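(* Let $N\ge 1$, $p>1$, $m\ge 0$, $\mu\ge 0$, $\nu\ge 0$, and assume $\delta:=(\mu-1)^2-4\nu^2\ge 0$. Let $R>0$ and let $u_0\in H^1(\mathbb{R}^N)$, $u_1\in L^2(\mathbb{R}^N)$ be non-negative, supported in the ball $B_{\mathbb{R}^N}(0,R)$, not both identically zero, and such that $$\frac{\mu-1-\sqrt{\delta}}{2}u_0(x)+u_1(x)>0 \quad\text{for a.e. } x\in B_{\mathbb{R}^N}(0,R).$$ Then there exists $\varepsilon_0=\varepsilon_0(u_0,u_1,N,R,p,m,\mu,\nu)>0$ such that for every $0<\varepsilon\le\varepsilon_0$, any weak solution $u$ of the Cauchy problem (P) on $[1,T)$ satisfying $$\operatorname{supp}(u)\subset\{(x,t)\in\mathbb{R}^N\times[1,\infty): |x|\le R+\phi_m(t)-\phi_m(1)\}$$ blows up in finite time, i.e. its maximal existence time $T_\varepsilon$ is finite, and it satisfies the following upper bounds, where $C>0$ is a constant independent of $\varepsilon$: For $N\ge 2$: $$T_\varepsilon\le \begin{cases} C\,\varepsilon^{-\frac{2(p-1)}{2-((1+m)(N-1)-m+\mu)(p-1)}} & \text{if } 1<p<p_T\big(N+\tfrac{\mu}{m+1},m\big),\\[1mm] \exp\big(C\varepsilon^{-(p-1)}\big) & \text{if } p=p_T\big(N+\tfrac{\mu}{m+1},m\big),\end{cases}$$ where $p_T(N',m):=1+\frac{2}{(1+m)(N'-1)-m}$, so that $p_T(N+\frac{\mu}{m+1},m)=1+\frac{2}{(1+m)(N-1)-m+\mu}$. For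 $N=1$: $$T_\varepsilon\le C\,\varepsilon^{-\frac{2(p-1)}{2-(\mu-m)(p-1)}}$$ if either $\mu\le m$ (and $p>1$ arbitrary), or $\mu>m$ and $1<p<1+\frac{2}{\mu-m}$; and $$T_\varepsilon\le \exp\big(C\varepsilon^{-(p-1)}\big)$$ if $\mu>m$ and $p=1+\frac{2}{\mu-m}$.
   Context: The Cauchy problem (P) is $$u_{tt}-t^{2m}\Delta u+\frac{\mu}{t}u_t+\frac{\nu^2}{t^2}u=|u_t|^p \ \text{ in } \mathbb{R}^N\times[1,\infty),\qquad u(x,1)=\varepsilon u_0(x),\ u_t(x,1)=\varepsilon u_1(x).$$ Notation: $\phi_m(t):=\frac{t^{1+m}}{1+m}$. A weak solution of (P) on $[1,T)$ is a function $u\in C([1,T),H^1(\mathbb{R}^N))\cap C^1([1,T),L^2(\mathbb{R}^N))$ with $u_t\in L^p_{loc}((1,T)\times\mathbb{R}^N)$, such that $u(\cdot,1)=\varepsilon u_0$ in $H^1(\mathbb{R}^N)$ and, for all $\Phi\in C_0^\infty(\mathbb{R}^N\times[1,T))$ and all $t\in[1,T)$, $$\int_{\mathbb{R}^N}u_t(x,t)\Phi(x,t)dx-\varepsilon\int_{\mathbb{R}^N}u_1(x)\Phi(x,1)dx-\int_1^t\!\!\int_{\mathbb{R}^N}u_t\Phi_t\,dx\,ds+\int_1^t\!\!\int_{\mathbb{R}^N}s^{2m}\nabla u\cdot\nabla\Phi\,dx\,ds+\int_1^t\!\!\int_{\mathbb{R}^N}\frac{\mu}{s}u_t\Phi\,dx\,ds+\int_1^t\!\!\int_{\mathbb{R}^N}\frac{\nu^2}{s^2}u\Phi\,dx\,ds=\int_1^t\!\!\int_{\mathbb{R}^N}|u_t|^p\Phi\,dx\,ds.$$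 *)

theory Defs
  imports "HOL-Analysis.Analysis"
begin

coinductive smooth_fun :: "('a::euclidean_space \<Rightarrow> real) \<Rightarrow> bool" where
  "(\<forall>x. f differentiable (at x)) \<Longrightarrow>
   (\<forall>i\<in>Basis. smooth_fun (\<lambda>x. frechet_derivative f (at x) i)) \<Longrightarrow> smooth_fun f"

definition test_fn :: "(real^'n \<Rightarrow> real) \<Rightarrow> bool" where
  "test_fn \<phi> \<longleftrightarrow> smooth_fun \<phi> \<and> (\<exists>r. \<forall>x. r \<le> norm x \<longrightarrow> \<phi> x = 0)"

definition pdx :: "(real^'n \<Rightarrow> real) \<Rightarrow> 'n \<Rightarrow> real^'n \<Rightarrow> real" where
  "pdx \<phi> i x = frechet_derivative \<phi> (at x) (axis i 1)"

definition L2 :: "(real^'n \<Rightarrow> real) \<Rightarrow> bool" where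
  "L2 f \<longleftrightarrow> f \<in> borel_measurable lborel \<and> integrable lborel (\<lambda>x. (f x)^2)"

definition L2dist2 :: "(real^'n \<Rightarrow> real) \<Rightarrow> (real^'n \<Rightarrow> real) \<Rightarrow> real" where
  "L2dist2 f g = (LINT x|lborel. (f x - g x)^2)"

definition weak_grad :: "(real^'n \<Rightarrow> real) \<Rightarrow> (real^'n \<Rightarrow> real^'n) \<Rightarrow> bool" where
  "weak_grad f g \<longleftrightarrow> (\<forall>\<phi>. test_fn \<phi> \<longrightarrow> (\<forall>i.
      (LINT x|lborel. f x * pdx \<phi> i x) = - (LINT x|lborel. g x $ i * \<phi> x)))"

definition H1 :: "(real^'n \<Rightarrow> real) \<Rightarrow> bool" where
  "H1 f \<longleftrightarrow> L2 f \<and> (\<exists>g. weak_grad f g \<and> (\<forall>i. L2 (\<lambda>x. g x $ i)))"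

text \<open>Test functions in C_0^infinity(R^N x [1,T)): (restrictions of) smooth functions on
  R^{N+1} vanishing for |x| large and for t near T.\<close>
definition test_fn_T :: "real \<Rightarrow> (real^'n \<Rightarrow> real \<Rightarrow> real) \<Rightarrow> bool" where
  "test_fn_T T \<Phi> \<longleftrightarrow> smooth_fun (\<lambda>z. \<Phi> (fst z) (snd z)) \<and>
     (\<exists>r T'. T' < T \<and> (\<forall>x t. r \<le> norm x \<or> T' \<le> t \<longrightarrow> \<Phi> x t = 0))"

definition dt_T :: "(real^'n \<Rightarrow> real \<Rightarrow> real) \<Rightarrow> real^'n \<Rightarrow> real \<Rightarrow> real" where
  "dt_T \<Phi> x t = frechet_derivative (\<lambda>z. \<Phi> (fst z) (snd z)) (at (x, t)) (0, 1)"

definition dx_T :: "(real^'n \<Rightarrow> real \<Rightarrow> real) \<Rightarrow> 'n \<Rightarrow> real^'n \<Rightarrow> real \<Rightarrow> real" where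
  "dx_T \<Phi> i x t = frechet_derivative (\<lambda>z. \<Phi> (fst z) (snd z)) (at (x, t)) (axis i 1, 0)"

definition phi_m :: "real \<Rightarrow> real \<Rightarrow> real" where
  "phi_m m t = t powr (1 + m) / (1 + m)"

definition weak_sol ::
  "real \<Rightarrow> real \<Rightarrow> real \<Rightarrow> real \<Rightarrow> real \<Rightarrow> (real^'n \<Rightarrow> real) \<Rightarrow> (real^'n \<Rightarrow> real)
   \<Rightarrow> real \<Rightarrow> (real^'n \<Rightarrow> real \<Rightarrow> real) \<Rightarrow> bool" where
  "weak_sol m \<mu> \<nu> p \<epsilon> u0 u1 T u \<longleftrightarrow> 1 < T \<and>
   (\<exists>G :: real^'n \<Rightarrow> real \<Rightarrow> real^'n. \<exists>v :: real^'n \<Rightarrow> real \<Rightarrow> real.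
     \<comment> \<open>u in C([1,T),H^1), with gradient G\<close>
     (\<forall>t\<in>{1..<T}. L2 (\<lambda>x. u x t) \<and> weak_grad (\<lambda>x. u x t) (\<lambda>x. G x t)
        \<and> (\<forall>i. L2 (\<lambda>x. G x t $ i)) \<and> L2 (\<lambda>x. v x t)) \<and>
     (\<forall>t\<in>{1..<T}. ((\<lambda>s. L2dist2 (\<lambda>x. u x s) (\<lambda>x. u x t)) \<longlongrightarrow> 0) (at t within {1..<T})) \<and>
     (\<forall>t\<in>{1..<T}. \<forall>i. ((\<lambda>s. L2dist2 (\<lambda>x. G x s $ i) (\<lambda>x. G x t $ i)) \<longlongrightarrow> 0) (at t within {1..<T})) \<and>
     \<comment> \<open>u in C^1([1,T),L^2), with derivative v\<close>
     (\<forall>t\<in>{1..<T}. ((\<lambda>s. L2dist2 (\<lambda>x. (u x s - u x t) / (s - t)) (\<lambda>x. v x t)) \<longlongrightarrow> 0) (at t within {1..<T})) \<and>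
     (\<forall>t\<in>{1..<T}. ((\<lambda>s. L2dist2 (\<lambda>x. v x s) (\<lambda>x. v x t)) \<longlongrightarrow> 0) (at t within {1..<T})) \<and>
     \<comment> \<open>u_t in L^p_loc((1,T) x R^N)\<close>
     (\<forall>K. compact K \<and> K \<subseteq> UNIV \<times> {1<..<T} \<longrightarrow>
        set_borel_measurable lborel K (\<lambda>z. v (fst z) (snd z)) \<and>
        set_integrable lborel K (\<lambda>z. \<bar>v (fst z) (snd z)\<bar> powr p)) \<and>
     \<comment> \<open>initial datum\<close>
     (AE x in lborel. u x 1 = \<epsilon> * u0 x) \<and>
     \<comment> \<open>weak formulation\<close>
     (\<forall>\<Phi>. test_fn_T T \<Phi> \<longrightarrow> (\<forall>t\<in>{1..<T}.
        (LINT x|lborel. v x t * \<Phi> x t)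
        - \<epsilon> * (LINT x|lborel. u1 x * \<Phi> x 1)
        - (LINT s:{1..t}|lborel. (LINT x|lborel. v x s * dt_T \<Phi> x s))
        + (LINT s:{1..t}|lborel. (LINT x|lborel. s powr (2 * m) * (\<Sum>i\<in>UNIV. G x s $ i * dx_T \<Phi> i x s)))
        + (LINT s:{1..t}|lborel. (LINT x|lborel. \<mu> / s * v x s * \<Phi> x s))
        + (LINT s:{1..t}|lborel. (LINT x|lborel. \<nu>^2 / s^2 * u x s * \<Phi> x s))
        = (LINT s:{1..t}|lborel. (LINT x|lborel. \<bar>v x s\<bar> powr p * \<Phi> x s)))))"

end

theory Submission
  imports Defs
begin

text \<open>
  Let \<open>eig\<close> be the positive radial solution of \<open>\<Delta> eig = eig\<close>. Testing the equation with
  \<open>eig\<close> reduces it to a scalar problem: \<open>U t = \<integral> u eig\<close> has derivative \<open>V t = \<integral> u\<^sub>t eig\<close> and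
  \<open>V' + (\<mu> / t) V + (\<nu>\<^sup>2 / t\<^sup>2 - t\<^sup>2\<^sup>m) U = \<integral> |u\<^sub>t|\<^sup>p eig\<close>. Since \<open>u\<close> lives in the light cone and the mass of
  \<open>eig\<close> in a ball of radius \<open>r\<close> is \<open>O(r\<^bsup>(N - 1) / 2\<^esup> e\<^sup>r)\<close>, Hoelder's inequality bounds the right-hand side from below by
  a multiple of \<open>|V|\<^sup>p (e\<^bsup>phi_m m t\<^esup> t\<^bsup>(1 + m) (N - 1) / 2\<^esup>)\<^bsup>1 - p\<^esup>\<close>.

  The condition \<open>\<delta> \<ge> 0\<close> factorises the Euler part of the scalar operator over the reals, and together with
  the sign condition on the data this keeps \<open>U\<close> and a first-order expression in \<open>U\<close> positive. After the
  Liouville transform, with \<open>g\<close> the transformed function and \<open>\<gamma>\<close> its derivative in the new time,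
  first \<open>\<gamma> \<ge> g / 2\<close> for large times; then \<open>Z\<close>, which is \<open>g + \<gamma>\<close> divided by its linear growth,
  satisfies \<open>Z' \<ge> c t\<^bsup>- \<kappa> (p - 1) / 2\<^esup> Z\<^sup>p\<close> with \<open>\<kappa> = (1 + m) (N - 1) - m + \<mu>\<close>. Integrating this inequality
  gives the lifespan bounds. As \<open>V\<close> need not be differentiable, differential inequalities for it are
  understood for the lower right Dini derivative.
\<close>

section \<open>Smooth functions\<close>

text \<open>\<open>eig\<close> grows exponentially and is not an admissible test function. As
  \<open>u\<close> stays in the light cone, multiplying \<open>eig\<close> by a cutoff that equals 1
  beyond the cone changes none of the integrals and gives one. The L^p bound on \<open>u_t\<close>
  is local in the open interval (1,T), away from the initial time, so the nonlinear term is known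
  only as an integrable function of time with a continuous lower bound. Hence the increments of
  \<open>V\<close>, not a derivative, carry the equation. The exponent \<kappa> / 2 is the sum of
  two powers of t: (\<mu> - m) / 2 from the Liouville weight, and (1 + m)(N - 1) / 2 from the mass
  of \<open>eig\<close>, where the Bessel decay halves the power of the volume of a shell. The time
  from which \<open>Z\<close> obeys its inequality depends on m, \<mu>, \<nu> only, never on
  \<epsilon> or T; the data enter through a lower bound of \<open>Z\<close> at that time, which is
  linear in \<epsilon>. Integrating with an arbitrary antiderivative of the power of t then serves
  the power case and the logarithmic case at once.\<close>

lemma smooth_fun_differentiable: "smooth_fun f \<Longrightarrow> f differentiable (at x)"
  by (erule smooth_fun.cases) blast

lemma smooth_fun_partial:
  "smooth_fun f \<Longrightarrow> i \<in> Basis \<Longrightarrow> smooth_fun (\<lambda>x. frechet_derivative f (at x) i)"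
  by (erule smooth_fun.cases) blast

lemma smooth_fun_DERIV:
  fixes f :: "real \<Rightarrow> real"
  assumes "smooth_fun f"
  shows "(f has_real_derivative deriv f x) (at x)"
  using smooth_fun_differentiable[OF assms]
  by (simp add: DERIV_deriv_iff_real_differentiable)

lemma frechet_derivative_real:
  fixes f :: "real \<Rightarrow> real"
  assumes "(f has_real_derivative D) (at x)"
  shows "frechet_derivative f (at x) 1 = D"
  using frechet_derivative_at[OF assms[unfolded has_field_derivative_def], symmetric] by simp

text \<open>Coinduction on products alone fails, since the partial derivatives of a product are sums
  of products. The closure of the smooth functions under all these operations is itself closed under
  partial derivatives, by the rules of differentiation, and so serves as coinduction
  invariant.\<close>

inductive smooth_alg :: "('a::euclidean_space \<Rightarrow> real) \<Rightarrow> bool" where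
  base: "smooth_fun f \<Longrightarrow> smooth_alg f"
| add: "smooth_alg f \<Longrightarrow> smooth_alg g \<Longrightarrow> smooth_alg (\<lambda>x. f x + g x)"
| mult: "smooth_alg f \<Longrightarrow> smooth_alg g \<Longrightarrow> smooth_alg (\<lambda>x. f x * g x)"
| comp: "smooth_fun (g :: real \<Rightarrow> real) \<Longrightarrow> smooth_alg f \<Longrightarrow> smooth_alg (\<lambda>x. g (f x))"
| inverse: "smooth_alg f \<Longrightarrow> (\<And>x. f x \<noteq> 0) \<Longrightarrow> smooth_alg (\<lambda>x. inverse (f x))"

lemma smooth_fun_const: "smooth_fun (\<lambda>x. c)"
proof -
  have "\<exists>c. f = (\<lambda>x. c) \<Longrightarrow> smooth_fun f" for f :: "'a \<Rightarrow> real"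
    by (coinduction arbitrary: f) auto
  thus ?thesis by blast
qed

lemma smooth_fun_bounded_linear:
  fixes f :: "'a::euclidean_space \<Rightarrow> real"
  assumes "bounded_linear f"
  shows "smooth_fun f"
proof (rule smooth_fun.intros)
  have d: "(f has_derivative f) (at x)" for x
    using assms by (rule bounded_linear_imp_has_derivative)
  show "\<forall>x. f differentiable (at x)"
    using d unfolding differentiable_def by blast
  show "\<forall>i\<in>Basis. smooth_fun (\<lambda>x. frechet_derivative f (at x) i)"
    using frechet_derivative_at[OF d, symmetric] by (simp add: smooth_fun_const)
qed

lemma smooth_alg_step:
  assumes "smooth_alg f"
  shows "(\<forall>x. f differentiable (at x)) \<and>
    (\<forall>i\<in>Basis. smooth_alg (\<lambda>x. frechet_derivative f (at x) i))"
  using assms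
proof induction
  case (base f)
  then show ?case
    by (auto intro: smooth_alg.base smooth_fun_differentiable smooth_fun_partial)
next
  case (add f g)
  have d: "((\<lambda>x. f x + g x) has_derivative
      (\<lambda>h. frechet_derivative f (at x) h + frechet_derivative g (at x) h)) (at x)" for x
    using add by (intro has_derivative_add) (auto simp: frechet_derivative_works[symmetric])
  show ?case
    using add d frechet_derivative_at[OF d, symmetric]
    by (auto simp: differentiable_def intro!: smooth_alg.add)
next
  case (mult f g)
  have d: "((\<lambda>x. f x * g x) has_derivative
      (\<lambda>h. f x * frechet_derivative g (at x) h + frechet_derivative f (at x) h * g x)) (at x)" for x
    using mult by (intro has_derivative_mult) (auto simp: frechet_derivative_works[symmetric])
  show ?case
    using mult d frechet_derivative_at[OF d, symmetric]
    by (auto simp: differentiable_def intro!: smooth_alg.add smooth_alg.mult)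
next
  case (comp g f)
  have d: "((\<lambda>x. g (f x)) has_derivative
      (\<lambda>h. frechet_derivative g (at (f x)) 1 * frechet_derivative f (at x) h)) (at x)" for x
  proof -
    have 1: "(g has_derivative (*) (frechet_derivative g (at (f x)) 1)) (at (f x))"
      using smooth_fun_DERIV[OF comp(1), of "f x"]
      by (simp add: has_field_derivative_def frechet_derivative_real)
    have 2: "(f has_derivative frechet_derivative f (at x)) (at x)"
      using comp by (simp add: frechet_derivative_works[symmetric])
    show ?thesis
      using has_derivative_compose[OF 2 1] .
  qed
  have "smooth_alg (\<lambda>x. frechet_derivative g (at (f x)) 1)"
    using smooth_fun_partial[OF comp(1), of 1] comp(2)
    by (auto intro: smooth_alg.comp[of "\<lambda>y. frechet_derivative g (at y) 1"])
  then show ?case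
    using comp d frechet_derivative_at[OF d, symmetric]
    by (auto simp: differentiable_def intro!: smooth_alg.mult)
next
  case (inverse f)
  have d: "((\<lambda>x. inverse (f x)) has_derivative
      (\<lambda>h. -1 * (inverse (f x) * frechet_derivative f (at x) h * inverse (f x)))) (at x)" for x
    using Deriv.has_derivative_inverse[of f x "frechet_derivative f (at x)" UNIV] inverse
    by (auto simp: frechet_derivative_works[symmetric])
  have "smooth_alg (\<lambda>x. -1 * (inverse (f x) * frechet_derivative f (at x) h * inverse (f x)))"
    if "h \<in> Basis" for h
    using that inverse
    by (intro smooth_alg.mult smooth_alg.inverse smooth_alg.base[OF smooth_fun_const]) auto
  then show ?case
    using inverse d frechet_derivative_at[OF d, symmetric]
    by (auto simp: differentiable_def)
qed

lemma smooth_alg_imp_smooth_fun: "smooth_alg f \<Longrightarrow> smooth_fun f"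
  by (coinduction arbitrary: f) (use smooth_alg_step in auto)

lemma smooth_fun_add: "smooth_fun f \<Longrightarrow> smooth_fun g \<Longrightarrow> smooth_fun (\<lambda>x. f x + g x)"
  by (rule smooth_alg_imp_smooth_fun) (auto intro: smooth_alg.intros)

lemma smooth_fun_mult: "smooth_fun f \<Longrightarrow> smooth_fun g \<Longrightarrow> smooth_fun (\<lambda>x. f x * g x)"
  by (rule smooth_alg_imp_smooth_fun) (auto intro: smooth_alg.intros)

lemma smooth_fun_compose:
  fixes g :: "real \<Rightarrow> real"
  shows "smooth_fun g \<Longrightarrow> smooth_fun f \<Longrightarrow> smooth_fun (\<lambda>x. g (f x))"
  by (rule smooth_alg_imp_smooth_fun) (auto intro: smooth_alg.intros)

lemma smooth_fun_inverse:
  "smooth_fun f \<Longrightarrow> (\<And>x. f x \<noteq> 0) \<Longrightarrow> smooth_fun (\<lambda>x. inverse (f x))"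
  by (rule smooth_alg_imp_smooth_fun) (auto intro: smooth_alg.intros)

lemma smooth_fun_sum:
  assumes "\<And>i. i \<in> I \<Longrightarrow> smooth_fun (f i)"
  shows "smooth_fun (\<lambda>x. \<Sum>i\<in>I. f i x)"
  using assms
  by (induction I rule: infinite_finite_induct) (auto intro: smooth_fun_const smooth_fun_add)

lemma smooth_fun_inner_self: "smooth_fun (\<lambda>x. x \<bullet> x)"
  unfolding euclidean_inner[of x x for x]
  by (intro smooth_fun_sum smooth_fun_mult smooth_fun_bounded_linear bounded_linear_inner_left)

lemma smooth_fun_continuous_on: "smooth_fun f \<Longrightarrow> continuous_on S f"
  by (simp add: differentiable_imp_continuous_on differentiable_at_imp_differentiable_on
      smooth_fun_differentiable)

lemma smooth_fun_deriv:
  fixes f :: "real \<Rightarrow> real"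
  assumes "smooth_fun f"
  shows "smooth_fun (deriv f)"
  using smooth_fun_partial[OF assms, of 1] frechet_derivative_real[OF smooth_fun_DERIV[OF assms]]
  by simp

text \<open>The basis of the line is the single vector 1, so one derivative per step is enough. The
  invariant \<open>X\<close> is instantiated by the flat functions \<open>exp_flat q\<close> and by
  the everywhere convergent power series.\<close>

lemma smooth_fun_realI:
  fixes f :: "real \<Rightarrow> real"
  assumes "X f"
    and step: "\<And>f. X f \<Longrightarrow> \<exists>f'. X f' \<and> (\<forall>x. (f has_real_derivative f' x) (at x))"
  shows "smooth_fun f"
  using assms(1)
proof (coinduction arbitrary: f)
  case (smooth_fun f)
  then obtain f' where f': "X f'" "\<And>x. (f has_real_derivative f' x) (at x)"
    using step by blast
  have "(\<lambda>x. frechet_derivative f (at x) 1) = f'"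
    using frechet_derivative_real[OF f'(2)] by auto
  with f' show ?case
    by (auto simp: real_differentiable_def)
qed

section \<open>Flat functions, cutoffs and entire power series on the line\<close>

lemma power_div_exp_inverse_tendsto_0:
  "((\<lambda>s::real. inverse s ^ k * exp (- inverse s)) \<longlongrightarrow> 0) (at_right 0)"
  using filterlim_compose[OF tendsto_power_div_exp_0 filterlim_inverse_at_top_right, of k]
  by (simp add: exp_minus divide_inverse)

lemma poly_exp_inverse_tendsto_0:
  "((\<lambda>s::real. poly q (inverse s) * exp (- inverse s)) \<longlongrightarrow> 0) (at_right 0)"
proof -
  have "((\<lambda>s::real. \<Sum>i\<le>degree q. coeff q i * (inverse s ^ i * exp (- inverse s))) \<longlongrightarrow> 0) (at_right 0)"
    by (rule tendsto_null_sum) (intro tendsto_mult_right_zero power_div_exp_inverse_tendsto_0)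
  thus ?thesis
    by (simp add: poly_altdef sum_distrib_right mult.assoc)
qed

text \<open>The classical flat function e^(-1/s), with a polynomial in 1/s in front so that the
  family is closed under differentiation.\<close>

definition exp_flat :: "real poly \<Rightarrow> real \<Rightarrow> real" where
  "exp_flat q s = (if s > 0 then poly q (inverse s) * exp (- inverse s) else 0)"

text \<open>With y = 1/s the operator d/ds is -y^2 d/dy, which maps q(y) e^(-y) to y^2 (q - q')(y)
  e^(-y); the factor y^2 is \<open>[:0, 0, 1:]\<close>. At 0 the right difference quotient is again
  of this form, with y q(y) in place of q(y), and tends to 0.\<close>

lemma exp_flat_DERIV:
  "(exp_flat q has_real_derivative exp_flat ([:0, 0, 1:] * (q - pderiv q)) s) (at s)"
proof (cases s "0::real" rule: linorder_cases)
  case less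
  have "\<forall>\<^sub>F x in nhds s. exp_flat q x = 0"
    using eventually_nhds_in_open[of "{..<0}" s] less
    by (auto simp: exp_flat_def elim!: eventually_mono)
  with less show ?thesis
    by (subst DERIV_cong_ev[OF refl _ refl, where g = "\<lambda>_. 0"]) (auto simp: exp_flat_def)
next
  case greater
  have ev: "\<forall>\<^sub>F x in nhds s. exp_flat q x = poly q (inverse x) * exp (- inverse x)"
    using eventually_nhds_in_open[of "{0<..}" s] greater
    by (auto simp: exp_flat_def elim!: eventually_mono)
  have "((\<lambda>x. poly q (inverse x) * exp (- inverse x)) has_real_derivative
      exp_flat ([:0, 0, 1:] * (q - pderiv q)) s) (at s)"
    using greater
    by (auto intro!: derivative_eq_intros DERIV_chain2[OF poly_DERIV]
        simp: exp_flat_def algebra_simps power2_eq_square divide_simps)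
  then show ?thesis
    by (subst DERIV_cong_ev[OF refl ev refl])
next
  case equal
  have "((\<lambda>h. exp_flat q h / h) \<longlongrightarrow> 0) (at_left 0)"
    by (rule tendsto_eventually) (auto simp: exp_flat_def eventually_at_filter)
  moreover have "((\<lambda>h. exp_flat q h / h) \<longlongrightarrow> 0) (at_right 0)"
  proof (rule Lim_transform_eventually[OF poly_exp_inverse_tendsto_0[of "[:0,1:] * q"]])
    show "\<forall>\<^sub>F s in at_right 0. poly ([:0, 1:] * q) (inverse s) * exp (- inverse s) = exp_flat q s / s"
      by (auto simp: exp_flat_def eventually_at_filter divide_inverse)
  qed
  ultimately have "((\<lambda>h. exp_flat q h / h) \<longlongrightarrow> 0) (at 0)"
    by (rule filterlim_split_at)
  with equal show ?thesis
    by (simp add: DERIV_def exp_flat_def[of _ 0])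
qed

lemma smooth_fun_exp_flat: "smooth_fun (exp_flat q)"
  by (rule smooth_fun_realI[where X = "\<lambda>f. \<exists>q. f = exp_flat q"]) (use exp_flat_DERIV in blast)+

text \<open>The quotient f / (f + g) of two flat functions, f vanishing for x >= b and g for x <= a;
  as a < b they never vanish together.\<close>

lemma smooth_cutoff_exists:
  fixes a b :: real
  assumes "a < b"
  obtains \<zeta> :: "real \<Rightarrow> real" where "smooth_fun \<zeta>" "\<And>x. 0 \<le> \<zeta> x" "\<And>x. x \<le> a \<Longrightarrow> \<zeta> x = 1"
    "\<And>x. b \<le> x \<Longrightarrow> \<zeta> x = 0"
proof -
  define f where "f = (\<lambda>x. exp_flat 1 (b + (-1) * x))"
  define g where "g = (\<lambda>x. exp_flat 1 (x + (- a)))"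
  have lin: "smooth_fun (\<lambda>x::real. x)"
    by (rule smooth_fun_bounded_linear) (rule bounded_linear_ident)
  have fg: "smooth_fun f" "smooth_fun g"
    unfolding f_def g_def
    by (intro smooth_fun_compose[OF smooth_fun_exp_flat] smooth_fun_add smooth_fun_mult
        smooth_fun_const lin)+
  have nn: "f x \<ge> 0" "g x \<ge> 0" for x
    by (auto simp: f_def g_def exp_flat_def)
  have pos: "f x + g x > 0" for x
    using assms nn[of x] by (cases "x > a") (auto simp: f_def g_def exp_flat_def add_pos_nonneg)
  show ?thesis
  proof (rule that[of "\<lambda>x. f x * inverse (f x + g x)"])
    show "smooth_fun (\<lambda>x. f x * inverse (f x + g x))"
      by (intro smooth_fun_mult smooth_fun_inverse smooth_fun_add fg) (metis pos less_irrefl)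
    show "0 \<le> f x * inverse (f x + g x)" for x
      using nn pos[of x] by simp
    show "f x * inverse (f x + g x) = 1" if "x \<le> a" for x
      using that pos[of x] by (auto simp: g_def exp_flat_def)
    show "f x * inverse (f x + g x) = 0" if "b \<le> x" for x
      using that by (auto simp: f_def exp_flat_def)
  qed
qed

lemma smooth_fun_power_series:
  fixes c :: "nat \<Rightarrow> real"
  assumes "\<And>x. summable (\<lambda>n. c n * x ^ n)"
  shows "smooth_fun (\<lambda>x. \<Sum>n. c n * x ^ n)"
proof (rule smooth_fun_realI[where X = "\<lambda>f. \<exists>c::nat \<Rightarrow> real.
      (\<forall>x. summable (\<lambda>n. c n * x ^ n)) \<and> f = (\<lambda>x. \<Sum>n. c n * x ^ n)"])
  fix f :: "real \<Rightarrow> real"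
  assume "\<exists>c::nat \<Rightarrow> real. (\<forall>x. summable (\<lambda>n. c n * x ^ n)) \<and> f = (\<lambda>x. \<Sum>n. c n * x ^ n)"
  then obtain c :: "nat \<Rightarrow> real" where c: "\<And>x. summable (\<lambda>n. c n * x ^ n)"
    and f: "f = (\<lambda>x. \<Sum>n. c n * x ^ n)" by blast
  show "\<exists>f'. (\<exists>c::nat \<Rightarrow> real. (\<forall>x. summable (\<lambda>n. c n * x ^ n)) \<and> f' = (\<lambda>x. \<Sum>n. c n * x ^ n)) \<and>
      (\<forall>x. (f has_real_derivative f' x) (at x))"
    unfolding f using termdiffs_strong_converges_everywhere[OF c] termdiff_converges_all[OF c]
    by blast
qed (use assms in blast)

section \<open>The radial eigenfunction of the Laplacian\<close>

text \<open>The Laplacian of F(|x|^2) is 4 r F'' + 2 N F' at r = |x|^2, and equating it to F gives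
  this recursion for the Taylor coefficients. The series is 0F1(; N/2; r/4), a modified Bessel
  function up to a power; for N = 1 it is cosh |x|. With |x|^2 as variable, smoothness at the origin
  is automatic.\<close>

fun radial_coeff :: "nat \<Rightarrow> nat \<Rightarrow> real" where
  "radial_coeff N 0 = 1"
| "radial_coeff N (Suc k) = radial_coeff N k / (real (k + 1) * (4 * real k + 2 * real N))"

definition radial_fun :: "nat \<Rightarrow> real \<Rightarrow> real" where
  "radial_fun N r = (\<Sum>k. radial_coeff N k * r ^ k)"

lemma radial_coeff_pos: "N \<ge> 1 \<Longrightarrow> radial_coeff N k > 0"
  by (induction k) (auto intro!: divide_pos_pos mult_pos_pos add_nonneg_pos)

text \<open>\<open>radial_coeff N k * (2 * k)!\<close> decays like \<open>k\<close> to the power \<open>- (N - 1) / 2\<close>; squaring turns this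
  into a statement about factorials.\<close>

lemma radial_coeff_square:
  assumes "N \<ge> 1"
  shows "(radial_coeff N k)\<^sup>2 * fact (2 * k) * fact (2 * k + N - 1) \<le> fact (N - 1)"
proof (induction k)
  case 0
  then show ?case by simp
next
  case (Suc k)
  define c where "c = radial_coeff N k"
  define x where "x = real k"
  define n where "n = real N"
  have n: "n \<ge> 1" "x \<ge> 0" using assms by (auto simp: n_def x_def)
  have f1: "fact (2 * Suc k) = (2 * x + 2) * (2 * x + 1) * (fact (2 * k) :: real)"
    by (simp add: x_def algebra_simps)
  obtain j where j: "N = Suc j" using assms by (cases N) auto
  have f2: "fact (2 * Suc k + N - 1) = (2 * x + n + 1) * (2 * x + n) * (fact (2 * k + N - 1) :: real)"
    by (simp add: x_def n_def j algebra_simps)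
  have rc: "radial_coeff N (Suc k) = c / ((x + 1) * (4 * x + 2 * n))"
    by (simp add: c_def x_def n_def add.commute)
  define \<rho> where "\<rho> = (2 * x + 2) * (2 * x + 1) * ((2 * x + n + 1) * (2 * x + n)) / ((x + 1) * (4 * x + 2 * n))\<^sup>2"
  have "\<rho> \<le> 1"
  proof -
    have "(2 * x + 2) * (2 * x + 1) * ((2 * x + n + 1) * (2 * x + n)) \<le> ((x + 1) * (4 * x + 2 * n))\<^sup>2"
    proof -
      \<comment> \<open>The two sides differ by n - 1; equality at N = 1 is the cosh series.\<close>
      have "(2 * x + 1) * (2 * x + n + 1) \<le> (2 * x + 2) * (2 * x + n)"
        using n by (simp add: algebra_simps)
      hence "((2 * x + 2) * (2 * x + n)) * ((2 * x + 1) * (2 * x + n + 1))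
          \<le> ((2 * x + 2) * (2 * x + n)) * ((2 * x + 2) * (2 * x + n))"
        using n by (intro mult_left_mono) auto
      also have "\<dots> = ((x + 1) * (4 * x + 2 * n))\<^sup>2"
        by (simp add: power2_eq_square algebra_simps)
      finally show ?thesis by (simp add: mult_ac)
    qed
    moreover have "((x + 1) * (4 * x + 2 * n))\<^sup>2 > 0"
      using n by (simp add: add_nonneg_eq_0_iff)
    ultimately show ?thesis by (simp add: \<rho>_def)
  qed
  have "(radial_coeff N (Suc k))\<^sup>2 * fact (2 * Suc k) * fact (2 * Suc k + N - 1)
      = \<rho> * (c\<^sup>2 * fact (2 * k) * fact (2 * k + N - 1))"
    unfolding f1 f2 rc \<rho>_def by (simp add: power_divide)
  also have "\<dots> \<le> 1 * (c\<^sup>2 * fact (2 * k) * fact (2 * k + N - 1))"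
    using \<open>\<rho> \<le> 1\<close> by (intro mult_right_mono) auto
  also have "\<dots> \<le> fact (N - 1)" using Suc by (simp add: c_def)
  finally show ?case .
qed

text \<open>The bound on the square makes the term at most the geometric mean of the exponential
  terms of index 2k and 2k + N - 1, the power r^(-(N - 1)/2) balancing the two indices. The
  arithmetic mean then replaces the geometric one.\<close>

lemma radial_term_le:
  assumes "N \<ge> 1" "r > 0"
  shows "radial_coeff N k * (r\<^sup>2) ^ k \<le> sqrt (fact (N - 1)) * r powr (- ((real N - 1) / 2)) *
    ((inverse (fact (2 * k)) * r ^ (2 * k) + inverse (fact (2 * k + (N - 1))) * r ^ (2 * k + (N - 1))) / 2)"
proof -
  define x where "x = inverse (fact (2 * k)) * r ^ (2 * k)"
  define y where "y = inverse (fact (2 * k + (N - 1))) * r ^ (2 * k + (N - 1))"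
  have xy: "x > 0" "y > 0" using assms by (auto simp: x_def y_def)
  have N': "2 * k + N - 1 = 2 * k + (N - 1)" using assms by simp
  have "(radial_coeff N k * (r\<^sup>2) ^ k)\<^sup>2 * r ^ (N - 1) \<le> fact (N - 1) * (x * y)"
  proof -
    have "(radial_coeff N k)\<^sup>2 \<le> fact (N - 1) / (fact (2 * k) * fact (2 * k + (N - 1)))"
      using radial_coeff_square[OF assms(1), of k] unfolding N' by (simp add: field_simps)
    hence "(radial_coeff N k)\<^sup>2 * (r ^ (2 * k) * r ^ (2 * k + (N - 1)))
       \<le> fact (N - 1) / (fact (2 * k) * fact (2 * k + (N - 1))) * (r ^ (2 * k) * r ^ (2 * k + (N - 1)))"
      using assms by (intro mult_right_mono) auto
    also have "\<dots> = fact (N - 1) * (x * y)"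
      by (simp add: x_def y_def field_simps)
    also have "(radial_coeff N k)\<^sup>2 * (r ^ (2 * k) * r ^ (2 * k + (N - 1)))
       = (radial_coeff N k * (r\<^sup>2) ^ k)\<^sup>2 * r ^ (N - 1)"
    proof -
      have "(r\<^sup>2) ^ k = r ^ (2 * k)" by (simp add: power_mult)
      thus ?thesis by (simp add: power_add power2_eq_square mult_ac)
    qed
    finally show ?thesis .
  qed
  hence "sqrt ((radial_coeff N k * (r\<^sup>2) ^ k)\<^sup>2 * r ^ (N - 1)) \<le> sqrt (fact (N - 1) * (x * y))"
    by (rule real_sqrt_le_mono)
  hence "(radial_coeff N k * (r\<^sup>2) ^ k) * sqrt (r ^ (N - 1)) \<le> sqrt (fact (N - 1)) * sqrt (x * y)"
    using radial_coeff_pos[OF assms(1), of k] assms(2) by (simp add: real_sqrt_mult)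
  also have "\<dots> \<le> sqrt (fact (N - 1)) * ((x + y) / 2)"
    using xy arith_geo_mean_sqrt[of x y] by (intro mult_left_mono) auto
  finally have 1: "(radial_coeff N k * (r\<^sup>2) ^ k) * sqrt (r ^ (N - 1)) \<le> sqrt (fact (N - 1)) * ((x + y) / 2)" .
  have "sqrt (r ^ (N - 1)) = r powr ((real N - 1) / 2)"
    using assms by (simp add: powr_half_sqrt[symmetric] powr_realpow[symmetric] powr_powr of_nat_diff)
  with 1 show ?thesis
    using assms unfolding x_def[symmetric] y_def[symmetric]
    by (simp add: powr_minus field_simps)
qed

lemma summable_even_exp:
  fixes r :: real
  assumes "r \<ge> 0"
  shows "summable (\<lambda>k. inverse (fact (2 * k + j)) * r ^ (2 * k + j))"
    "(\<Sum>k. inverse (fact (2 * k + j)) * r ^ (2 * k + j)) \<le> exp r"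
proof -
  have s: "summable (\<lambda>n. inverse (fact n) * r ^ n)"
    by (rule summable_exp)
  have inj: "inj (\<lambda>k. 2 * k + j)" by (auto simp: inj_def)
  show "summable (\<lambda>k. inverse (fact (2 * k + j)) * r ^ (2 * k + j))"
    using summable_reindex[OF s inj] assms by (simp add: o_def)
  have "(\<Sum>k. inverse (fact (2 * k + j)) * r ^ (2 * k + j)) \<le> (\<Sum>n. inverse (fact n) * r ^ n)"
    using suminf_reindex_mono[OF s inj] assms by (simp add: o_def)
  also have "\<dots> = exp r" by (simp add: exp_def scaleR_conv_of_real)
  finally show "(\<Sum>k. inverse (fact (2 * k + j)) * r ^ (2 * k + j)) \<le> exp r" .
qed

lemma summable_radial_coeff:
  assumes "N \<ge> 1"
  shows "summable (\<lambda>k. radial_coeff N k * r ^ k)"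
proof (cases "r = 0")
  case False
  define s where "s = sqrt \<bar>r\<bar>"
  have s: "s > 0" "s\<^sup>2 = \<bar>r\<bar>" using False by (auto simp: s_def)
  have sm: "summable (\<lambda>k. sqrt (fact (N - 1)) * s powr (- ((real N - 1) / 2)) *
    ((inverse (fact (2 * k)) * s ^ (2 * k) + inverse (fact (2 * k + (N - 1))) * s ^ (2 * k + (N - 1))) / 2))"
    using summable_even_exp(1)[of s 0] summable_even_exp(1)[of s "N - 1"] s
    by (intro summable_mult summable_divide summable_add) auto
  show ?thesis
  proof (rule summable_comparison_test'[OF sm, of 0])
    fix k :: nat
    have "norm (radial_coeff N k * r ^ k) = radial_coeff N k * (s\<^sup>2) ^ k"
      using radial_coeff_pos[OF assms, of k] s by (simp add: abs_mult power_abs)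
    also have "\<dots> \<le> sqrt (fact (N - 1)) * s powr (- ((real N - 1) / 2)) *
      ((inverse (fact (2 * k)) * s ^ (2 * k) + inverse (fact (2 * k + (N - 1))) * s ^ (2 * k + (N - 1))) / 2)"
      by (rule radial_term_le[OF assms s(1)])
    finally show "norm (radial_coeff N k * r ^ k) \<le> sqrt (fact (N - 1)) * s powr (- ((real N - 1) / 2)) *
      ((inverse (fact (2 * k)) * s ^ (2 * k) + inverse (fact (2 * k + (N - 1))) * s ^ (2 * k + (N - 1))) / 2)" .
  qed
qed simp

text \<open>Sums \<open>radial_term_le\<close>; each of the two subseries of the exponential series
  is at most e^r. The power of r in front is the sharp decay of the modified Bessel function, and
  the critical exponent depends on it.\<close>

lemma radial_fun_le:
  assumes "N \<ge> 1" "r > 0"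
  shows "radial_fun N (r\<^sup>2) \<le> sqrt (fact (N - 1)) * r powr (- ((real N - 1) / 2)) * exp r"
proof -
  define C where "C = sqrt (fact (N - 1)) * r powr (- ((real N - 1) / 2))"
  have C: "C \<ge> 0" by (simp add: C_def)
  let ?e = "\<lambda>j k. inverse (fact (2 * k + j)) * r ^ (2 * k + j)"
  have s: "summable (?e 0)" "summable (?e (N - 1))"
    using summable_even_exp(1)[of r 0] summable_even_exp(1)[of r "N - 1"] assms(2) by simp_all
  have "radial_fun N (r\<^sup>2) \<le> (\<Sum>k. C * ((?e 0 k + ?e (N - 1) k) / 2))"
    unfolding radial_fun_def
    using radial_term_le[OF assms] s summable_radial_coeff[OF assms(1)]
    by (intro suminf_le summable_mult summable_divide summable_add) (auto simp: C_def)
  also have "\<dots> = C * ((suminf (?e 0) + suminf (?e (N - 1))) / 2)"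
    using s by (simp only: suminf_mult suminf_divide suminf_add summable_divide summable_add)
  also have "\<dots> \<le> C * exp r"
    using summable_even_exp(2)[of r 0] summable_even_exp(2)[of r "N - 1"] assms C
    by (intro mult_left_mono) auto
  finally show ?thesis by (simp add: C_def)
qed

lemma radial_fun_pos:
  assumes "N \<ge> 1" "r \<ge> 0"
  shows "radial_fun N r > 0"
  unfolding radial_fun_def
  by (rule suminf_pos2[of _ 0])
    (use radial_coeff_pos[OF assms(1), THEN less_imp_le] assms(2) in
      \<open>auto intro!: mult_nonneg_nonneg summable_radial_coeff[OF assms(1)]\<close>)

lemma radial_fun_mono:
  assumes "N \<ge> 1" "0 \<le> r" "r \<le> s"
  shows "radial_fun N r \<le> radial_fun N s"
  unfolding radial_fun_def
  using radial_coeff_pos[OF assms(1), THEN less_imp_le] assms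
  by (intro suminf_le summable_radial_coeff[OF assms(1)]) (auto intro!: mult_left_mono power_mono)

lemma smooth_radial_fun: "N \<ge> 1 \<Longrightarrow> smooth_fun (radial_fun N)"
  using smooth_fun_power_series[OF summable_radial_coeff] by (simp add: radial_fun_def[abs_def])

text \<open>This is \<Delta> eig = eig in the variable r = |x|^2, checked coefficient by
  coefficient.\<close>

lemma radial_fun_ode:
  assumes "N \<ge> 1"
  shows "4 * r * deriv (deriv (radial_fun N)) r + 2 * real N * deriv (radial_fun N) r = radial_fun N r"
proof -
  define c where "c = radial_coeff N"
  note sc = summable_radial_coeff[OF assms, folded c_def]
  note sd = termdiff_converges_all[OF sc]
  note sdd = termdiff_converges_all[OF sd]
  have f: "radial_fun N = (\<lambda>x. \<Sum>n. c n * x ^ n)" by (auto simp: radial_fun_def c_def)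
  have d1: "deriv (radial_fun N) = (\<lambda>x. \<Sum>n. diffs c n * x ^ n)"
    unfolding f using termdiffs_strong_converges_everywhere[OF sc] DERIV_imp_deriv by blast
  have d2: "deriv (\<lambda>x. \<Sum>n. diffs c n * x ^ n) = (\<lambda>x. \<Sum>n. diffs (diffs c) n * x ^ n)"
    using termdiffs_strong_converges_everywhere[OF sd] DERIV_imp_deriv by blast
  define e where "e = (\<lambda>n. real n * diffs c n)"
  have e: "(\<lambda>n. e n * r ^ n) sums (r * (\<Sum>n. diffs (diffs c) n * r ^ n))"
  proof -
    have "(\<lambda>n. r * (diffs (diffs c) n * r ^ n)) sums (r * (\<Sum>n. diffs (diffs c) n * r ^ n))"
      by (intro sums_mult summable_sums sdd)
    also have "(\<lambda>n. r * (diffs (diffs c) n * r ^ n)) = (\<lambda>n. e (Suc n) * r ^ Suc n)"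
      by (auto simp: e_def diffs_def mult_ac)
    finally have "(\<lambda>n. e n * r ^ n) sums (r * (\<Sum>n. diffs (diffs c) n * r ^ n) + e 0 * r ^ 0)"
      by (subst (asm) sums_Suc_iff) simp
    thus ?thesis by (simp add: e_def)
  qed
  have "(\<lambda>n. 4 * (e n * r ^ n) + 2 * real N * (diffs c n * r ^ n)) sums
      (4 * (r * (\<Sum>n. diffs (diffs c) n * r ^ n)) + 2 * real N * (\<Sum>n. diffs c n * r ^ n))"
    by (intro sums_add sums_mult e summable_sums sd)
  also have "(\<lambda>n. 4 * (e n * r ^ n) + 2 * real N * (diffs c n * r ^ n)) = (\<lambda>n. c n * r ^ n)"
  proof
    fix n
    have "(real n + 1) * (4 * real n + 2 * real N) * c (Suc n) = c n"
      using assms by (simp add: c_def add_nonneg_eq_0_iff add.commute)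
    hence "c n * r ^ n = (real n + 1) * (4 * real n + 2 * real N) * c (Suc n) * r ^ n"
      by simp
    thus "4 * (e n * r ^ n) + 2 * real N * (diffs c n * r ^ n) = c n * r ^ n"
      by (simp add: e_def diffs_def algebra_simps)
  qed
  finally have "(\<lambda>n. c n * r ^ n) sums
      (4 * (r * (\<Sum>n. diffs (diffs c) n * r ^ n)) + 2 * real N * (\<Sum>n. diffs c n * r ^ n))" .
  from sums_unique2[OF this summable_sums[OF sc]] show ?thesis
    unfolding d1 d2 by (simp add: f mult.assoc)
qed

text \<open>Controls the volume of the shell between the radii x and x + 1.\<close>

lemma power_Suc_diff_le:
  fixes x :: real
  assumes "x \<ge> 0"
  shows "(x + 1) ^ Suc k - x ^ Suc k \<le> (real k + 1) * (x + 1) ^ k"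
proof (induction k)
  case 0
  then show ?case by simp
next
  case (Suc k)
  have "(x + 1) ^ Suc (Suc k) - x ^ Suc (Suc k)
      = (x + 1) * ((x + 1) ^ Suc k - x ^ Suc k) + x ^ Suc k"
    by (simp add: algebra_simps)
  also have "\<dots> \<le> (x + 1) * ((real k + 1) * (x + 1) ^ k) + (x + 1) ^ Suc k"
    using assms Suc by (intro add_mono mult_left_mono power_mono) auto
  also have "\<dots> = (real (Suc k) + 1) * (x + 1) ^ Suc k"
    by (simp add: algebra_simps)
  finally show ?case .
qed

section \<open>The eigenfunction on the whole space and its mass in balls\<close>

definition eig :: "real^'n \<Rightarrow> real" where
  "eig x = radial_fun CARD('n) (x \<bullet> x)"

lemma eig_pos: "eig x > 0"
  by (simp add: eig_def radial_fun_pos Suc_leI)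

lemma eig_nonneg [simp]: "eig x \<ge> 0"
  by (rule less_imp_le[OF eig_pos])

lemma card_ge_1: "CARD('n::finite) \<ge> 1"
  by (simp add: Suc_leI)

lemma continuous_on_eig: "continuous_on S (eig :: real^'n \<Rightarrow> real)"
  unfolding eig_def[abs_def]
  by (intro continuous_on_compose2[OF smooth_fun_continuous_on[OF smooth_radial_fun[OF card_ge_1]]]
      continuous_intros) auto

lemma borel_measurable_eig [measurable]: "(eig :: real^'n \<Rightarrow> real) \<in> borel_measurable borel"
  by (rule borel_measurable_continuous_onI[OF continuous_on_eig])

lemma set_integrable_eig: "set_integrable lborel (cball 0 r) (eig :: real^'n \<Rightarrow> real)"
  unfolding set_integrable_def
  by (intro borel_integrable_compact continuous_on_eig compact_cball)

text \<open>The dimension occurs only in the type, hence the type token as first argument.\<close>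

definition eig_mass :: "'n::finite itself \<Rightarrow> real \<Rightarrow> real" where
  "eig_mass _ r = (LINT x:cball 0 r|lborel. eig (x :: real^'n))"

lemma eig_mass_mono: "r \<le> s \<Longrightarrow> eig_mass TYPE('n::finite) r \<le> eig_mass TYPE('n) s"
  unfolding eig_mass_def set_lebesgue_integral_def
  by (rule integral_mono)
    (use set_integrable_eig in \<open>auto simp: set_integrable_def indicator_def\<close>)

lemma eig_mass_pos: "r > 0 \<Longrightarrow> eig_mass TYPE('n::finite) r > 0"
proof -
  assume r: "r > 0"
  have nn: "AE x in lborel. 0 \<le> indicator (cball 0 r) x *\<^sub>R eig (x :: real^'n)"
    by (auto simp: indicator_def)
  have "eig_mass TYPE('n) r \<noteq> 0"
  proof
    assume "eig_mass TYPE('n) r = 0"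
    hence "AE x in lborel. indicator (cball 0 r) x *\<^sub>R eig (x :: real^'n) = 0"
      using integral_nonneg_eq_0_iff_AE[OF set_integrable_eig[unfolded set_integrable_def] nn]
      by (simp add: eig_mass_def set_lebesgue_integral_def)
    hence "AE x in lborel. (x :: real^'n) \<notin> cball 0 r"
      by eventually_elim (use eig_pos in \<open>auto simp: indicator_def less_le\<close>)
    hence "emeasure lborel (cball (0 :: real^'n) r) = 0"
      by (subst AE_iff_measurable[symmetric, of _ _ "\<lambda>x. x \<notin> cball 0 r"]) (auto simp del: mem_cball)
    moreover have "unit_ball_vol (real CARD('n)) * r ^ CARD('n) > 0" using r by simp
    ultimately show False using r by (simp add: emeasure_cball ennreal_eq_0_iff)
  qed
  moreover have "eig_mass TYPE('n) r \<ge> 0"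
    unfolding eig_mass_def set_lebesgue_integral_def using nn by (rule integral_nonneg_AE)
  ultimately show ?thesis by simp
qed

text \<open>Shells take the place of polar coordinates. Between the radii n and n + 1 the function
  \<open>eig\<close> is at most its value at radius n + 1, and the volume is of order (n + 1)^(N -
  1); the Bessel decay halves this power.\<close>

lemma eig_mass_shell:
  "eig_mass TYPE('n::finite) (real n + 1) \<le> eig_mass TYPE('n) (real n) +
    sqrt (fact (CARD('n) - 1)) * unit_ball_vol (real CARD('n)) * real CARD('n) *
    ((real n + 1) powr ((real CARD('n) - 1) / 2) * exp (real n + 1))"
proof -
  define N where "N = CARD('n)"
  define r where "r = real n + 1"
  have N: "N \<ge> 1" unfolding N_def by (rule card_ge_1)
  have r: "r > 0" by (simp add: r_def)
  have vol: "measure lborel (cball (0 :: real^'n) s) = unit_ball_vol (real N) * s ^ N" if "s \<ge> 0" for s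
    using content_cball[OF that, of "0 :: real^'n"] by (simp add: N_def)
  have ind: "integrable lborel (indicat_real (cball (0 :: real^'n) s))" for s
    using emeasure_lborel_cball_finite[of "0 :: real^'n" s] by (simp add: integrable_indicator_iff)
  have "eig_mass TYPE('n) r \<le> (LINT x|lborel. indicator (cball 0 (real n)) x *\<^sub>R eig (x :: real^'n)
      + radial_fun N (r\<^sup>2) * (indicator (cball 0 r) x - indicator (cball 0 (real n)) x))"
    unfolding eig_mass_def set_lebesgue_integral_def
  proof (rule integral_mono)
    show "integrable lborel (\<lambda>x. indicator (cball 0 r) x *\<^sub>R eig (x :: real^'n))"
      using set_integrable_eig by (simp add: set_integrable_def)
    show "integrable lborel (\<lambda>x. indicator (cball 0 (real n)) x *\<^sub>R eig (x :: real^'n)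
      + radial_fun N (r\<^sup>2) * (indicator (cball 0 r) x - indicator (cball 0 (real n)) x))"
      using set_integrable_eig[of "real n"] ind
      by (intro Bochner_Integration.integrable_add Bochner_Integration.integrable_diff
          integrable_mult_right) (simp_all add: set_integrable_def)
    fix x :: "real^'n"
    have "eig x \<le> radial_fun N (r\<^sup>2)" if "norm x \<le> r"
      unfolding eig_def N_def using that
      by (intro radial_fun_mono card_ge_1) (auto simp: power2_norm_eq_inner[symmetric] intro!: power_mono)
    thus "indicator (cball 0 r) x *\<^sub>R eig x \<le> indicator (cball 0 (real n)) x *\<^sub>R eig x
      + radial_fun N (r\<^sup>2) * (indicator (cball 0 r) x - indicator (cball 0 (real n)) x)"
      by (auto simp: indicator_def r_def)
  qed
  also have "\<dots> = eig_mass TYPE('n) (real n) +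
      radial_fun N (r\<^sup>2) * (unit_ball_vol (real N) * (r ^ N - real n ^ N))"
  proof -
    have m: "(LINT x|lborel. indicat_real (cball (0 :: real^'n) s) x) = unit_ball_vol (real N) * s ^ N"
      if "s \<ge> 0" for s
      using vol[OF that] by simp
    have "integrable lborel (\<lambda>x. indicator (cball 0 (real n)) x *\<^sub>R eig (x :: real^'n))"
      using set_integrable_eig by (simp add: set_integrable_def)
    moreover have "integrable lborel (\<lambda>x :: real^'n. radial_fun N (r\<^sup>2) *
        (indicat_real (cball 0 r) x - indicat_real (cball 0 (real n)) x))"
      using ind by (intro integrable_mult_right Bochner_Integration.integrable_diff)
    moreover have "(LINT x|lborel. indicat_real (cball (0 :: real^'n) r) x - indicat_real (cball 0 (real n)) x)
        = unit_ball_vol (real N) * (r ^ N - real n ^ N)"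
      unfolding Bochner_Integration.integral_diff[OF ind ind] using r
      by (subst (1 2) m) (auto simp: right_diff_distrib)
    ultimately show ?thesis
      by (simp only: Bochner_Integration.integral_add integral_mult_right_zero eig_mass_def
          set_lebesgue_integral_def)
  qed
  also have "radial_fun N (r\<^sup>2) * (unit_ball_vol (real N) * (r ^ N - real n ^ N))
     \<le> (sqrt (fact (N - 1)) * r powr (- ((real N - 1) / 2)) * exp r) *
        (unit_ball_vol (real N) * (real N * r powr (real N - 1)))"
  proof (intro mult_mono radial_fun_le N r)
    obtain k where k: "N = Suc k" using N by (cases N) auto
    have "r ^ N - real n ^ N \<le> real N * r ^ k"
      using power_Suc_diff_le[of "real n" k] by (simp add: k r_def add.commute)
    also have "r ^ k = r powr (real N - 1)"
      using r by (simp add: k powr_realpow)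
    finally show "r ^ N - real n ^ N \<le> real N * r powr (real N - 1)" .
    show "0 \<le> unit_ball_vol (real N) * (r ^ N - real n ^ N)"
      by (auto simp: r_def intro!: mult_nonneg_nonneg power_mono)
    show "0 \<le> r ^ N - real n ^ N"
      by (auto simp: r_def intro!: power_mono)
  qed auto
  also have "\<dots> = sqrt (fact (N - 1)) * unit_ball_vol (real N) * real N *
      (r powr ((real N - 1) / 2) * exp r)"
  proof -
    have "r powr (- ((real N - 1) / 2)) * r powr (real N - 1) = r powr ((real N - 1) / 2)"
      by (simp add: powr_add[symmetric] field_simps)
    from this[symmetric] show ?thesis by (simp only: mult_ac)
  qed
  finally show ?thesis by (simp add: N_def r_def)
qed

text \<open>The constant 2C reproduces itself: 2C e^n <= C e^(n + 1) because 2 <= e, and the new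
  shell adds another C e^(n + 1).\<close>

lemma eig_mass_nat_le:
  "eig_mass TYPE('n::finite) (real n) \<le>
    2 * (sqrt (fact (CARD('n) - 1)) * unit_ball_vol (real CARD('n)) * real CARD('n)) *
    (real n powr ((real CARD('n) - 1) / 2) * exp (real n))"
proof (induction n)
  case 0
  \<comment> \<open>\<open>0 powr x\<close> is 0 for every x, also in dimension one where the
    exponent is 0, so the claimed bound at radius 0 is 0 and rests on points being null
    sets.\<close>
  have "eig_mass TYPE('n) 0 = 0"
  proof -
    have "AE x in lborel. x \<noteq> (0 :: real^'n)"
      by (rule AE_lborel_singleton)
    hence "AE x in lborel. indicator (cball 0 0) x *\<^sub>R eig (x :: real^'n) = 0"
      by eventually_elim auto
    thus ?thesis
      unfolding eig_mass_def set_lebesgue_integral_def by (rule integral_eq_zero_AE)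
  qed
  then show ?case by simp
next
  case (Suc n)
  define C where "C = sqrt (fact (CARD('n) - 1)) * unit_ball_vol (real CARD('n)) * real CARD('n)"
  define \<alpha> where "\<alpha> = (real CARD('n) - 1) / 2"
  have C: "C \<ge> 0" by (simp add: C_def)
  have \<alpha>: "\<alpha> \<ge> 0" using card_ge_1[where 'n = 'n] by (simp add: \<alpha>_def)
  have e: "2 * exp (real n) \<le> exp (real n + 1)"
    using exp_ge_add_one_self[of "1 :: real"] by (simp add: exp_add)
  have "eig_mass TYPE('n) (real n + 1) \<le> 2 * C * (real n powr \<alpha> * exp (real n))
      + C * ((real n + 1) powr \<alpha> * exp (real n + 1))"
    using eig_mass_shell[where 'n = 'n, of n] Suc unfolding C_def[symmetric] \<alpha>_def[symmetric] by linarith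
  also have "2 * C * (real n powr \<alpha> * exp (real n)) = C * (real n powr \<alpha> * (2 * exp (real n)))"
    by simp
  also have "\<dots> \<le> C * ((real n + 1) powr \<alpha> * exp (real n + 1))"
    using C \<alpha> e by (intro mult_left_mono mult_mono powr_mono2) auto
  finally show ?case
    unfolding C_def[symmetric] \<alpha>_def[symmetric] by (simp add: algebra_simps)
qed

text \<open>Rounding the radius up costs one unit, which goes into e^(R + 1). The polynomial factor
  uses phi_m m t <= t^(1 + m), the source of the exponent (1 + m)(N - 1) / 2.\<close>

lemma eig_mass_le:
  assumes m: "m \<ge> 0" and R: "R > 0"
  obtains C where "C > 0" "\<And>t. t \<ge> 1 \<Longrightarrow> eig_mass TYPE('n::finite) (R + phi_m m t) \<le>
    C * (exp (phi_m m t) * t powr ((1 + m) * (real CARD('n) - 1) / 2))"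
proof -
  define C where "C = 2 * (sqrt (fact (CARD('n) - 1)) * unit_ball_vol (real CARD('n)) * real CARD('n))"
  define \<alpha> where "\<alpha> = (real CARD('n) - 1) / 2"
  have C: "C > 0" by (simp add: C_def)
  have \<alpha>: "\<alpha> \<ge> 0" using card_ge_1[where 'n = 'n] by (simp add: \<alpha>_def)
  show ?thesis
  proof (rule that[of "C * ((R + 2) powr \<alpha> * exp (R + 1))"])
    show "C * ((R + 2) powr \<alpha> * exp (R + 1)) > 0" using C R by simp
    fix t :: real assume t: "t \<ge> 1"
    define r where "r = R + phi_m m t"
    have r: "r > 0" using R m by (simp add: r_def phi_m_def add_pos_nonneg)
    define n where "n = nat \<lceil>r\<rceil>"
    have n: "r \<le> real n" "real n \<le> r + 1" using r by (auto simp: n_def)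
    have tm: "t powr (1 + m) \<ge> 1" using t m by (intro ge_one_powr_ge_zero) auto
    have "r + 1 \<le> (R + 2) * t powr (1 + m)"
    proof -
      have "phi_m m t \<le> t powr (1 + m)"
        using m by (simp add: phi_m_def divide_le_eq mult_le_cancel_left1)
      moreover have "(R + 1) * 1 \<le> (R + 1) * t powr (1 + m)"
        using tm R by (intro mult_left_mono) auto
      ultimately show ?thesis by (simp add: r_def algebra_simps)
    qed
    hence "(r + 1) powr \<alpha> \<le> ((R + 2) * t powr (1 + m)) powr \<alpha>"
      using \<alpha> r by (intro powr_mono2) auto
    also have "\<dots> = (R + 2) powr \<alpha> * t powr ((1 + m) * \<alpha>)"
      by (simp add: powr_mult powr_powr)
    finally have 1: "(r + 1) powr \<alpha> \<le> (R + 2) powr \<alpha> * t powr ((1 + m) * \<alpha>)" .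
    have "eig_mass TYPE('n) r \<le> eig_mass TYPE('n) (real n)"
      using n by (intro eig_mass_mono)
    also have "\<dots> \<le> C * (real n powr \<alpha> * exp (real n))"
      unfolding C_def \<alpha>_def by (rule eig_mass_nat_le)
    also have "\<dots> \<le> C * ((r + 1) powr \<alpha> * exp (r + 1))"
      using C n \<alpha> by (intro mult_left_mono mult_mono powr_mono2) auto
    also have "\<dots> \<le> C * (((R + 2) powr \<alpha> * t powr ((1 + m) * \<alpha>)) * exp (r + 1))"
      using C 1 by (intro mult_left_mono mult_right_mono) auto
    also have "\<dots> = C * ((R + 2) powr \<alpha> * exp (R + 1)) * (exp (phi_m m t) * t powr ((1 + m) * \<alpha>))"
      by (simp add: r_def exp_add mult_ac)
    finally show "eig_mass TYPE('n) (R + phi_m m t) \<le> C * ((R + 2) powr \<alpha> * exp (R + 1)) *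
        (exp (phi_m m t) * t powr ((1 + m) * (real CARD('n) - 1) / 2))"
      by (simp add: r_def \<alpha>_def)
  qed
qed

section \<open>Weighted means and square integrable functions\<close>

text \<open>Convexity: the tangent of x^p at l lies below the graph. Young's inequality with the
  exponents p and p / (p - 1) gives it.\<close>

lemma powr_tangent_le:
  fixes x l p :: real
  assumes "p > 1" "x \<ge> 0" "l \<ge> 0"
  shows "p * l powr (p - 1) * x \<le> x powr p + (p - 1) * l powr p"
proof -
  have "x * l powr (p - 1) \<le> x powr p / p + (l powr (p - 1)) powr (p / (p - 1)) / (p / (p - 1))"
    using assms by (intro Youngs_inequality) (auto simp: field_simps)
  also have "(l powr (p - 1)) powr (p / (p - 1)) = l powr p"
    using assms by (simp add: powr_powr)
  finally have "p * (x * l powr (p - 1)) \<le> p * (x powr p / p + l powr p / (p / (p - 1)))"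
    using assms by (intro mult_left_mono) auto
  also have "\<dots> = x powr p + (p - 1) * l powr p"
    using assms by (simp add: field_simps)
  finally show ?thesis by (simp add: mult_ac)
qed

text \<open>Hoelder's inequality, obtained by integrating the tangent inequality for x^p at one well
  chosen point.\<close>

lemma weighted_power_mean:
  fixes f w :: "'a \<Rightarrow> real"
  assumes p: "p > 1" and fp: "integrable M (\<lambda>x. \<bar>f x\<bar> powr p * w x)"
    and fw: "integrable M (\<lambda>x. f x * w x)" and w: "integrable M w" "\<And>x. w x \<ge> 0"
    and pos: "(LINT x|M. w x) > 0"
  shows "\<bar>LINT x|M. f x * w x\<bar> powr p * (LINT x|M. w x) powr (1 - p) \<le> (LINT x|M. \<bar>f x\<bar> powr p * w x)"
proof -
  define A where "A = \<bar>LINT x|M. f x * w x\<bar>"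
  define J where "J = (LINT x|M. w x)"
  \<comment> \<open>The modulus of the weighted mean of f. With this point of tangency both terms
    become multiples of A^p J^(1 - p), with factors p and p - 1.\<close>
  define l where "l = A / J"
  have l: "l \<ge> 0" using pos by (simp add: l_def A_def J_def)
  have afw: "integrable M (\<lambda>x. \<bar>f x\<bar> * w x)"
    using integrable_abs[OF fw] w(2) by (simp add: abs_mult)
  have "A \<le> (LINT x|M. \<bar>f x\<bar> * w x)"
    using integral_abs_bound[of M "\<lambda>x. f x * w x"] w(2) by (simp add: A_def abs_mult)
  hence "p * l powr (p - 1) * A - (p - 1) * l powr p * J
      \<le> p * l powr (p - 1) * (LINT x|M. \<bar>f x\<bar> * w x) - (p - 1) * l powr p * J"
    using p by (intro diff_right_mono mult_left_mono) auto
  also have "\<dots> = (LINT x|M. p * l powr (p - 1) * (\<bar>f x\<bar> * w x) - (p - 1) * l powr p * w x)"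
    using afw w(1) by (simp add: J_def)
  also have "\<dots> \<le> (LINT x|M. \<bar>f x\<bar> powr p * w x)"
  proof (rule integral_mono)
    fix x
    have "(p * l powr (p - 1) * \<bar>f x\<bar> - (p - 1) * l powr p) * w x \<le> \<bar>f x\<bar> powr p * w x"
      using powr_tangent_le[OF p, of "\<bar>f x\<bar>" l] l w(2) by (intro mult_right_mono) auto
    thus "p * l powr (p - 1) * (\<bar>f x\<bar> * w x) - (p - 1) * l powr p * w x \<le> \<bar>f x\<bar> powr p * w x"
      by (simp add: algebra_simps)
  qed (use afw w fp in auto)
  also have "p * l powr (p - 1) * A - (p - 1) * l powr p * J = A powr p * J powr (1 - p)"
  proof (cases "A = 0")
    case True
    then show ?thesis by (simp add: l_def)
  next
    case False
    hence A: "A > 0" by (simp add: A_def)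
    have J: "J > 0" using pos by (simp add: J_def)
    have "l powr (p - 1) * A = A powr p * J powr (1 - p)"
      using A J by (simp add: l_def powr_divide powr_diff divide_simps)
    moreover have "l powr p * J = A powr p * J powr (1 - p)"
      using A J by (simp add: l_def powr_divide powr_diff divide_simps)
    ultimately show ?thesis by (simp add: algebra_simps)
  qed
  finally show ?thesis by (simp add: A_def J_def)
qed

section \<open>Pairings and limits of square integrable functions\<close>

lemma L2_mult_integrable:
  assumes "L2 f" "L2 g"
  shows "integrable lborel (\<lambda>x. f x * g x)"
proof (rule Bochner_Integration.integrable_bound)
  show "integrable lborel (\<lambda>x. (f x)\<^sup>2 + (g x)\<^sup>2)"
    using assms by (auto simp: L2_def)
  show "(\<lambda>x. f x * g x) \<in> borel_measurable lborel"
    using assms by (auto simp: L2_def)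
  have "\<bar>a * b\<bar> \<le> a\<^sup>2 + b\<^sup>2" for a b :: real
    using sum_squares_bound[of "\<bar>a\<bar>" "\<bar>b\<bar>"] mult_nonneg_nonneg[OF abs_ge_zero[of a] abs_ge_zero[of b]]
    by (simp only: abs_mult power2_abs)
  thus "AE x in lborel. norm (f x * g x) \<le> norm ((f x)\<^sup>2 + (g x)\<^sup>2)"
    by (auto intro!: always_eventually order_trans[OF _ abs_ge_self])
qed

lemma L2_cmult: "L2 f \<Longrightarrow> L2 (\<lambda>x. c * f x)"
  by (auto simp: L2_def power_mult_distrib)

lemma L2_diff:
  assumes "L2 f" "L2 g"
  shows "L2 (\<lambda>x. f x - g x)"
proof -
  have "integrable lborel (\<lambda>x. (f x)\<^sup>2 - 2 * (f x * g x) + (g x)\<^sup>2)"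
    using assms L2_mult_integrable[OF assms] by (auto simp: L2_def)
  also have "(\<lambda>x. (f x)\<^sup>2 - 2 * (f x * g x) + (g x)\<^sup>2) = (\<lambda>x. (f x - g x)\<^sup>2)"
    by (auto simp: power2_eq_square algebra_simps)
  finally show ?thesis using assms by (auto simp: L2_def)
qed

lemma L2_Cauchy_Schwarz:
  assumes "L2 f" "L2 g"
  shows "(LINT x|lborel. f x * g x)\<^sup>2 \<le> (LINT x|lborel. (f x)\<^sup>2) * (LINT x|lborel. (g x)\<^sup>2)"
proof -
  define A where "A = (LINT x|lborel. (f x)\<^sup>2)"
  define B where "B = (LINT x|lborel. f x * g x)"
  define C where "C = (LINT x|lborel. (g x)\<^sup>2)"
  have C: "C \<ge> 0" by (simp add: C_def)
  have q: "0 \<le> A - 2 * s * B + s\<^sup>2 * C" for s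
  proof -
    have "0 \<le> (LINT x|lborel. (f x - s * g x)\<^sup>2)" by simp
    also have "\<dots> = (LINT x|lborel. (f x)\<^sup>2 - 2 * s * (f x * g x) + s\<^sup>2 * (g x)\<^sup>2)"
      by (intro Bochner_Integration.integral_cong) (auto simp: power2_eq_square algebra_simps)
    also have "\<dots> = A - 2 * s * B + s\<^sup>2 * C"
      using assms L2_mult_integrable[OF assms] by (simp add: L2_def A_def B_def C_def)
    finally show ?thesis .
  qed
  have "B\<^sup>2 \<le> A * C"
  proof (cases "C = 0")
    case True
    have "B = 0"
    proof (rule ccontr)
      assume "B \<noteq> 0"
      \<comment> \<open>For C = 0 the quadratic is affine in s, and this s gives it the value
        -1.\<close>
      thus False using q[of "(A + 1) / (2 * B)"] True by (simp add: field_simps)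
    qed
    thus ?thesis using True by simp
  next
    case False
    with C have "C > 0" by simp
    thus ?thesis using q[of "B / C"] by (simp add: field_simps power2_eq_square)
  qed
  thus ?thesis by (simp add: A_def B_def C_def)
qed

lemma L2_tendsto_integral:
  assumes lim: "((\<lambda>s. L2dist2 (f s) f0) \<longlongrightarrow> 0) F" and f: "\<forall>\<^sub>F s in F. L2 (f s)"
    and f0: "L2 f0" and \<psi>: "L2 \<psi>"
  shows "((\<lambda>s. LINT x|lborel. f s x * \<psi> x) \<longlongrightarrow> (LINT x|lborel. f0 x * \<psi> x)) F"
proof -
  define C where "C = (LINT x|lborel. (\<psi> x)\<^sup>2)"
  have "((\<lambda>s. sqrt (L2dist2 (f s) f0 * C)) \<longlongrightarrow> sqrt (0 * C)) F"
    by (intro tendsto_intros lim)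
  hence 0: "((\<lambda>s. sqrt (L2dist2 (f s) f0 * C)) \<longlongrightarrow> 0) F" by simp
  have "\<forall>\<^sub>F s in F. norm ((LINT x|lborel. f s x * \<psi> x) - (LINT x|lborel. f0 x * \<psi> x))
      \<le> sqrt (L2dist2 (f s) f0 * C)"
    using f
  proof eventually_elim
    case (elim s)
    have "(LINT x|lborel. f s x * \<psi> x) - (LINT x|lborel. f0 x * \<psi> x) = (LINT x|lborel. (f s x - f0 x) * \<psi> x)"
      using L2_mult_integrable[OF elim \<psi>] L2_mult_integrable[OF f0 \<psi>]
      by (simp add: left_diff_distrib)
    moreover have "(LINT x|lborel. (f s x - f0 x) * \<psi> x)\<^sup>2 \<le> L2dist2 (f s) f0 * C"
      using L2_Cauchy_Schwarz[OF L2_diff[OF elim f0] \<psi>] by (simp add: L2dist2_def C_def)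
    ultimately show ?case by (simp add: real_le_rsqrt)
  qed
  hence "((\<lambda>s. (LINT x|lborel. f s x * \<psi> x) - (LINT x|lborel. f0 x * \<psi> x)) \<longlongrightarrow> 0) F"
    by (rule Lim_null_comparison[OF _ 0])
  thus ?thesis by (simp add: LIM_zero_iff)
qed

text \<open>The L2 mass of \<open>f0\<close> on the set is at most the squared L2 distance to any
  \<open>f s\<close> vanishing there, and this tends to 0. In this way the support of
  \<open>u\<close> passes to its time derivative.\<close>

lemma L2_limit_vanishes:
  assumes lim: "((\<lambda>s. L2dist2 (f s) f0) \<longlongrightarrow> 0) F" and F: "F \<noteq> bot"
    and f: "\<forall>\<^sub>F s in F. L2 (f s) \<and> (AE x in lborel. P x \<longrightarrow> f s x = 0)"
    and f0: "L2 f0" and P: "{x. P x} \<in> sets borel"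
  shows "AE x in lborel. P x \<longrightarrow> f0 x = 0"
proof -
  define E where "E = {x. P x}"
  have E: "E \<in> sets borel" using P by (simp add: E_def)
  have i: "integrable lborel (\<lambda>x. indicator E x * (f0 x)\<^sup>2)"
    using integrable_mult_indicator[of E lborel "\<lambda>x. (f0 x)\<^sup>2"] f0 E by (simp add: L2_def)
  have "\<forall>\<^sub>F s in F. (LINT x|lborel. indicator E x * (f0 x)\<^sup>2) \<le> L2dist2 (f s) f0"
    using f
  proof eventually_elim
    case (elim s)
    show ?case
      unfolding L2dist2_def
    proof (rule integral_mono_AE[OF i])
      show "integrable lborel (\<lambda>x. (f s x - f0 x)\<^sup>2)"
        using L2_diff[of "f s" f0] elim f0 by (simp add: L2_def)
      show "AE x in lborel. indicator E x * (f0 x)\<^sup>2 \<le> (f s x - f0 x)\<^sup>2"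
        using elim[THEN conjunct2] by eventually_elim (auto simp: E_def indicator_def)
    qed
  qed
  hence "(LINT x|lborel. indicator E x * (f0 x)\<^sup>2) \<le> 0"
    by (rule tendsto_lowerbound[OF lim _ F])
  moreover have "(LINT x|lborel. indicator E x * (f0 x)\<^sup>2) \<ge> 0"
    by (rule integral_nonneg_AE) auto
  ultimately have "(LINT x|lborel. indicator E x * (f0 x)\<^sup>2) = 0" by linarith
  hence "AE x in lborel. indicator E x * (f0 x)\<^sup>2 = 0"
    by (subst (asm) integral_nonneg_eq_0_iff_AE[OF i]) auto
  thus ?thesis
    by eventually_elim (auto simp: E_def indicator_def split: if_splits)
qed

section \<open>Lower right Dini derivatives\<close>

text \<open>The form with e states that the lower limit of the difference quotients is at least d
  while staying within the reals, even if that limit is infinite.\<close>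

definition rdini_ge :: "(real \<Rightarrow> real) \<Rightarrow> real \<Rightarrow> real \<Rightarrow> bool" where
  "rdini_ge f t d \<longleftrightarrow> (\<forall>e>0. \<forall>\<^sub>F s in at_right t. f t + (d - e) * (s - t) \<le> f s)"

lemma rdini_ge_mono: "rdini_ge f t d \<Longrightarrow> d' \<le> d \<Longrightarrow> rdini_ge f t d'"
proof -
  assume f: "rdini_ge f t d" and d: "d' \<le> d"
  show "rdini_ge f t d'"
    unfolding rdini_ge_def
  proof (intro allI impI)
    fix e :: real assume "e > 0"
    with f have "\<forall>\<^sub>F s in at_right t. f t + (d - e) * (s - t) \<le> f s"
      by (auto simp: rdini_ge_def)
    moreover have "\<forall>\<^sub>F s in at_right t. t < s"
      by (auto simp: eventually_at_filter)
    ultimately show "\<forall>\<^sub>F s in at_right t. f t + (d' - e) * (s - t) \<le> f s"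
    proof eventually_elim
      case (elim s)
      have "(d' - e) * (s - t) \<le> (d - e) * (s - t)"
        using elim d by (intro mult_right_mono) auto
      with elim show ?case by linarith
    qed
  qed
qed

lemma DERIV_right_imp_rdini_ge:
  assumes "(f has_real_derivative d) (at_right t)"
  shows "rdini_ge f t d"
  unfolding rdini_ge_def
proof (intro allI impI)
  fix e :: real assume e: "e > 0"
  have "((\<lambda>s. (f s - f t) / (s - t)) \<longlongrightarrow> d) (at_right t)"
    using assms by (simp add: has_field_derivative_iff)
  hence "\<forall>\<^sub>F s in at_right t. (f s - f t) / (s - t) > d - e"
    using e by (intro order_tendstoD(1)) auto
  moreover have "\<forall>\<^sub>F s in at_right t. t < s"
    by (auto simp: eventually_at_filter)
  ultimately show "\<forall>\<^sub>F s in at_right t. f t + (d - e) * (s - t) \<le> f s"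
    by eventually_elim (auto simp: field_simps)
qed

text \<open>A minorant touching f at t and differentiable from the right is enough. Products and
  compositions then reduce to ordinary calculus for the minorant.\<close>

lemma rdini_geI:
  assumes "\<And>e. e > 0 \<Longrightarrow> \<exists>k D. k t = f t \<and> (k has_real_derivative D) (at_right t) \<and> d - e \<le> D \<and>
    (\<forall>\<^sub>F s in at_right t. k s \<le> f s)"
  shows "rdini_ge f t d"
  unfolding rdini_ge_def
proof (intro allI impI)
  fix e :: real assume e: "e > 0"
  then obtain k D where k: "k t = f t" "(k has_real_derivative D) (at_right t)" "d - e / 2 \<le> D"
    "\<forall>\<^sub>F s in at_right t. k s \<le> f s"
    using assms[of "e / 2"] by auto
  have "rdini_ge k t (d - e / 2)"
    using DERIV_right_imp_rdini_ge[OF k(2)] k(3) rdini_ge_mono by blast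
  hence "\<forall>\<^sub>F s in at_right t. k t + (d - e / 2 - e / 2) * (s - t) \<le> k s"
    using e half_gt_zero unfolding rdini_ge_def by blast
  with k(4) show "\<forall>\<^sub>F s in at_right t. f t + (d - e) * (s - t) \<le> f s"
    by eventually_elim (use k(1) in auto)
qed

lemma rdini_ge_add:
  assumes "rdini_ge f t d" "rdini_ge g t d'"
  shows "rdini_ge (\<lambda>s. f s + g s) t (d + d')"
  unfolding rdini_ge_def
proof (intro allI impI)
  fix e :: real assume "e > 0"
  hence "\<forall>\<^sub>F s in at_right t. f t + (d - e / 2) * (s - t) \<le> f s"
    "\<forall>\<^sub>F s in at_right t. g t + (d' - e / 2) * (s - t) \<le> g s"
    using assms half_gt_zero unfolding rdini_ge_def by blast+
  thus "\<forall>\<^sub>F s in at_right t. f t + g t + (d + d' - e) * (s - t) \<le> f s + g s"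
    by eventually_elim (auto simp: field_simps)
qed

lemma rdini_ge_mult:
  assumes f: "rdini_ge f t d" and \<alpha>: "(\<alpha> has_real_derivative \<alpha>') (at_right t)" and pos: "\<alpha> t > 0"
  shows "rdini_ge (\<lambda>s. \<alpha> s * f s) t (\<alpha> t * d + \<alpha>' * f t)"
proof (rule rdini_geI)
  fix e :: real assume e: "e > 0"
  define e' where "e' = e / \<alpha> t"
  have e': "e' > 0" using e pos by (simp add: e'_def)
  define k where "k = (\<lambda>s. \<alpha> s * (f t + (d - e') * (s - t)))"
  have "(k has_real_derivative \<alpha>' * f t + \<alpha> t * (d - e')) (at_right t)"
    unfolding k_def by (auto intro!: derivative_eq_intros \<alpha>)
  moreover have "\<alpha> t * d + \<alpha>' * f t - e \<le> \<alpha>' * f t + \<alpha> t * (d - e')"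
    using pos by (simp add: e'_def algebra_simps)
  moreover have "\<forall>\<^sub>F s in at_right t. k s \<le> \<alpha> s * f s"
  proof -
    have "(\<alpha> \<longlongrightarrow> \<alpha> t) (at_right t)"
      using DERIV_continuous[OF \<alpha>] by (simp add: continuous_within)
    hence "\<forall>\<^sub>F s in at_right t. \<alpha> s > 0"
      using pos by (rule order_tendstoD(1))
    moreover have "\<forall>\<^sub>F s in at_right t. f t + (d - e') * (s - t) \<le> f s"
      using f e' unfolding rdini_ge_def by blast
    ultimately show ?thesis
      by eventually_elim (auto simp: k_def)
  qed
  ultimately show "\<exists>k D. k t = \<alpha> t * f t \<and> (k has_real_derivative D) (at_right t) \<and>
      \<alpha> t * d + \<alpha>' * f t - e \<le> D \<and> (\<forall>\<^sub>F s in at_right t. k s \<le> \<alpha> s * f s)"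
    by (intro exI[of _ k] exI[of _ "\<alpha>' * f t + \<alpha> t * (d - e')"]) (simp add: k_def)
qed

lemma rdini_ge_compose_mono:
  assumes f: "rdini_ge f t d" and pos: "f t > 0"
    and h: "(h has_real_derivative h') (at (f t))" "h' > 0"
    and mono: "\<And>x y. 0 < x \<Longrightarrow> x \<le> y \<Longrightarrow> h x \<le> h y"
  shows "rdini_ge (\<lambda>s. h (f s)) t (h' * d)"
proof (rule rdini_geI)
  fix e :: real assume e: "e > 0"
  define e' where "e' = e / h'"
  have e': "e' > 0" using e h(2) by (simp add: e'_def)
  define l where "l = (\<lambda>s. f t + (d - e') * (s - t))"
  have l: "(l has_real_derivative d - e') (at_right t)"
    unfolding l_def by (auto intro!: derivative_eq_intros)
  have lt: "l t = f t" by (simp add: l_def)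
  have "((\<lambda>s. h (l s)) has_real_derivative h' * (d - e')) (at_right t)"
    using h(1) lt by (intro DERIV_chain2[OF _ l]) simp
  moreover have "h' * d - e \<le> h' * (d - e')"
    using h(2) by (simp add: e'_def algebra_simps)
  moreover have "\<forall>\<^sub>F s in at_right t. h (l s) \<le> h (f s)"
  proof -
    have "(l \<longlongrightarrow> f t) (at_right t)"
      using DERIV_continuous[OF l] lt by (simp add: continuous_within)
    hence "\<forall>\<^sub>F s in at_right t. l s > 0"
      using pos by (rule order_tendstoD(1))
    moreover have "\<forall>\<^sub>F s in at_right t. l s \<le> f s"
      using f e' unfolding rdini_ge_def l_def by blast
    ultimately show ?thesis
      by eventually_elim (rule mono)
  qed
  ultimately show "\<exists>k D. k t = h (f t) \<and> (k has_real_derivative D) (at_right t) \<and>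
      h' * d - e \<le> D \<and> (\<forall>\<^sub>F s in at_right t. k s \<le> h (f s))"
    by (intro exI[of _ "\<lambda>s. h (l s)"] exI[of _ "h' * (d - e')"]) (simp add: lt)
qed

text \<open>f is compared with the line of slope -e through its value at a. If the last point c at
  which f is not below this line came before b, the Dini bound at c would carry f along a little
  further. Finally e tends to 0.\<close>

lemma rdini_ge_imp_mono:
  fixes f :: "real \<Rightarrow> real"
  assumes "a \<le> b" and cont: "continuous_on {a..b} f"
    and dini: "\<And>t. a \<le> t \<Longrightarrow> t < b \<Longrightarrow> rdini_ge f t 0"
  shows "f a \<le> f b"
proof -
  have "f a - e * (b - a) \<le> f b" if e: "e > 0" for e
  proof -
    define S where "S = {a..b} \<inter> (\<lambda>t. f a - e * (t - a) - f t) -` {..0}"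
    have "closed S"
      unfolding S_def
      by (intro continuous_closed_preimage continuous_intros cont)
    moreover have "bounded S"
      by (rule bounded_subset[OF bounded_closed_interval[of a b]]) (auto simp: S_def)
    ultimately have comp: "compact S"
      by (simp add: compact_eq_bounded_closed)
    have "a \<in> S" using assms(1) by (auto simp: S_def)
    then obtain c where c: "c \<in> S" and max: "\<And>t. t \<in> S \<Longrightarrow> t \<le> c"
      using compact_attains_sup[OF comp] by blast
    have "c = b"
    proof (rule ccontr)
      assume "c \<noteq> b"
      hence cb: "a \<le> c" "c < b" using c by (auto simp: S_def)
      have "\<forall>\<^sub>F s in at_right c. f c + (0 - e) * (s - c) \<le> f s"
        using dini[OF cb] e unfolding rdini_ge_def by blast
      moreover have "\<forall>\<^sub>F s in at_right c. c < s \<and> s < b"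
        using cb(2) eventually_at_right_field by blast
      ultimately have "\<forall>\<^sub>F s in at_right c. s \<in> S \<and> c < s"
      proof eventually_elim
        case (elim s)
        have "f a - e * (c - a) \<le> f c" using c by (auto simp: S_def)
        with elim cb show ?case by (auto simp: S_def algebra_simps)
      qed
      then obtain s where "s \<in> S" "c < s"
        using eventually_happens trivial_limit_at_right_real by blast
      with max show False by fastforce
    qed
    with c show ?thesis by (auto simp: S_def)
  qed
  hence lim: "\<forall>\<^sub>F e in at_right 0. f a - e * (b - a) \<le> f b"
    by (auto simp: eventually_at_filter)
  have "((\<lambda>e. f a - e * (b - a)) \<longlongrightarrow> f a - 0 * (b - a)) (at_right 0)"
    by (intro tendsto_intros)
  thus ?thesis
    using tendsto_upperbound[OF _ lim] by simp
qed

section \<open>The scalar differential inequality\<close>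

lemma phi_m_DERIV:
  assumes "m \<ge> 0" "t > 0"
  shows "(phi_m m has_real_derivative t powr m) (at t within S)"
  unfolding phi_m_def using assms by (auto intro!: derivative_eq_intros)

text \<open>The derivative t^m is at least 1 for t >= 1: the new time runs at least as fast as
  t.\<close>

lemma phi_m_diff_ge:
  assumes "m \<ge> 0" "1 \<le> s" "s \<le> t"
  shows "t - s \<le> phi_m m t - phi_m m s"
proof -
  have "phi_m m s - s \<le> phi_m m t - t"
  proof (rule DERIV_nonneg_imp_nondecreasing[OF assms(3)])
    fix x assume x: "s \<le> x" "x \<le> t"
    have "((\<lambda>x. phi_m m x - x) has_real_derivative x powr m - 1) (at x)"
      using assms x by (auto intro!: derivative_eq_intros phi_m_DERIV)
    moreover have "x powr m \<ge> 1"
      using assms x by (intro ge_one_powr_ge_zero) auto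
    ultimately show "\<exists>y. ((\<lambda>x. phi_m m x - x) has_real_derivative y) (at x) \<and> 0 \<le> y"
      by (intro exI[of _ "x powr m - 1"]) auto
  qed
  thus ?thesis by linarith
qed

lemma at_right_le_at_within:
  fixes t :: real
  assumes "a \<le> t" "t < b"
  shows "at_right t \<le> at t within {a..<b}"
proof -
  have "at_right t = at t within {t<..<b}"
    using assms(2) by (simp add: at_within_nhd[of t "{..<b}" "{t<..}" "{t<..<b}"] Int_def set_eq_iff)
  also have "\<dots> \<le> at t within {a..<b}"
    using assms by (intro at_le) auto
  finally show ?thesis .
qed

lemma DERIV_within_imp_right:
  fixes t :: real
  assumes "(f has_real_derivative d) (at t within {a..<b})" "a \<le> t" "t < b"
  shows "(f has_real_derivative d) (at_right t)"
  using assms(1) tendsto_mono[OF at_right_le_at_within[OF assms(2,3)]]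
  unfolding has_field_derivative_iff by blast

text \<open>The tested problem with an unspecified nonnegative forcing \<open>H\<close>. Assumption
  \<open>V_1\<close> is the pointwise sign condition on the data, integrated against
  \<open>eig\<close>.\<close>

locale damped_tricomi_ode =
  fixes m \<mu> \<nu> T :: real and U V H :: "real \<Rightarrow> real"
  assumes m: "m \<ge> 0" and \<delta>: "(\<mu> - 1)\<^sup>2 - 4 * \<nu>\<^sup>2 \<ge> 0"
    and DERIV_U: "1 \<le> t \<Longrightarrow> t < T \<Longrightarrow> (U has_real_derivative V t) (at t within {1..<T})"
    and cont_V: "continuous_on {1..<T} V"
    and dini_V: "1 \<le> t \<Longrightarrow> t < T \<Longrightarrow>
      rdini_ge V t ((t powr (2 * m) - \<nu>\<^sup>2 / t\<^sup>2) * U t - \<mu> / t * V t + H t)"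
    and H_nonneg: "1 \<le> t \<Longrightarrow> t < T \<Longrightarrow> H t \<ge> 0"
    and U_1: "U 1 \<ge> 0" and V_1: "V 1 + (\<mu> - 1 - sqrt ((\<mu> - 1)\<^sup>2 - 4 * \<nu>\<^sup>2)) / 2 * U 1 > 0"
    and T: "T > 1"
begin

text \<open>In the new time the first-order coefficient becomes (\<mu> + m) / t^(m + 1); the weight
  t^b with 2 b = \<mu> + m removes it.\<close>

definition b :: real where "b = (\<mu> + m) / 2"
text \<open>The larger root of x (x - m - 1) = q, real because \<delta> >= 0. Hence t^a solves the
  equation in which only the potential q / t^(2 m + 2) is kept.\<close>

definition a :: real where "a = (m + 1 + sqrt ((\<mu> - 1)\<^sup>2 - 4 * \<nu>\<^sup>2)) / 2"
definition q :: real where "q = b\<^sup>2 - (m + 1) * b - \<nu>\<^sup>2"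
definition g :: "real \<Rightarrow> real" where "g t = t powr b * U t"

text \<open>Liouville transform: with respect to the new time \<open>phi_m m t\<close> the derivative of \<open>g\<close> is
  \<open>\<gamma>\<close>, and \<open>g\<close> solves \<open>g'' = (1 + O(1/s\<^sup>2)) g\<close> up to the nonnegative forcing.\<close>

definition \<gamma> :: "real \<Rightarrow> real" where
  "\<gamma> t = t powr (b - m) * V t + b * t powr (b - m - 1) * U t"

lemma a_pos: "a > 0"
  using m \<delta> by (simp add: a_def add_pos_nonneg)

lemma a_eq: "a * (a - m - 1) = q"
proof -
  have "a * (a - m - 1) = ((sqrt ((\<mu> - 1)\<^sup>2 - 4 * \<nu>\<^sup>2))\<^sup>2 - (m + 1)\<^sup>2) / 4"
    by (simp add: a_def power2_eq_square field_simps)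
  also have "\<dots> = q"
    using \<delta> by (simp add: q_def b_def power2_eq_square field_simps)
  finally show ?thesis .
qed

lemma DERIV_g:
  assumes "1 \<le> t" "t < T"
  shows "(g has_real_derivative t powr m * \<gamma> t) (at t within {1..<T})"
proof -
  have "((\<lambda>t. t powr b * U t) has_real_derivative b * t powr (b - 1) * U t + V t * t powr b)
      (at t within {1..<T})"
    using assms by (auto intro!: derivative_eq_intros DERIV_U)
  moreover have "b * t powr (b - 1) * U t + V t * t powr b = t powr m * \<gamma> t"
    using assms by (simp add: \<gamma>_def powr_diff powr_add field_simps)
  ultimately show ?thesis by (simp add: g_def[abs_def])
qed

text \<open>After inserting the inequality for \<open>V\<close>, all terms in \<open>V\<close>
  cancel by the choice of b, and the terms in \<open>U\<close> combine to the factor 1 + q / t^(2 m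
  + 2).\<close>

lemma dini_\<gamma>:
  assumes "1 \<le> t" "t < T"
  shows "rdini_ge \<gamma> t (t powr m * (1 + q * t powr (- 2 * m - 2)) * g t + t powr (b - m) * H t)"
proof -
  have 1: "((\<lambda>t. t powr (b - m)) has_real_derivative (b - m) * t powr (b - m - 1)) (at_right t)"
    using assms by (auto intro!: derivative_eq_intros)
  have 2: "((\<lambda>t. b * t powr (b - m - 1) * U t) has_real_derivative
      b * ((b - m - 1) * t powr (b - m - 2)) * U t + V t * (b * t powr (b - m - 1))) (at_right t)"
    using assms by (auto intro!: derivative_eq_intros DERIV_within_imp_right[OF DERIV_U])
  have 3: "rdini_ge \<gamma> t ((t powr (b - m) *
        ((t powr (2 * m) - \<nu>\<^sup>2 / t\<^sup>2) * U t - \<mu> / t * V t + H t)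
        + (b - m) * t powr (b - m - 1) * V t)
      + (b * ((b - m - 1) * t powr (b - m - 2)) * U t + V t * (b * t powr (b - m - 1))))"
    unfolding \<gamma>_def[abs_def]
    using assms by (intro rdini_ge_add rdini_ge_mult[OF dini_V 1] DERIV_right_imp_rdini_ge[OF 2]) auto
  have \<mu>': "\<mu> = 2 * b - m" by (simp add: b_def field_simps)
  have sq: "t powr (2 * m) = t powr m * t powr m"
    by (simp add: powr_add[symmetric])
  have neg: "t powr (- 2 * m - 2) = 1 / (t powr m * t powr m * t\<^sup>2)"
    using assms by (simp add: powr_diff powr_minus sq divide_simps)
  have "t powr m * (1 + q * t powr (- 2 * m - 2)) * g t + t powr (b - m) * H t =
      (t powr (b - m) *
        ((t powr (2 * m) - \<nu>\<^sup>2 / t\<^sup>2) * U t - \<mu> / t * V t + H t)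
        + (b - m) * t powr (b - m - 1) * V t)
      + (b * ((b - m - 1) * t powr (b - m - 2)) * U t + V t * (b * t powr (b - m - 1)))"
  proof -
    \<comment> \<open>In these letters the claim is a polynomial identity modulo M j = 1.\<close>
    define M i j X where "M = t powr m" and "i = 1 / t" and "j = 1 / t powr m" and "X = t powr b"
    have "M * j = 1" using assms by (simp add: M_def j_def)
    hence "M * (1 + (b\<^sup>2 - (m + 1) * b - \<nu>\<^sup>2) * (j * j * (i * i))) * (X * U t) + X * j * H t =
      (X * j * ((M * M - \<nu>\<^sup>2 * (i * i)) * U t - (2 * b - m) * i * V t + H t)
        + (b - m) * (X * j * i) * V t)
      + (b * ((b - m - 1) * (X * j * (i * i))) * U t + V t * (b * (X * j * i)))"
      by algebra
    moreover have "t powr (- 2 * m - 2) = j * j * (i * i)"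
      unfolding neg i_def j_def by (simp add: power2_eq_square)
    moreover have "t powr (b - m) = X * j" "t powr (b - m - 1) = X * j * i"
      "t powr (b - m - 2) = X * j * (i * i)" "\<nu>\<^sup>2 / t\<^sup>2 = \<nu>\<^sup>2 * (i * i)"
      using assms by (simp_all add: X_def i_def j_def powr_diff power2_eq_square)
    moreover have "\<mu> / t = (2 * b - m) * i"
      by (simp add: \<mu>'[symmetric] i_def)
    ultimately show ?thesis
      unfolding g_def q_def sq M_def[symmetric] X_def[symmetric] by simp
  qed
  with 3 show ?thesis by simp
qed

lemma cont_g: "continuous_on {1..<T} g"
  by (rule continuous_on_vector_derivative[where f' = "\<lambda>t. t powr m * \<gamma> t"])
    (use DERIV_g in \<open>auto simp: has_real_derivative_iff_has_vector_derivative[symmetric]\<close>)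

lemma cont_U: "continuous_on {1..<T} U"
  by (rule continuous_on_vector_derivative[where f' = V])
    (use DERIV_U in \<open>auto simp: has_real_derivative_iff_has_vector_derivative[symmetric]\<close>)

lemma cont_\<gamma>: "continuous_on {1..<T} \<gamma>"
  unfolding \<gamma>_def[abs_def] by (intro continuous_intros cont_V cont_U) auto

lemma cont_within:
  assumes "continuous_on {1..<T} f" "1 \<le> s" "t < T"
  shows "continuous_on {s..t} f"
  using assms(1) by (rule continuous_on_subset) (use assms(2,3) in auto)

text \<open>The Wronskian of t^a and g in the new time. As t^a absorbs the potential q / t^(2 m +
  2), only the term g and the forcing contribute to the derivative of \<open>W\<close>.\<close>

definition W :: "real \<Rightarrow> real" where
  "W t = t powr a * \<gamma> t - a * t powr (a - m - 1) * g t"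

text \<open>b - a = (\<mu> - 1 - sqrt \<delta>) / 2, so the sign condition on the data says exactly
  that the Wronskian starts positive.\<close>

lemma W_1: "W 1 = V 1 + (\<mu> - 1 - sqrt ((\<mu> - 1)\<^sup>2 - 4 * \<nu>\<^sup>2)) / 2 * U 1"
  by (simp add: W_def \<gamma>_def g_def a_def b_def field_simps)

lemma cont_W: "continuous_on {1..<T} W"
  unfolding W_def[abs_def] by (intro continuous_intros cont_\<gamma> cont_g) auto

lemma dini_W:
  assumes "1 \<le> t" "t < T"
  shows "rdini_ge W t (t powr (a + m) * g t)"
proof -
  have 1: "((\<lambda>t. t powr a) has_real_derivative a * t powr (a - 1)) (at_right t)"
    using assms by (auto intro!: derivative_eq_intros)
  have 2: "((\<lambda>t. - a * t powr (a - m - 1) * g t) has_real_derivative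
      - a * ((a - m - 1) * t powr (a - m - 2)) * g t + (t powr m * \<gamma> t) * (- a * t powr (a - m - 1)))
      (at_right t)"
    using assms by (auto intro!: derivative_eq_intros DERIV_within_imp_right[OF DERIV_g])
  have 3: "rdini_ge W t ((t powr a * (t powr m * (1 + q * t powr (- 2 * m - 2)) * g t + t powr (b - m) * H t)
        + a * t powr (a - 1) * \<gamma> t)
      + (- a * ((a - m - 1) * t powr (a - m - 2)) * g t + (t powr m * \<gamma> t) * (- a * t powr (a - m - 1))))"
    using assms rdini_ge_add[OF rdini_ge_mult[OF dini_\<gamma> 1] DERIV_right_imp_rdini_ge[OF 2]]
    by (simp add: W_def[abs_def])
  have sq: "t powr (2 * m) = t powr m * t powr m"
    by (simp add: powr_add[symmetric])
  have neg: "t powr (- 2 * m - 2) = 1 / (t powr m * t powr m * t\<^sup>2)"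
    using assms by (simp add: powr_diff powr_minus sq divide_simps)
  have "(t powr a * (t powr m * (1 + q * t powr (- 2 * m - 2)) * g t + t powr (b - m) * H t)
        + a * t powr (a - 1) * \<gamma> t)
      + (- a * ((a - m - 1) * t powr (a - m - 2)) * g t + (t powr m * \<gamma> t) * (- a * t powr (a - m - 1)))
     = t powr (a + m) * g t + t powr a * t powr (b - m) * H t"
  proof -
    define M i j X where "M = t powr m" and "i = 1 / t" and "j = 1 / t powr m" and "X = t powr a"
    have "M * j = 1" using assms by (simp add: M_def j_def)
    hence "(X * (M * (1 + (a * (a - m - 1)) * (j * j * (i * i))) * g t + t powr (b - m) * H t)
        + a * (X * i) * \<gamma> t)
      + (- a * ((a - m - 1) * (X * j * (i * i))) * g t + (M * \<gamma> t) * (- a * (X * j * i)))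
     = X * M * g t + X * t powr (b - m) * H t"
      by algebra
    moreover have "t powr (- 2 * m - 2) = j * j * (i * i)"
      unfolding neg i_def j_def by (simp add: power2_eq_square)
    moreover have "t powr (a - 1) = X * i" "t powr (a - m - 1) = X * j * i"
      "t powr (a - m - 2) = X * j * (i * i)" "t powr (a + m) = X * M"
      using assms by (simp_all add: X_def M_def i_def j_def powr_diff powr_add power2_eq_square)
    ultimately show ?thesis
      unfolding a_eq[symmetric] M_def[symmetric] X_def[symmetric] by simp
  qed
  moreover have "t powr a * t powr (b - m) * H t \<ge> 0"
    using H_nonneg[OF assms] by simp
  ultimately show ?thesis
    by (intro rdini_ge_mono[OF 3]) linarith
qed

text \<open>The quotient rule for g / t^a, with the Wronskian as numerator.\<close>

lemma dini_g_scaled: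
  assumes "1 \<le> t" "t < T"
  shows "rdini_ge (\<lambda>t. t powr (- a) * g t) t (t powr (m - 2 * a) * W t)"
proof -
  have "((\<lambda>t. t powr (- a) * g t) has_real_derivative
      - a * t powr (- a - 1) * g t + (t powr m * \<gamma> t) * t powr (- a)) (at_right t)"
    using assms by (auto intro!: derivative_eq_intros DERIV_within_imp_right[OF DERIV_g])
  moreover have "- a * t powr (- a - 1) * g t + (t powr m * \<gamma> t) * t powr (- a) = t powr (m - 2 * a) * W t"
  proof -
    have "t powr (2 * a) = t powr a * t powr a"
      by (simp add: powr_add[symmetric])
    thus ?thesis
      using assms by (simp add: W_def powr_diff powr_minus powr_add field_simps)
  qed
  ultimately show ?thesis
    using DERIV_right_imp_rdini_ge by simp
qed

lemma g_nonneg_if: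
  assumes "1 \<le> t" "t < T" and pos: "\<And>s. 1 \<le> s \<Longrightarrow> s < t \<Longrightarrow> W s > 0"
  shows "g t \<ge> 0"
proof -
  have "1 powr (- a) * g 1 \<le> t powr (- a) * g t"
  proof (rule rdini_ge_imp_mono[OF assms(1)])
    show "continuous_on {1..t} (\<lambda>t. t powr (- a) * g t)"
      using assms by (intro continuous_intros cont_within[OF cont_g]) auto
    fix s assume s: "1 \<le> s" "s < t"
    show "rdini_ge (\<lambda>t. t powr (- a) * g t) s 0"
      using s assms(2) pos[OF s] by (intro rdini_ge_mono[OF dini_g_scaled]) auto
  qed
  moreover have "g 1 \<ge> 0" using U_1 by (simp add: g_def)
  ultimately have "0 \<le> t powr (- a) * g t" by simp
  moreover have "t powr (- a) > 0" using assms by simp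
  ultimately show ?thesis by (simp add: zero_le_mult_iff)
qed

lemma W_mono_if:
  assumes "1 \<le> t" "t < T" and pos: "\<And>s. 1 \<le> s \<Longrightarrow> s < t \<Longrightarrow> W s > 0"
  shows "W 1 \<le> W t"
proof (rule rdini_ge_imp_mono[OF assms(1)])
  show "continuous_on {1..t} W"
    using assms by (intro cont_within[OF cont_W]) auto
  fix s assume s: "1 \<le> s" "s < t"
  have "g s \<ge> 0" using s assms by (intro g_nonneg_if) auto
  then show "rdini_ge W s 0"
    using s assms(2) by (intro rdini_ge_mono[OF dini_W]) auto
qed

text \<open>A circle broken by continuity: W > 0 up to some time makes g / t^a nondecreasing, hence
  g >= 0, hence W nondecreasing. At the first time c with W <= 0 this gives W c >= W 1 > 0, a
  contradiction.\<close>

lemma W_pos: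
  assumes "1 \<le> t" "t < T"
  shows "W t > 0"
proof (rule ccontr)
  assume neg: "\<not> W t > 0"
  define S where "S = {1..t} \<inter> W -` {..0}"
  have "closed S"
    unfolding S_def using assms
    by (intro continuous_closed_preimage cont_within[OF cont_W]) auto
  moreover have "bounded S"
    by (rule bounded_subset[OF bounded_closed_interval[of 1 t]]) (auto simp: S_def)
  ultimately have "compact S"
    by (simp add: compact_eq_bounded_closed)
  moreover have "t \<in> S" using neg assms by (simp add: S_def)
  ultimately obtain c where c: "c \<in> S" and min: "\<And>s. s \<in> S \<Longrightarrow> c \<le> s"
    using compact_attains_inf[of S] by blast
  have "W 1 \<le> W c"
    using c assms min by (intro W_mono_if) (force simp: S_def not_less)+
  moreover have "W 1 > 0" using V_1 W_1 by simp
  ultimately show False using c by (simp add: S_def)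
qed

lemma g_nonneg: "1 \<le> t \<Longrightarrow> t < T \<Longrightarrow> g t \<ge> 0"
  using W_pos by (intro g_nonneg_if) auto

lemma W_ge: "1 \<le> t \<Longrightarrow> t < T \<Longrightarrow> W 1 \<le> W t"
  using W_pos by (intro W_mono_if) auto

text \<open>Carries the size of the data forward in time: the bound is linear in W 1, hence in
  \<epsilon>.\<close>

lemma \<gamma>_ge:
  assumes "1 \<le> t" "t < T"
  shows "t powr (- a) * W 1 \<le> \<gamma> t"
proof -
  have "0 \<le> a * t powr (a - m - 1) * g t"
    using a_pos g_nonneg[OF assms] by simp
  hence "W 1 \<le> t powr a * \<gamma> t"
    using W_ge[OF assms] by (simp add: W_def)
  thus ?thesis
    using assms by (simp add: powr_minus field_simps)
qed

lemma \<gamma>_pos: "1 \<le> t \<Longrightarrow> t < T \<Longrightarrow> \<gamma> t > 0"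
  using \<gamma>_ge[of t] V_1 W_1 by (smt (verit) mult_pos_pos powr_gt_zero)

lemma g_mono:
  assumes "1 \<le> s" "s \<le> t" "t < T"
  shows "g s \<le> g t"
proof (rule rdini_ge_imp_mono[OF assms(2)])
  show "continuous_on {s..t} g"
    using assms by (intro cont_within[OF cont_g])
  fix x assume x: "s \<le> x" "x < t"
  have "rdini_ge g x (x powr m * \<gamma> x)"
    using x assms by (intro DERIV_right_imp_rdini_ge DERIV_within_imp_right[OF DERIV_g]) auto
  then show "rdini_ge g x 0"
    using x assms \<gamma>_pos[of x] by (elim rdini_ge_mono) auto
qed

section \<open>Comparison of \<gamma>, g and V at large times\<close>

lemma q_small:
  assumes "1 \<le> t0" "\<bar>q\<bar> \<le> t0\<^sup>2 / 4" "t0 \<le> t"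
  shows "\<bar>q * t powr (- 2 * m - 2)\<bar> \<le> 1 / 4"
proof -
  have "t powr (- 2 * m - 2) \<le> t powr (- 2)"
    using assms m by (intro powr_mono) auto
  also have "\<dots> = 1 / t\<^sup>2"
    using assms by (simp add: powr_minus divide_simps)
  finally have 1: "t powr (- 2 * m - 2) \<le> 1 / t\<^sup>2" .
  have "t0\<^sup>2 \<le> t\<^sup>2" using assms by (intro power_mono) auto
  hence 2: "\<bar>q\<bar> \<le> t\<^sup>2 / 4" using assms by linarith
  have "\<bar>q * t powr (- 2 * m - 2)\<bar> \<le> (t\<^sup>2 / 4) * (1 / t\<^sup>2)"
    unfolding abs_mult using 1 2 by (intro mult_mono) auto
  also have "\<dots> = 1 / 4" using assms by simp
  finally show ?thesis .
qed

text \<open>In the new time the derivative of f is at least E (3/4 g - 1/4 g - 1/2 g(t0)) >= 0. The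
  subtracted constant g(t0) pays for the unfavourable start: f(t0) >= -(3/2) E(t0) g(t0), while E
  grows by the factor e^(1/2) >= 3/2 within one unit of time. The waiting time is thus independent
  of the size of g.\<close>

lemma \<gamma>_ge_half_g:
  assumes t0: "1 \<le> t0" "\<bar>q\<bar> \<le> t0\<^sup>2 / 4" and t: "t0 + 1 \<le> t" "t < T"
  shows "g t / 2 \<le> \<gamma> t"
proof -
  define E where "E = (\<lambda>t. exp (phi_m m t / 2))"
  define f where "f = (\<lambda>t. E t * (\<gamma> t + (- g t / 2 - g t0)))"
  have "f t0 \<le> f t"
  proof (rule rdini_ge_imp_mono[of t0 t f])
    show "t0 \<le> t" using t by simp
    show "continuous_on {t0..t} f"
      unfolding f_def E_def phi_m_def using t0 t m
      by (intro continuous_intros cont_within[OF cont_g] cont_within[OF cont_\<gamma>]) auto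
    fix x assume x: "t0 \<le> x" "x < t"
    have x1: "1 \<le> x" "x < T" using x t t0 by auto
    have E: "(E has_real_derivative E x * (x powr m / 2)) (at_right x)"
      unfolding E_def using x1 m by (auto intro!: derivative_eq_intros phi_m_DERIV)
    have 1: "((\<lambda>t. - g t / 2 - g t0) has_real_derivative - (x powr m * \<gamma> x) / 2) (at_right x)"
      using x1 by (auto intro!: derivative_eq_intros DERIV_within_imp_right[OF DERIV_g])
    have "rdini_ge f x (E x * ((x powr m * (1 + q * x powr (- 2 * m - 2)) * g x + x powr (b - m) * H x)
       + (- (x powr m * \<gamma> x) / 2)) + E x * (x powr m / 2) * (\<gamma> x + (- g x / 2 - g t0)))"
      unfolding f_def
      by (intro rdini_ge_mult[OF _ E] rdini_ge_add[OF dini_\<gamma>[OF x1]] DERIV_right_imp_rdini_ge[OF 1])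
        (simp add: E_def)
    moreover have "0 \<le> E x * ((x powr m * (1 + q * x powr (- 2 * m - 2)) * g x + x powr (b - m) * H x)
       + (- (x powr m * \<gamma> x) / 2)) + E x * (x powr m / 2) * (\<gamma> x + (- g x / 2 - g t0))"
    proof -
      have "3 / 4 \<le> 1 + q * x powr (- 2 * m - 2)"
        using q_small[OF t0 x(1)] by (simp only: abs_le_iff) linarith
      hence "(3 / 4) * g x \<le> (1 + q * x powr (- 2 * m - 2)) * g x"
        using g_nonneg[OF x1] by (rule mult_right_mono)
      moreover have "g t0 \<le> g x" using x t t0 by (intro g_mono) auto
      ultimately have "0 \<le> (1 + q * x powr (- 2 * m - 2)) * g x - g x / 4 - g t0 / 2" by simp
      hence "0 \<le> E x * (x powr m * ((1 + q * x powr (- 2 * m - 2)) * g x - g x / 4 - g t0 / 2))"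
        by (simp add: E_def)
      moreover have "0 \<le> E x * (x powr (b - m) * H x)"
        using H_nonneg[OF x1] by (simp add: E_def)
      ultimately show ?thesis by (simp add: algebra_simps)
    qed
    ultimately show "rdini_ge f x 0" by (rule rdini_ge_mono)
  qed
  hence "E t0 * (\<gamma> t0 - g t0 / 2 - g t0) \<le> E t * (\<gamma> t - g t / 2 - g t0)"
    by (simp add: f_def algebra_simps)
  moreover have "E t0 * (- (3 / 2) * g t0) \<le> E t0 * (\<gamma> t0 - g t0 / 2 - g t0)"
    using \<gamma>_pos[of t0] t0 t by (intro mult_left_mono) (auto simp: E_def)
  moreover have "E t0 * (3 / 2) \<le> E t"
  proof -
    have "1 \<le> phi_m m t - phi_m m t0"
      using phi_m_diff_ge[OF m t0(1), of t] t by simp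
    have "3 / 2 \<le> exp (1 / 2 :: real)"
      using exp_ge_add_one_self[of "1 / 2 :: real"] by simp
    also have "\<dots> \<le> exp ((phi_m m t - phi_m m t0) / 2)"
      using \<open>1 \<le> phi_m m t - phi_m m t0\<close> by simp
    finally have "E t0 * (3 / 2) \<le> E t0 * exp ((phi_m m t - phi_m m t0) / 2)"
      by (intro mult_left_mono) (auto simp: E_def)
    also have "\<dots> = E t" by (simp add: E_def exp_add[symmetric] field_simps)
    finally show ?thesis .
  qed
  hence "E t0 * (3 / 2) * g t0 \<le> E t * g t0"
    using g_nonneg[of t0] t0 t by (intro mult_right_mono) auto
  ultimately have "0 \<le> E t * (\<gamma> t - g t / 2)"
    by (simp add: algebra_simps)
  thus ?thesis by (simp add: E_def zero_le_mult_iff)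
qed

text \<open>V = t^(m - b) (\<gamma> - b g / t^(m + 1)). For t >= 4 b the subtracted term is at most
  g / 4 <= \<gamma> / 2, and the remaining \<gamma> / 2 is at least (\<gamma> + g) / 6 because g <=
  2 \<gamma>.\<close>

lemma V_ge:
  assumes t0: "1 \<le> t0" "\<bar>q\<bar> \<le> t0\<^sup>2 / 4" "4 * b \<le> t0" and t: "t0 + 1 \<le> t" "t < T"
  shows "t powr (m - b) * (\<gamma> t + g t) / 6 \<le> V t"
proof -
  have t1: "1 \<le> t" "t < T" using t t0 by auto
  have g: "g t \<le> 2 * \<gamma> t" using \<gamma>_ge_half_g[OF t0(1,2) t] by simp
  have "t powr 1 \<le> t powr (m + 1)"
    using t1 m by (intro powr_mono) auto
  hence "4 * b \<le> t powr (m + 1)" using t0 t by simp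
  hence "b * t powr (- m - 1) \<le> 1 / 4"
    using t1 by (simp add: powr_diff powr_minus powr_add field_simps)
  hence "b * t powr (- m - 1) * g t \<le> 1 / 4 * g t"
    using g_nonneg[OF t1] by (rule mult_right_mono)
  also have "\<dots> \<le> \<gamma> t / 2" using g by simp
  finally have "(\<gamma> t + g t) / 6 \<le> \<gamma> t - b * t powr (- m - 1) * g t"
    using g by simp
  hence "t powr (m - b) * ((\<gamma> t + g t) / 6) \<le> t powr (m - b) * (\<gamma> t - b * t powr (- m - 1) * g t)"
    by (intro mult_left_mono) auto
  also have "\<dots> = V t"
    using t1 by (simp add: \<gamma>_def g_def powr_diff powr_minus powr_add field_simps)
  finally show ?thesis by simp
qed

text \<open>e^(-phi_m) alone is the right factor when q = 0. The second exponent has derivative |q|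
  / t^(m + 2) = t^m |q| / t^(2 m + 2), which outweighs the potential whatever the sign of q. For t
  >= 1 it lies between -|q| and 0, so it costs only a constant factor.\<close>

definition \<omega> :: "real \<Rightarrow> real" where
  "\<omega> t = exp (- phi_m m t - \<bar>q\<bar> * t powr (- m - 1) / (m + 1))"

definition Z :: "real \<Rightarrow> real" where "Z t = \<omega> t * (\<gamma> t + g t)"

lemma \<omega>_pos: "\<omega> t > 0"
  by (simp add: \<omega>_def)

lemma \<omega>_bounds:
  assumes "1 \<le> t"
  shows "exp (- phi_m m t - \<bar>q\<bar>) \<le> \<omega> t" "\<omega> t \<le> exp (- phi_m m t)"
proof -
  have "t powr (- m - 1) \<le> t powr 0"
    using assms m by (intro powr_mono) auto
  hence "t powr (- m - 1) / (m + 1) \<le> 1 / 1"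
    using assms m by (intro frac_le) auto
  hence "\<bar>q\<bar> * (t powr (- m - 1) / (m + 1)) \<le> \<bar>q\<bar> * 1"
    by (intro mult_left_mono) auto
  thus "exp (- phi_m m t - \<bar>q\<bar>) \<le> \<omega> t" by (simp add: \<omega>_def)
  show "\<omega> t \<le> exp (- phi_m m t)" using m by (simp add: \<omega>_def)
qed

lemma Z_pos: "1 \<le> t \<Longrightarrow> t < T \<Longrightarrow> Z t > 0"
  using \<gamma>_pos[of t] g_nonneg[of t] \<omega>_pos[of t] by (simp add: Z_def add_pos_nonneg)

lemma cont_Z: "continuous_on {1..<T} Z"
  unfolding Z_def[abs_def] \<omega>_def phi_m_def using m
  by (intro continuous_intros cont_g cont_\<gamma>) auto

lemma dini_Z:
  assumes "1 \<le> t" "t < T"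
  shows "rdini_ge Z t (\<omega> t * (t powr (b - m) * H t))"
proof -
  have \<omega>: "(\<omega> has_real_derivative \<omega> t * (- (t powr m) + \<bar>q\<bar> * t powr (- m - 2))) (at_right t)"
  proof -
    have "((\<lambda>t. - phi_m m t - \<bar>q\<bar> * t powr (- m - 1) / (m + 1)) has_real_derivative
        - (t powr m) - \<bar>q\<bar> * ((- m - 1) * t powr (- m - 1 - 1)) / (m + 1)) (at_right t)"
      using assms m 
      by (intro DERIV_diff DERIV_minus DERIV_cdivide DERIV_cmult phi_m_DERIV
          has_field_derivative_at_within[OF has_real_derivative_powr]) auto
    moreover have "- (t powr m) - \<bar>q\<bar> * ((- m - 1) * t powr (- m - 1 - 1)) / (m + 1)
        = - (t powr m) + \<bar>q\<bar> * t powr (- m - 2)"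
    proof -
      have "(- m - 1) / (m + 1) = -1" using m by (simp add: field_simps)
      hence "\<bar>q\<bar> * ((- m - 1) * t powr (- m - 1 - 1)) / (m + 1) = - (\<bar>q\<bar> * t powr (- m - 1 - 1))"
        by (metis (no_types, lifting) mult.assoc mult.commute mult_minus1 times_divide_eq_right)
      moreover have "- m - 1 - 1 = - m - 2" by simp
      ultimately show ?thesis by (simp only:)
    qed
    ultimately have "((\<lambda>t. - phi_m m t - \<bar>q\<bar> * t powr (- m - 1) / (m + 1)) has_real_derivative
        - (t powr m) + \<bar>q\<bar> * t powr (- m - 2)) (at_right t)"
      by (simp only:)
    from DERIV_chain2[OF DERIV_exp this] show ?thesis
      unfolding \<omega>_def[abs_def] .
  qed
  have 1: "rdini_ge g t (t powr m * \<gamma> t)"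
    using assms by (intro DERIV_right_imp_rdini_ge DERIV_within_imp_right[OF DERIV_g]) auto
  have 2: "rdini_ge Z t (\<omega> t * ((t powr m * (1 + q * t powr (- 2 * m - 2)) * g t + t powr (b - m) * H t)
      + t powr m * \<gamma> t) + \<omega> t * (- (t powr m) + \<bar>q\<bar> * t powr (- m - 2)) * (\<gamma> t + g t))"
    unfolding Z_def[abs_def]
    by (intro rdini_ge_mult[OF _ \<omega>] rdini_ge_add[OF dini_\<gamma>[OF assms]] 1 \<omega>_pos)
  have pw: "t powr m * t powr (- 2 * m - 2) = t powr (- m - 2)"
    by (simp add: powr_add[symmetric])
  have "0 \<le> (\<bar>q\<bar> + q) * g t + \<bar>q\<bar> * \<gamma> t"
  proof (rule add_nonneg_nonneg)
    show "0 \<le> (\<bar>q\<bar> + q) * g t"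
      using g_nonneg[OF assms] by (intro mult_nonneg_nonneg) linarith+
    show "0 \<le> \<bar>q\<bar> * \<gamma> t"
      using \<gamma>_pos[OF assms] by simp
  qed
  hence "0 \<le> \<omega> t * (t powr (- m - 2) * ((\<bar>q\<bar> + q) * g t + \<bar>q\<bar> * \<gamma> t))"
    using \<omega>_pos[of t] by simp
  also have "\<dots> = \<omega> t * ((t powr m * (1 + q * t powr (- 2 * m - 2)) * g t + t powr (b - m) * H t)
      + t powr m * \<gamma> t) + \<omega> t * (- (t powr m) + \<bar>q\<bar> * t powr (- m - 2)) * (\<gamma> t + g t)
      - \<omega> t * (t powr (b - m) * H t)"
    unfolding pw[symmetric] by (simp add: algebra_simps)
  finally show ?thesis
    by (intro rdini_ge_mono[OF 2]) linarith
qed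

text \<open>The exponentials of phi_m cancel, p + (1 - p) - 1 = 0: the three parts come from the
  p-th power of V, from the mass of \<open>eig\<close> and from \<omega>. The powers of t add up to
  (m - b) p + (b - m) + d (1 - p) = (1 - p)(b - m + d).\<close>

lemma dini_Z_superlinear:
  assumes p: "p > 1" and c0: "c0 \<ge> 0"
    and t0: "1 \<le> t0" "\<bar>q\<bar> \<le> t0\<^sup>2 / 4" "4 * b \<le> t0" and t: "t0 + 1 \<le> t" "t < T"
    and H: "c0 * \<bar>V t\<bar> powr p * (exp (phi_m m t) * t powr d) powr (1 - p) \<le> H t"
  shows "rdini_ge Z t (c0 * exp (- \<bar>q\<bar>) * 6 powr (- p) * t powr ((1 - p) * (b - m + d)) * Z t powr p)"
proof -
  define F where "F = phi_m m t"
  have t1: "1 \<le> t" "t < T" using t t0 by auto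
  have Zp: "Z t > 0" by (rule Z_pos[OF t1])
  have "Z t \<le> exp (- F) * (\<gamma> t + g t)"
    unfolding Z_def F_def using \<omega>_bounds(2)[OF t1(1)] \<gamma>_pos[OF t1] g_nonneg[OF t1]
    by (intro mult_right_mono) auto
  hence "exp F * Z t \<le> \<gamma> t + g t" by (simp add: exp_minus field_simps)
  hence "t powr (m - b) * (exp F * Z t) / 6 \<le> t powr (m - b) * (\<gamma> t + g t) / 6"
    by (intro divide_right_mono mult_left_mono) auto
  also have "\<dots> \<le> V t" by (rule V_ge[OF t0 t])
  finally have V: "t powr (m - b) * (exp F * Z t) / 6 \<le> \<bar>V t\<bar>" by simp
  have "t powr ((m - b) * p) * (exp (F * p) * Z t powr p) * 6 powr (- p)
      = (t powr (m - b) * (exp F * Z t) / 6) powr p"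
    using Zp by (simp add: powr_divide powr_mult powr_powr exp_powr_real powr_minus divide_simps)
  also have "\<dots> \<le> \<bar>V t\<bar> powr p"
    using V Zp p by (intro powr_mono2) auto
  finally have Vp: "t powr ((m - b) * p) * (exp (F * p) * Z t powr p) * 6 powr (- p) \<le> \<bar>V t\<bar> powr p" .
  have "c0 * exp (- \<bar>q\<bar>) * 6 powr (- p) * t powr ((1 - p) * (b - m + d)) * Z t powr p
      = exp (- F - \<bar>q\<bar>) * (t powr (b - m) *
        (c0 * (t powr ((m - b) * p) * (exp (F * p) * Z t powr p) * 6 powr (- p))
          * (exp (F * (1 - p)) * t powr (d * (1 - p)))))"
  proof -
    have "t powr ((1 - p) * (b - m + d)) = t powr (b - m) * t powr ((m - b) * p) * t powr (d * (1 - p))"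
      by (simp add: powr_add[symmetric] algebra_simps)
    moreover have "exp (- \<bar>q\<bar>) = exp (- F - \<bar>q\<bar>) * exp (F * p) * exp (F * (1 - p))"
      by (simp add: exp_add[symmetric] algebra_simps)
    ultimately show ?thesis by (simp only: mult_ac)
  qed
  also have "\<dots> \<le> exp (- F - \<bar>q\<bar>) * (t powr (b - m) *
        (c0 * \<bar>V t\<bar> powr p * (exp (F * (1 - p)) * t powr (d * (1 - p)))))"
    using c0 by (intro mult_left_mono mult_right_mono Vp) auto
  also have "(exp (F * (1 - p)) * t powr (d * (1 - p))) = (exp F * t powr d) powr (1 - p)"
    by (simp add: powr_mult powr_powr exp_powr_real)
  also have "exp (- F - \<bar>q\<bar>) * (t powr (b - m) * (c0 * \<bar>V t\<bar> powr p * (exp F * t powr d) powr (1 - p)))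
      \<le> exp (- F - \<bar>q\<bar>) * (t powr (b - m) * H t)"
    using H unfolding F_def by (intro mult_left_mono) auto
  also have "\<dots> \<le> \<omega> t * (t powr (b - m) * H t)"
    unfolding F_def using \<omega>_bounds(1)[OF t1(1)] H_nonneg[OF t1] by (intro mult_right_mono) auto
  finally show ?thesis by (rule rdini_ge_mono[OF dini_Z[OF t1]])
qed

text \<open>Separation of variables: h is an antiderivative of z^(-p), so h (Z t) - c \<Theta> t is
  nondecreasing, and h <= 0 bounds the growth of \<Theta> for as long as the solution lives.\<close>

lemma lifespan_integral_bound:
  assumes p: "p > 1" and c0: "c0 \<ge> 0"
    and t0: "1 \<le> t0" "\<bar>q\<bar> \<le> t0\<^sup>2 / 4" "4 * b \<le> t0" and t: "t0 + 1 \<le> t" "t < T"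
    and H: "\<And>t. 1 \<le> t \<Longrightarrow> t < T \<Longrightarrow>
      c0 * \<bar>V t\<bar> powr p * (exp (phi_m m t) * t powr d) powr (1 - p) \<le> H t"
    and \<Theta>: "\<And>t. 1 \<le> t \<Longrightarrow> (\<Theta> has_real_derivative t powr ((1 - p) * (b - m + d))) (at t)"
  shows "c0 * exp (- \<bar>q\<bar>) * 6 powr (- p) * (\<Theta> t - \<Theta> (t0 + 1))
    \<le> (exp (- phi_m m (t0 + 1) - \<bar>q\<bar>) * ((t0 + 1) powr (- a) * W 1)) powr (1 - p) / (p - 1)"
proof -
  define c where "c = c0 * exp (- \<bar>q\<bar>) * 6 powr (- p)"
  define t1 where "t1 = t0 + 1"
  have t1: "1 \<le> t1" "t1 < T" using t t0 by (auto simp: t1_def)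
  define h where "h = (\<lambda>z::real. - (z powr (1 - p)) / (p - 1))"
  define f where "f = (\<lambda>t. h (Z t) + - c * \<Theta> t)"
  have "f t1 \<le> f t"
  proof (rule rdini_ge_imp_mono[of t1 t f])
    show "t1 \<le> t" using t by (simp add: t1_def)
    have "continuous_on {t1..t} \<Theta>"
      using t1 by (intro DERIV_continuous_on[of _ _ "\<lambda>t. t powr ((1 - p) * (b - m + d))"]
          has_field_derivative_at_within[OF \<Theta>]) auto
    moreover have "Z x \<noteq> 0" if "x \<in> {t1..t}" for x
      using Z_pos[of x] that t1 t by auto
    ultimately show "continuous_on {t1..t} f"
      unfolding f_def h_def using t1 t p
      by (intro continuous_intros cont_within[OF cont_Z]) auto
    fix x assume x: "t1 \<le> x" "x < t"
    have x1: "1 \<le> x" "x < T" "t0 + 1 \<le> x" using x t t1 by (auto simp: t1_def)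
    have Zx: "Z x > 0" by (rule Z_pos[OF x1(1,2)])
    have h: "(h has_real_derivative Z x powr (- p)) (at (Z x))"
    proof -
      have "(h has_real_derivative - ((1 - p) * Z x powr (1 - p - 1)) / (p - 1)) (at (Z x))"
        unfolding h_def using Zx by (intro DERIV_cdivide DERIV_minus has_real_derivative_powr)
      moreover have "- ((1 - p) * Z x powr (1 - p - 1)) / (p - 1) = Z x powr (- p)"
        using p by (simp add: divide_simps) (simp add: algebra_simps)
      ultimately show ?thesis by simp
    qed
    have mono: "h y \<le> h z" if "0 < y" "y \<le> z" for y z
      unfolding h_def using that p by (intro divide_right_mono) (auto intro!: powr_mono2')
    have "rdini_ge (\<lambda>s. h (Z s)) x (Z x powr (- p) * (c * x powr ((1 - p) * (b - m + d)) * Z x powr p))"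
      using Zx dini_Z_superlinear[OF p c0 t0 x1(3,2) H[OF x1(1,2)]] h mono
      by (intro rdini_ge_compose_mono[where f = Z and h = h]) (auto simp: c_def)
    moreover have "rdini_ge (\<lambda>t. - c * \<Theta> t) x (- c * x powr ((1 - p) * (b - m + d)))"
      by (intro DERIV_right_imp_rdini_ge DERIV_cmult has_field_derivative_at_within[OF \<Theta>[OF x1(1)]])
    ultimately have "rdini_ge f x (Z x powr (- p) * (c * x powr ((1 - p) * (b - m + d)) * Z x powr p)
        + - c * x powr ((1 - p) * (b - m + d)))"
      unfolding f_def by (rule rdini_ge_add)
    moreover have "Z x powr (- p) * Z x powr p = 1"
      using Zx by (simp add: powr_minus)
    hence "Z x powr (- p) * (c * x powr ((1 - p) * (b - m + d)) * Z x powr p)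
        + - c * x powr ((1 - p) * (b - m + d)) = 0"
      by (simp add: mult_ac)
    ultimately show "rdini_ge f x 0" by (simp only:)
  qed
  moreover have "h (Z t) \<le> 0"
    using p by (simp add: h_def)
  ultimately have 1: "c * (\<Theta> t - \<Theta> t1) \<le> Z t1 powr (1 - p) / (p - 1)"
    by (simp add: f_def h_def algebra_simps)
  have "exp (- phi_m m t1 - \<bar>q\<bar>) * (t1 powr (- a) * W 1) \<le> Z t1"
    unfolding Z_def
    using \<omega>_bounds(1)[OF t1(1)] \<gamma>_ge[OF t1] g_nonneg[OF t1] W_pos[of 1] T \<omega>_pos[of t1]
    by (intro mult_mono) auto
  hence "Z t1 powr (1 - p) \<le> (exp (- phi_m m t1 - \<bar>q\<bar>) * (t1 powr (- a) * W 1)) powr (1 - p)"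
    using p W_pos[of 1] T t1 by (intro powr_mono2') auto
  hence "Z t1 powr (1 - p) / (p - 1)
      \<le> (exp (- phi_m m t1 - \<bar>q\<bar>) * (t1 powr (- a) * W 1)) powr (1 - p) / (p - 1)"
    using p by (intro divide_right_mono) auto
  with 1 show ?thesis by (simp add: c_def t1_def)
qed

end

text \<open>Uniformity is the point: \<open>t1\<close> and \<open>K\<close> are fixed before
  \<epsilon>, T and the solution. The data enter as W 1 = \<epsilon> I, whose power 1 - p splits off
  the factor \<epsilon>^(1 - p).\<close>

lemma tricomi_ode_lifespan:
  fixes m \<mu> \<nu> p d c0 I :: real
  assumes m: "m \<ge> 0" and \<delta>: "(\<mu> - 1)\<^sup>2 - 4 * \<nu>\<^sup>2 \<ge> 0"
    and p: "p > 1" and c0: "c0 > 0" and I: "I > 0"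
  obtains t1 K where "t1 \<ge> 1" "K > 0"
    "\<And>\<epsilon> T U V \<Theta> t. \<epsilon> > 0 \<Longrightarrow> t1 \<le> t \<Longrightarrow> t < T \<Longrightarrow>
      (\<And>t. 1 \<le> t \<Longrightarrow> t < T \<Longrightarrow> (U has_real_derivative V t) (at t within {1..<T})) \<Longrightarrow>
      continuous_on {1..<T} V \<Longrightarrow>
      (\<And>t. 1 \<le> t \<Longrightarrow> t < T \<Longrightarrow> rdini_ge V t ((t powr (2 * m) - \<nu>\<^sup>2 / t\<^sup>2) * U t - \<mu> / t * V t
        + c0 * \<bar>V t\<bar> powr p * (exp (phi_m m t) * t powr d) powr (1 - p))) \<Longrightarrow>
      U 1 \<ge> 0 \<Longrightarrow> V 1 + (\<mu> - 1 - sqrt ((\<mu> - 1)\<^sup>2 - 4 * \<nu>\<^sup>2)) / 2 * U 1 = \<epsilon> * I \<Longrightarrow>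
      (\<And>t. 1 \<le> t \<Longrightarrow> (\<Theta> has_real_derivative t powr ((1 - p) * ((\<mu> - m) / 2 + d))) (at t)) \<Longrightarrow>
      \<Theta> t - \<Theta> t1 \<le> K * \<epsilon> powr (1 - p)"
proof -
  \<comment> \<open>The exported constants depend on the parameters alone, so they can be used
    before there is a solution to interpret the locale with.\<close>
  define b0 where "b0 = damped_tricomi_ode.b m \<mu>"
  define q0 where "q0 = damped_tricomi_ode.q m \<mu> \<nu>"
  define a0 where "a0 = damped_tricomi_ode.a m \<mu> \<nu>"
  \<comment> \<open>4 |q| <= t0 together with t0 >= 1 gives |q| <= t0^2 / 4.\<close>
  define t0 where "t0 = max 1 (max (4 * \<bar>q0\<bar>) (4 * b0))"
  have "4 * \<bar>q0\<bar> \<le> t0 * t0"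
    using mult_mono[of "1::real" t0 "4 * \<bar>q0\<bar>" t0] by (auto simp: t0_def)
  hence "\<bar>q0\<bar> \<le> t0\<^sup>2 / 4"
    by (simp add: power2_eq_square)
  moreover have "1 \<le> t0" "4 * b0 \<le> t0"
    by (auto simp: t0_def)
  ultimately have t0: "1 \<le> t0" "\<bar>q0\<bar> \<le> t0\<^sup>2 / 4" "4 * b0 \<le> t0" by blast+
  define c where "c = c0 * exp (- \<bar>q0\<bar>) * 6 powr (- p)"
  have c: "c > 0" using c0 by (simp add: c_def)
  define L where "L = exp (- phi_m m (t0 + 1) - \<bar>q0\<bar>) * ((t0 + 1) powr (- a0) * I)"
  have L: "L > 0" using I t0 by (simp add: L_def)
  show ?thesis
  proof (rule that[of "t0 + 1" "L powr (1 - p) / (p - 1) / c"])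
    show "1 \<le> t0 + 1" using t0 by simp
    show "0 < L powr (1 - p) / (p - 1) / c" using L p c by simp
    fix \<epsilon> T U V \<Theta> t
    assume \<epsilon>: "\<epsilon> > (0::real)" and t: "t0 + 1 \<le> t" "t < T"
      and U: "\<And>t. 1 \<le> t \<Longrightarrow> t < T \<Longrightarrow> (U has_real_derivative V t) (at t within {1..<T})"
      and V: "continuous_on {1..<T} V"
      and dini: "\<And>t. 1 \<le> t \<Longrightarrow> t < T \<Longrightarrow> rdini_ge V t ((t powr (2 * m) - \<nu>\<^sup>2 / t\<^sup>2) * U t - \<mu> / t * V t
        + c0 * \<bar>V t\<bar> powr p * (exp (phi_m m t) * t powr d) powr (1 - p))"
      and U1: "U 1 \<ge> 0" and V1: "V 1 + (\<mu> - 1 - sqrt ((\<mu> - 1)\<^sup>2 - 4 * \<nu>\<^sup>2)) / 2 * U 1 = \<epsilon> * I"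
      and \<Theta>: "\<And>t. 1 \<le> t \<Longrightarrow> (\<Theta> has_real_derivative t powr ((1 - p) * ((\<mu> - m) / 2 + d))) (at t)"
    interpret damped_tricomi_ode m \<mu> \<nu> T U V
      "\<lambda>t. c0 * \<bar>V t\<bar> powr p * (exp (phi_m m t) * t powr d) powr (1 - p)"
      using m \<delta> U V dini U1 V1 \<epsilon> I c0 t t0 by unfold_locales auto
    have "b0 - m = (\<mu> - m) / 2"  by (simp add: b0_def b_def field_simps)
    hence \<Theta>': "(\<Theta> has_real_derivative t powr ((1 - p) * (b0 - m + d))) (at t)" if "1 \<le> t" for t
      using \<Theta>[OF that] by (simp only:)
    have "c * (\<Theta> t - \<Theta> (t0 + 1))
        \<le> (exp (- phi_m m (t0 + 1) - \<bar>q0\<bar>) * ((t0 + 1) powr (- a0) * (\<epsilon> * I))) powr (1 - p) / (p - 1)"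
      using lifespan_integral_bound[OF p _ _ _ _ t, of c0 d \<Theta>] c0 t0 \<Theta>'
      unfolding W_1 V1 c_def b0_def q0_def a0_def by simp
    also have "exp (- phi_m m (t0 + 1) - \<bar>q0\<bar>) * ((t0 + 1) powr (- a0) * (\<epsilon> * I)) = L * \<epsilon>"
      by (simp add: L_def)
    also have "(L * \<epsilon>) powr (1 - p) = L powr (1 - p) * \<epsilon> powr (1 - p)"
      by (rule powr_mult)
    finally have "\<Theta> t - \<Theta> (t0 + 1) \<le> L powr (1 - p) * \<epsilon> powr (1 - p) / (p - 1) / c"
      by (rule mult_imp_le_div_pos[OF c, OF back_subst[of "\<lambda>x. x \<le> _", OF _ mult.commute]])
    thus "\<Theta> t - \<Theta> (t0 + 1) \<le> L powr (1 - p) / (p - 1) / c * \<epsilon> powr (1 - p)"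
      by simp
  qed
qed

section \<open>Radial test functions\<close>

lemma has_derivative_radial:
  fixes x :: "'a::euclidean_space" and \<Psi> :: "real \<Rightarrow> real"
  assumes "smooth_fun \<Psi>"
  shows "((\<lambda>x. \<Psi> (x \<bullet> x)) has_derivative (\<lambda>h. deriv \<Psi> (x \<bullet> x) * (2 * (x \<bullet> h)))) (at x)"
proof -
  have 1: "((\<lambda>x. x \<bullet> x) has_derivative (\<lambda>h. 2 * (x \<bullet> h))) (at x)"
    by (auto intro!: derivative_eq_intros simp: inner_commute)
  have 2: "(\<Psi> has_derivative (*) (deriv \<Psi> (x \<bullet> x))) (at (x \<bullet> x))"
    using smooth_fun_DERIV[OF assms] by (simp add: has_field_derivative_def)
  show ?thesis using has_derivative_compose[OF 1 2] .
qed

lemma pdx_radial: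
  assumes "smooth_fun \<Psi>"
  shows "pdx (\<lambda>x :: real^'n. \<Psi> (x \<bullet> x)) i x = 2 * x $ i * deriv \<Psi> (x \<bullet> x)"
  using frechet_derivative_at[OF has_derivative_radial[OF assms, of x], symmetric]
  by (simp add: pdx_def inner_axis)

lemma pdx_pdx_radial:
  assumes "smooth_fun \<Psi>"
  shows "pdx (pdx (\<lambda>x :: real^'n. \<Psi> (x \<bullet> x)) i) i x =
    2 * deriv \<Psi> (x \<bullet> x) + 4 * (x $ i)\<^sup>2 * deriv (deriv \<Psi>) (x \<bullet> x)"
proof -
  have "((\<lambda>x :: real^'n. 2 * x $ i * deriv \<Psi> (x \<bullet> x)) has_derivative
      (\<lambda>h. 2 * x $ i * (deriv (deriv \<Psi>) (x \<bullet> x) * (2 * (x \<bullet> h))) + (2 * h $ i) * deriv \<Psi> (x \<bullet> x))) (at x)"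
    by (intro has_derivative_mult has_derivative_mult_right has_derivative_radial
        smooth_fun_deriv assms bounded_linear_imp_has_derivative bounded_linear_vec_nth)
  from frechet_derivative_at[OF this, symmetric] show ?thesis
    unfolding pdx_radial[OF assms, abs_def] pdx_def
    by (simp add: inner_axis power2_eq_square)
qed

lemma test_fn_pdx:
  assumes "test_fn \<phi>"
  shows "test_fn (pdx \<phi> i)"
proof -
  obtain r where r: "\<And>x. r \<le> norm x \<Longrightarrow> \<phi> x = 0" and s: "smooth_fun \<phi>"
    using assms by (auto simp: test_fn_def)
  \<comment> \<open>The extra unit puts x into the open set |x| > r, on which \<phi> vanishes
    identically.\<close>
  have "pdx \<phi> i x = 0" if "r + 1 \<le> norm x" for x
  proof -
    have "open {x :: real^'a. r < norm x}"
      by (intro open_Collect_less continuous_intros)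
    hence "(\<phi> has_derivative (\<lambda>_. 0)) (at x)"
      by (rule has_derivative_transform_within_open[where f = "\<lambda>_. 0", rotated])
        (use that r in \<open>auto intro: order_less_imp_le\<close>)
    from frechet_derivative_at[OF this, symmetric] show ?thesis
      by (simp add: pdx_def)
  qed
  moreover have "smooth_fun (pdx \<phi> i)"
    unfolding pdx_def[abs_def] using s by (intro smooth_fun_partial) (auto simp: Basis_vec_def)
  ultimately show ?thesis unfolding test_fn_def by blast
qed

lemma test_fn_L2:
  assumes "test_fn \<phi>"
  shows "L2 \<phi>"
proof -
  obtain r where r: "\<And>x. r \<le> norm x \<Longrightarrow> \<phi> x = 0" and s: "smooth_fun \<phi>"
    using assms by (auto simp: test_fn_def)
  have "integrable lborel (\<lambda>x. indicator (cball 0 r) x *\<^sub>R (\<phi> x)\<^sup>2)"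
    by (intro borel_integrable_compact compact_cball continuous_intros smooth_fun_continuous_on s)
  also have "(\<lambda>x. indicator (cball 0 r) x *\<^sub>R (\<phi> x)\<^sup>2) = (\<lambda>x. (\<phi> x)\<^sup>2)"
    using r by (intro ext) (force simp: indicator_def)
  finally show ?thesis
    unfolding L2_def
    using borel_measurable_continuous_onI[OF smooth_fun_continuous_on[OF s, of UNIV]] by simp
qed

text \<open>Separated test functions suffice, since only spatial integrals against
  \<open>eig\<close> are followed in time.\<close>

lemma test_fn_T_radial:
  fixes \<Psi> \<eta> :: "real \<Rightarrow> real"
  assumes \<Psi>: "smooth_fun \<Psi>" and \<eta>: "smooth_fun \<eta>" and T': "T' < T" "\<And>s. T' \<le> s \<Longrightarrow> \<eta> s = 0"
    and r: "\<And>x :: real^'n. r \<le> norm x \<Longrightarrow> \<Psi> (x \<bullet> x) = 0"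
  defines "\<Phi> \<equiv> \<lambda>(x :: real^'n) s. \<Psi> (x \<bullet> x) * \<eta> s"
  shows "test_fn_T T \<Phi>"
    and "dt_T \<Phi> x s = \<Psi> (x \<bullet> x) * deriv \<eta> s"
    and "dx_T \<Phi> i x s = pdx (\<lambda>x. \<Psi> (x \<bullet> x)) i x * \<eta> s"
proof -
  have f: "smooth_fun (\<lambda>z :: (real^'n) \<times> real. fst z \<bullet> fst z)"
    unfolding euclidean_inner[of "fst z" "fst z" for z]
    by (intro smooth_fun_sum smooth_fun_mult smooth_fun_bounded_linear bounded_linear_intros)
  have "smooth_fun (\<lambda>z :: (real^'n) \<times> real. \<Phi> (fst z) (snd z))"
    unfolding \<Phi>_def
    by (intro smooth_fun_mult smooth_fun_compose[OF \<Psi> f]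
        smooth_fun_compose[OF \<eta> smooth_fun_bounded_linear[OF bounded_linear_snd]])
  thus "test_fn_T T \<Phi>"
    unfolding test_fn_T_def using T' r by (auto simp: \<Phi>_def)
  have 1: "((\<lambda>z :: (real^'n) \<times> real. \<Psi> (fst z \<bullet> fst z)) has_derivative
      (\<lambda>h. deriv \<Psi> (x \<bullet> x) * (2 * (x \<bullet> fst h)))) (at (x, s))"
    using has_derivative_compose[OF bounded_linear_imp_has_derivative[OF bounded_linear_fst]
        has_derivative_radial[OF \<Psi>, of "fst (x, s)"]] by simp
  have "(\<eta> has_derivative (*) (deriv \<eta> (snd (x, s)))) (at (snd (x, s)))"
    using smooth_fun_DERIV[OF \<eta>] by (simp add: has_field_derivative_def)
  from has_derivative_compose[OF bounded_linear_imp_has_derivative[OF bounded_linear_snd] this]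
  have 2: "((\<lambda>z :: (real^'n) \<times> real. \<eta> (snd z)) has_derivative (\<lambda>h. deriv \<eta> s * snd h)) (at (x, s))"
    by simp
  note d = frechet_derivative_at[OF has_derivative_mult[OF 1 2], symmetric]
  show "dt_T \<Phi> x s = \<Psi> (x \<bullet> x) * deriv \<eta> s"
    by (simp add: dt_T_def \<Phi>_def d)
  show "dx_T \<Phi> i x s = pdx (\<lambda>x. \<Psi> (x \<bullet> x)) i x * \<eta> s"
    by (simp add: dx_T_def \<Phi>_def d pdx_radial[OF \<Psi>] inner_axis)
qed

text \<open>The cutoff equals 1 up to radius \<rho> + 1 and not just \<rho>, so that first and
  second derivatives agree with those of \<open>eig\<close> on the whole closed ball.\<close>

lemma smooth_radial_eig_cutoff:
  fixes \<rho> :: real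
  assumes "\<rho> \<ge> 0"
  obtains \<Psi> :: "real \<Rightarrow> real" where "smooth_fun \<Psi>" "\<And>r. r \<ge> 0 \<Longrightarrow> \<Psi> r \<ge> 0"
    "test_fn (\<lambda>x :: real^'n. \<Psi> (x \<bullet> x))"
    "\<And>x :: real^'n. norm x \<le> \<rho> \<Longrightarrow> \<Psi> (x \<bullet> x) = eig x"
    "\<And>x :: real^'n. norm x \<le> \<rho> \<Longrightarrow> (\<Sum>i\<in>UNIV. pdx (pdx (\<lambda>x. \<Psi> (x \<bullet> x)) i) i x) = eig x"
proof -
  define N where "N = CARD('n)"
  have N: "N \<ge> 1" unfolding N_def by (rule card_ge_1)
  have "(\<rho> + 1)\<^sup>2 < (\<rho> + 2)\<^sup>2" using assms by (intro power_strict_mono) auto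
  then obtain \<zeta> :: "real \<Rightarrow> real" where \<zeta>: "smooth_fun \<zeta>" "\<And>x. 0 \<le> \<zeta> x"
    "\<And>x. x \<le> (\<rho> + 1)\<^sup>2 \<Longrightarrow> \<zeta> x = 1" "\<And>x. (\<rho> + 2)\<^sup>2 \<le> x \<Longrightarrow> \<zeta> x = 0"
    using smooth_cutoff_exists by blast
  define \<Psi> where "\<Psi> = (\<lambda>r. radial_fun N r * \<zeta> r)"
  have s: "smooth_fun \<Psi>"
    unfolding \<Psi>_def by (intro smooth_fun_mult smooth_radial_fun N \<zeta>)
  have out: "\<Psi> (x \<bullet> x) = 0" if "\<rho> + 2 \<le> norm x" for x :: "real^'n"
  proof -
    have "(\<rho> + 2)\<^sup>2 \<le> (norm x)\<^sup>2" using that assms by (intro power_mono) auto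
    thus ?thesis using \<zeta>(4) by (simp add: \<Psi>_def power2_norm_eq_inner)
  qed
  have inside: "x \<bullet> x < (\<rho> + 1)\<^sup>2" if "norm x \<le> \<rho>" for x :: "real^'n"
  proof -
    have "(norm x)\<^sup>2 < (\<rho> + 1)\<^sup>2" using that by (intro power_strict_mono) auto
    thus ?thesis by (simp add: power2_norm_eq_inner)
  qed
  have d1: "deriv \<Psi> r = deriv (radial_fun N) r" if "r < (\<rho> + 1)\<^sup>2" for r
  proof (rule DERIV_imp_deriv)
    show "(\<Psi> has_real_derivative deriv (radial_fun N) r) (at r)"
      by (rule has_field_derivative_transform_within_open[OF smooth_fun_DERIV[OF smooth_radial_fun[OF N]],
            of "{..<(\<rho> + 1)\<^sup>2}"]) (use that \<zeta>(3) in \<open>auto simp: \<Psi>_def\<close>)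
  qed
  have d2: "deriv (deriv \<Psi>) r = deriv (deriv (radial_fun N)) r" if "r < (\<rho> + 1)\<^sup>2" for r
  proof (rule DERIV_imp_deriv)
    show "(deriv \<Psi> has_real_derivative deriv (deriv (radial_fun N)) r) (at r)"
      by (rule has_field_derivative_transform_within_open[OF
            smooth_fun_DERIV[OF smooth_fun_deriv[OF smooth_radial_fun[OF N]]],
            of "{..<(\<rho> + 1)\<^sup>2}"]) (use that d1 in auto)
  qed
  show ?thesis
  proof (rule that[of \<Psi>])
    show "smooth_fun \<Psi>" by (rule s)
    show "\<Psi> r \<ge> 0" if "r \<ge> 0" for r
      using radial_fun_pos[OF N that] \<zeta>(2) by (simp add: \<Psi>_def)
    show "test_fn (\<lambda>x :: real^'n. \<Psi> (x \<bullet> x))"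
      unfolding test_fn_def using out
      by (intro conjI smooth_fun_compose[OF s] smooth_fun_inner_self) blast
    fix x :: "real^'n" assume x: "norm x \<le> \<rho>"
    show "\<Psi> (x \<bullet> x) = eig x"
      using inside[OF x] \<zeta>(3) by (simp add: \<Psi>_def eig_def N_def)
    have "(\<Sum>i\<in>UNIV. pdx (pdx (\<lambda>x. \<Psi> (x \<bullet> x)) i) i x) =
        (\<Sum>i\<in>UNIV. 2 * deriv (radial_fun N) (x \<bullet> x) + 4 * (x $ i)\<^sup>2 * deriv (deriv (radial_fun N)) (x \<bullet> x))"
      by (simp add: pdx_pdx_radial[OF s] d1[OF inside[OF x]] d2[OF inside[OF x]])
    also have "\<dots> = 2 * real N * deriv (radial_fun N) (x \<bullet> x)
        + 4 * (x \<bullet> x) * deriv (deriv (radial_fun N)) (x \<bullet> x)"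
      by (simp add: sum.distrib N_def inner_vec_def power2_eq_square sum_distrib_left sum_distrib_right mult_ac)
    also have "\<dots> = eig x"
      using radial_fun_ode[OF N, of "x \<bullet> x"] by (simp add: eig_def N_def)
    finally show "(\<Sum>i\<in>UNIV. pdx (pdx (\<lambda>x. \<Psi> (x \<bullet> x)) i) i x) = eig x" .
  qed
qed

section \<open>Weak solutions\<close>

lemma phi_m_mono: "m \<ge> 0 \<Longrightarrow> 1 \<le> s \<Longrightarrow> s \<le> t \<Longrightarrow> phi_m m s \<le> phi_m m t"
  using phi_m_diff_ge[of m s t] by linarith

lemma phi_m_pos: "m \<ge> 0 \<Longrightarrow> t > 0 \<Longrightarrow> phi_m m t > 0"
  by (simp add: phi_m_def)

lemma set_integral_Icc_diff:
  fixes f :: "real \<Rightarrow> real"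
  assumes "a \<le> b" "b \<le> c" "set_integrable lborel {a..c} f"
  shows "(LINT s:{a..c}|lborel. f s) - (LINT s:{a..b}|lborel. f s) = (LINT s:{b<..c}|lborel. f s)"
proof -
  have eq: "{a..c} = {a..b} \<union> {b<..c}" using assms by auto
  have i: "set_integrable lborel {a..b} f" "set_integrable lborel {b<..c} f"
    using assms by (auto intro: set_integrable_subset)
  have "(LINT s:{a..b} \<union> {b<..c}|lborel. f s) = (LINT s:{a..b}|lborel. f s) + (LINT s:{b<..c}|lborel. f s)"
    by (rule set_integral_Un[OF _ i]) auto
  thus ?thesis unfolding eq by simp
qed

text \<open>Increments are controlled only from times t1 > 1 on. Letting t1 decrease to t with V
  continuous covers t = 1 as well.\<close>

lemma increments_imp_rdini_ge:
  fixes V k :: "real \<Rightarrow> real"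
  assumes V: "continuous_on {1..<T} V" and k: "continuous_on {1..<T} k"
    and inc: "\<And>t1 t2. 1 < t1 \<Longrightarrow> t1 < t2 \<Longrightarrow> t2 < T \<Longrightarrow> (LINT s:{t1<..t2}|lborel. k s) \<le> V t2 - V t1"
    and t: "1 \<le> t" "t < T"
  shows "rdini_ge V t (k t)"
  unfolding rdini_ge_def
proof (intro allI impI)
  fix e :: real assume e: "e > 0"
  have "(k \<longlongrightarrow> k t) (at t within {1..<T})"
    using k t by (auto simp: continuous_on_def)
  hence "\<forall>\<^sub>F s in at t within {1..<T}. k s > k t - e"
    by (rule order_tendstoD(1)) (use e in simp)
  hence "\<forall>\<^sub>F s in at_right t. k s > k t - e"
    using at_right_le_at_within[OF t] by (rule filter_leD[rotated])
  then obtain b where b: "b > t" "\<And>s. t < s \<Longrightarrow> s < b \<Longrightarrow> k s > k t - e"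
    unfolding eventually_at_right_field by blast
  have "V t + (k t - e) * (t2 - t) \<le> V t2" if t2: "t < t2" "t2 < min b T" for t2
  proof -
    have le: "V t1 + (k t - e) * (t2 - t1) \<le> V t2" if t1: "t < t1" "t1 < t2" for t1
    proof -
      have kc: "continuous_on {t1..t2} k"
        by (rule continuous_on_subset[OF k]) (use t t1 t2 in auto)
      have "(k t - e) * (t2 - t1) = (LINT s:{t1<..t2}|lborel. k t - e)"
        using t1 by (simp add: set_lebesgue_integral_def mult.commute)
      also have "\<dots> \<le> (LINT s:{t1<..t2}|lborel. k s)"
      proof (rule set_integral_mono)
        show "set_integrable lborel {t1<..t2} k"
          using borel_integrable_atLeastAtMost'[OF kc] by (rule set_integrable_subset) auto
        show "set_integrable lborel {t1<..t2} (\<lambda>_. k t - e)"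
          by (rule set_integrable_subset[OF borel_integrable_atLeastAtMost'[of t1 t2]]) auto
        show "k t - e \<le> k s" if "s \<in> {t1<..t2}" for s
          using b(2)[of s] that t1 t2 by auto
      qed
      also have "\<dots> \<le> V t2 - V t1"
        using t t1 t2 by (intro inc) auto
      finally show ?thesis by linarith
    qed
    have "(V \<longlongrightarrow> V t) (at t within {1..<T})"
      using V t by (auto simp: continuous_on_def)
    hence Vt: "(V \<longlongrightarrow> V t) (at_right t)"
      by (rule tendsto_mono[OF at_right_le_at_within[OF t]])
    have "((\<lambda>t1. V t1 + (k t - e) * (t2 - t1)) \<longlongrightarrow> V t + (k t - e) * (t2 - t)) (at_right t)"
      by (intro tendsto_intros Vt)
    moreover have "\<forall>\<^sub>F t1 in at_right t. V t1 + (k t - e) * (t2 - t1) \<le> V t2"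
      unfolding eventually_at_right_field using le t2 by blast
    ultimately show ?thesis
      by (rule tendsto_upperbound) simp
  qed
  moreover have "t < min b T" using b t by simp
  ultimately show "\<forall>\<^sub>F s in at_right t. V t + (k t - e) * (s - t) \<le> V s"
    unfolding eventually_at_right_field by blast
qed

text \<open>\<open>weak_sol\<close> with the gradient \<open>G\<close> and the time derivative
  \<open>v\<close> taken out of the existential quantifier, joined with the support
  conditions.\<close>

locale tricomi_weak_solution =
  fixes m \<mu> \<nu> p \<epsilon> R T :: real and u0 u1 :: "real^'n \<Rightarrow> real"
    and u v :: "real^'n \<Rightarrow> real \<Rightarrow> real" and G :: "real^'n \<Rightarrow> real \<Rightarrow> real^'n"
  assumes m: "m \<ge> 0" and p: "p > 1" and R: "R > 0" and T: "1 < T"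
    and u0: "L2 u0" and u1: "L2 u1"
    and supp_u1: "AE x in lborel. R < norm x \<longrightarrow> u1 x = 0"
    and supp_u: "\<And>t. 1 \<le> t \<Longrightarrow> t < T \<Longrightarrow>
      AE x in lborel. R + phi_m m t - phi_m m 1 < norm x \<longrightarrow> u x t = 0"
    and L2_u: "\<And>t. 1 \<le> t \<Longrightarrow> t < T \<Longrightarrow> L2 (\<lambda>x. u x t)"
    and grad_u: "\<And>t. 1 \<le> t \<Longrightarrow> t < T \<Longrightarrow> weak_grad (\<lambda>x. u x t) (\<lambda>x. G x t)"
    and L2_G: "\<And>t i. 1 \<le> t \<Longrightarrow> t < T \<Longrightarrow> L2 (\<lambda>x. G x t $ i)"
    and L2_v: "\<And>t. 1 \<le> t \<Longrightarrow> t < T \<Longrightarrow> L2 (\<lambda>x. v x t)"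
    and lim_v: "\<And>t. 1 \<le> t \<Longrightarrow> t < T \<Longrightarrow>
      ((\<lambda>s. L2dist2 (\<lambda>x. (u x s - u x t) / (s - t)) (\<lambda>x. v x t)) \<longlongrightarrow> 0) (at t within {1..<T})"
    and cont_v: "\<And>t. 1 \<le> t \<Longrightarrow> t < T \<Longrightarrow>
      ((\<lambda>s. L2dist2 (\<lambda>x. v x s) (\<lambda>x. v x t)) \<longlongrightarrow> 0) (at t within {1..<T})"
    and Lp_v: "\<And>K. compact K \<Longrightarrow> K \<subseteq> UNIV \<times> {1<..<T} \<Longrightarrow>
      set_integrable lborel K (\<lambda>z. \<bar>v (fst z) (snd z)\<bar> powr p)"
    and init: "AE x in lborel. u x 1 = \<epsilon> * u0 x"
    and weak: "\<And>\<Phi> t. test_fn_T T \<Phi> \<Longrightarrow> 1 \<le> t \<Longrightarrow> t < T \<Longrightarrow>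
        (LINT x|lborel. v x t * \<Phi> x t)
        - \<epsilon> * (LINT x|lborel. u1 x * \<Phi> x 1)
        - (LINT s:{1..t}|lborel. (LINT x|lborel. v x s * dt_T \<Phi> x s))
        + (LINT s:{1..t}|lborel. (LINT x|lborel. s powr (2 * m) * (\<Sum>i\<in>UNIV. G x s $ i * dx_T \<Phi> i x s)))
        + (LINT s:{1..t}|lborel. (LINT x|lborel. \<mu> / s * v x s * \<Phi> x s))
        + (LINT s:{1..t}|lborel. (LINT x|lborel. \<nu>^2 / s^2 * u x s * \<Phi> x s))
        = (LINT s:{1..t}|lborel. (LINT x|lborel. \<bar>v x s\<bar> powr p * \<Phi> x s))"
begin

definition U :: "real \<Rightarrow> real" where "U t = (LINT x|lborel. u x t * eig x)"
definition V :: "real \<Rightarrow> real" where "V t = (LINT x|lborel. v x t * eig x)"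
text \<open>Exceeds the support radius of \<open>u\<close> at time t by phi_m m 1. This margin lets
  nearby times share one ball.\<close>

definition \<rho> :: "real \<Rightarrow> real" where "\<rho> t = R + phi_m m t"

lemma \<rho>_pos: "1 \<le> t \<Longrightarrow> \<rho> t > 0"
  using R phi_m_pos[OF m, of t] by (simp add: \<rho>_def)

lemma \<rho>_mono: "1 \<le> s \<Longrightarrow> s \<le> t \<Longrightarrow> \<rho> s \<le> \<rho> t"
  using phi_m_mono[OF m] by (simp add: \<rho>_def)

lemma supp_u':
  assumes "1 \<le> s" "s \<le> t" "s < T"
  shows "AE x in lborel. \<rho> t < norm x \<longrightarrow> u x s = 0"
  using supp_u[OF assms(1,3)]
proof eventually_elim
  case (elim x)
  have "R + phi_m m s - phi_m m 1 \<le> \<rho> t"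
    using \<rho>_mono[OF assms(1,2)] phi_m_pos[OF m, of 1] by (simp add: \<rho>_def)
  with elim show ?case by auto
qed

lemma at_within_nontrivial: "1 \<le> t \<Longrightarrow> t < T \<Longrightarrow> at t within {1..<T} \<noteq> bot"
  using at_right_le_at_within[of 1 t T] trivial_limit_at_right_real[of t] by (metis bot.extremum_uniqueI)

lemma L2_quotient:
  assumes "1 \<le> s" "s < T" "1 \<le> t" "t < T"
  shows "L2 (\<lambda>x. (u x s - u x t) / (s - t))"
  using L2_cmult[OF L2_diff[OF L2_u[OF assms(1,2)] L2_u[OF assms(3,4)]], of "1 / (s - t)"] by simp

text \<open>For s close to t the difference quotient vanishes outside radius \<rho> t, the margin
  phi_m m 1 covering s > t too; the L2 limit inherits this.\<close>

lemma supp_v: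
  assumes "1 \<le> t" "t < T"
  shows "AE x in lborel. \<rho> t < norm x \<longrightarrow> v x t = 0"
proof (rule L2_limit_vanishes[OF lim_v[OF assms] at_within_nontrivial[OF assms] _ L2_v[OF assms]])
  show "{x :: real^'n. \<rho> t < norm x} \<in> sets borel" by measurable
  have "(phi_m m \<longlongrightarrow> phi_m m t) (at t within {1..<T})"
    using DERIV_continuous[OF phi_m_DERIV[OF m, of t "{1..<T}"]] assms by (simp add: continuous_within)
  hence "\<forall>\<^sub>F s in at t within {1..<T}. phi_m m s < phi_m m t + phi_m m 1"
    by (rule order_tendstoD(2)) (use phi_m_pos[OF m, of 1] in simp)
  moreover have "\<forall>\<^sub>F s in at t within {1..<T}. s \<in> {1..<T}"
    by (simp add: eventually_at_filter)
  ultimately show "\<forall>\<^sub>F s in at t within {1..<T}. L2 (\<lambda>x. (u x s - u x t) / (s - t)) \<and>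
      (AE x in lborel. \<rho> t < norm x \<longrightarrow> (u x s - u x t) / (s - t) = 0)"
  proof eventually_elim
    case (elim s)
    have "AE x in lborel. \<rho> t < norm x \<longrightarrow> (u x s - u x t) / (s - t) = 0"
      using supp_u[of s] supp_u'[OF assms(1) order_refl assms(2)] elim
      by (auto simp: \<rho>_def elim!: eventually_elim2)
    with elim assms show ?case by (auto intro!: L2_quotient)
  qed
qed

lemma integral_cutoff:
  fixes f \<psi> \<psi>' :: "real^'n \<Rightarrow> real"
  assumes "AE x in lborel. r < norm x \<longrightarrow> f x = 0" "\<And>x. norm x \<le> r \<Longrightarrow> \<psi> x = \<psi>' x"
    and [measurable]: "f \<in> borel_measurable borel" "\<psi> \<in> borel_measurable borel" "\<psi>' \<in> borel_measurable borel"
  shows "(LINT x|lborel. f x * \<psi> x) = (LINT x|lborel. f x * \<psi>' x)"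
proof (rule integral_cong_AE)
  show "AE x in lborel. f x * \<psi> x = f x * \<psi>' x"
    using assms(1) by eventually_elim (use assms(2) in \<open>auto simp: not_less[symmetric]\<close>)
qed measurable

text \<open>A truncation of \<open>eig\<close> made for time t is exact for all earlier times, so
  one test function can be kept while time varies.\<close>

definition eig_cut :: "real \<Rightarrow> (real \<Rightarrow> real) \<Rightarrow> bool" where
  "eig_cut t \<Psi> \<longleftrightarrow> smooth_fun \<Psi> \<and> (\<forall>r\<ge>0. \<Psi> r \<ge> 0) \<and> test_fn (\<lambda>x :: real^'n. \<Psi> (x \<bullet> x)) \<and>
    (\<forall>x :: real^'n. norm x \<le> \<rho> t \<longrightarrow> \<Psi> (x \<bullet> x) = eig x) \<and>
    (\<forall>x :: real^'n. norm x \<le> \<rho> t \<longrightarrow> (\<Sum>i\<in>UNIV. pdx (pdx (\<lambda>x. \<Psi> (x \<bullet> x)) i) i x) = eig x)"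

lemma eig_cut_exists:
  assumes "1 \<le> t"
  obtains \<Psi> where "eig_cut t \<Psi>"
proof -
  have "\<rho> t \<ge> 0" using \<rho>_pos[OF assms] by simp
  then obtain \<Psi> :: "real \<Rightarrow> real" where "smooth_fun \<Psi>" "\<And>r. r \<ge> 0 \<Longrightarrow> \<Psi> r \<ge> 0"
    "test_fn (\<lambda>x :: real^'n. \<Psi> (x \<bullet> x))"
    "\<And>x :: real^'n. norm x \<le> \<rho> t \<Longrightarrow> \<Psi> (x \<bullet> x) = eig x"
    "\<And>x :: real^'n. norm x \<le> \<rho> t \<Longrightarrow> (\<Sum>i\<in>UNIV. pdx (pdx (\<lambda>x. \<Psi> (x \<bullet> x)) i) i x) = eig x"
    by (rule smooth_radial_eig_cutoff[where 'n = 'n]) blast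
  thus ?thesis by (intro that[of \<Psi>]) (simp add: eig_cut_def)
qed

lemma measurable_test_fn: "test_fn \<phi> \<Longrightarrow> \<phi> \<in> borel_measurable borel"
  using test_fn_L2[of \<phi>] by (simp add: L2_def)

lemma integral_eig_cut:
  fixes f :: "real^'n \<Rightarrow> real"
  assumes \<Psi>: "eig_cut t \<Psi>" and f: "L2 f" "AE x in lborel. \<rho> t < norm x \<longrightarrow> f x = 0"
  shows "(LINT x|lborel. f x * \<Psi> (x \<bullet> x)) = (LINT x|lborel. f x * eig x)"
proof (rule integral_cutoff[OF f(2)])
  show "(\<lambda>x :: real^'n. \<Psi> (x \<bullet> x)) \<in> borel_measurable borel"
    using \<Psi> by (intro measurable_test_fn) (simp add: eig_cut_def)
qed (use \<Psi> f in \<open>auto simp: eig_cut_def L2_def\<close>)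

lemma U_cut:
  assumes "eig_cut t \<Psi>" "1 \<le> s" "s \<le> t" "s < T"
  shows "(LINT x|lborel. u x s * \<Psi> (x \<bullet> x)) = U s"
  unfolding U_def using assms by (intro integral_eig_cut[OF assms(1)] L2_u supp_u')

lemma V_cut:
  assumes "eig_cut t \<Psi>" "1 \<le> s" "s \<le> t" "s < T"
  shows "(LINT x|lborel. v x s * \<Psi> (x \<bullet> x)) = V s"
  unfolding V_def
proof (rule integral_eig_cut[OF assms(1)])
  show "L2 (\<lambda>x. v x s)" using assms by (intro L2_v)
  show "AE x in lborel. \<rho> t < norm x \<longrightarrow> v x s = 0"
    using supp_v[OF assms(2,4)] \<rho>_mono[OF assms(2,3)] by (auto elim!: eventually_mono)
qed

lemma u1_cut:
  assumes "eig_cut t \<Psi>" "1 \<le> t"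
  shows "(LINT x|lborel. u1 x * \<Psi> (x \<bullet> x)) = (LINT x|lborel. u1 x * eig x)"
proof (rule integral_eig_cut[OF assms(1) u1])
  have "R < \<rho> t" using phi_m_pos[OF m, of t] assms(2) by (simp add: \<rho>_def)
  thus "AE x in lborel. \<rho> t < norm x \<longrightarrow> u1 x = 0"
    using supp_u1 by (auto elim!: eventually_mono)
qed

text \<open>The weak gradient is tested with the partial derivatives of the truncated
  \<open>eig\<close>, which moves both derivatives onto it; on the support of \<open>u\<close> its
  Laplacian is \<open>eig\<close>.\<close>

lemma grad_cut:
  assumes "eig_cut t \<Psi>" "1 \<le> s" "s \<le> t" "s < T"
  shows "(LINT x|lborel. (\<Sum>i\<in>UNIV. G x s $ i * pdx (\<lambda>x. \<Psi> (x \<bullet> x)) i x)) = - U s"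
proof -
  define \<psi> where "\<psi> = (\<lambda>x :: real^'n. \<Psi> (x \<bullet> x))"
  have tf: "test_fn \<psi>" using assms(1) by (simp add: eig_cut_def \<psi>_def)
  have "(LINT x|lborel. (\<Sum>i\<in>UNIV. G x s $ i * pdx \<psi> i x)) = (\<Sum>i\<in>UNIV. LINT x|lborel. G x s $ i * pdx \<psi> i x)"
    using assms by (intro Bochner_Integration.integral_sum L2_mult_integrable L2_G test_fn_L2 test_fn_pdx tf) auto
  also have "\<dots> = (\<Sum>i\<in>UNIV. - (LINT x|lborel. u x s * pdx (pdx \<psi> i) i x))"
    using grad_u[of s] test_fn_pdx[OF tf] assms by (auto simp: weak_grad_def)
  also have "\<dots> = - (LINT x|lborel. (\<Sum>i\<in>UNIV. u x s * pdx (pdx \<psi> i) i x))"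
    unfolding sum_negf using assms
    by (subst Bochner_Integration.integral_sum)
      (auto intro!: L2_mult_integrable[OF L2_u test_fn_L2] test_fn_pdx tf)
  also have "(LINT x|lborel. (\<Sum>i\<in>UNIV. u x s * pdx (pdx \<psi> i) i x)) =
      (LINT x|lborel. u x s * (\<Sum>i\<in>UNIV. pdx (pdx \<psi> i) i x))"
    by (simp add: sum_distrib_left)
  also have "\<dots> = U s"
    unfolding U_def
  proof (rule integral_cutoff)
    show "AE x in lborel. \<rho> t < norm x \<longrightarrow> u x s = 0" using assms by (intro supp_u')
    show "(\<lambda>x. \<Sum>i\<in>UNIV. pdx (pdx \<psi> i) i x) \<in> borel_measurable borel"
      by (intro borel_measurable_sum measurable_test_fn test_fn_pdx tf)
    show "(\<lambda>x. u x s) \<in> borel_measurable borel" using L2_u[of s] assms by (simp add: L2_def)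
  qed (use assms(1) in \<open>auto simp: eig_cut_def \<psi>_def\<close>)
  finally show ?thesis by (simp add: \<psi>_def)
qed

lemma DERIV_U:
  assumes "1 \<le> t" "t < T"
  shows "(U has_real_derivative V t) (at t within {1..<T})"
proof -
  \<comment> \<open>A truncation made for a later time is exact for s on both sides of t.\<close>
  obtain t' where t': "t < t'" "t' < T" using dense[OF assms(2)] by blast
  obtain \<Psi> where \<Psi>: "eig_cut t' \<Psi>" using eig_cut_exists[of t'] t' assms by auto
  have L2\<Psi>: "L2 (\<lambda>x :: real^'n. \<Psi> (x \<bullet> x))"
    using \<Psi> by (intro test_fn_L2) (simp add: eig_cut_def)
  have ev: "\<forall>\<^sub>F s in at t within {1..<T}. s \<in> {1..<T} \<and> s < t'"
  proof -
    have "\<forall>\<^sub>F s in at t within {1..<T}. s \<in> {..<t'}"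
      by (rule topological_tendstoD[OF tendsto_ident_at]) (use t' in auto)
    moreover have "\<forall>\<^sub>F s in at t within {1..<T}. s \<in> {1..<T}"
      by (simp add: eventually_at_filter)
    ultimately show ?thesis by eventually_elim auto
  qed
  have "((\<lambda>s. LINT x|lborel. (u x s - u x t) / (s - t) * \<Psi> (x \<bullet> x)) \<longlongrightarrow>
      (LINT x|lborel. v x t * \<Psi> (x \<bullet> x))) (at t within {1..<T})"
    using ev assms
    by (intro L2_tendsto_integral lim_v L2_v L2\<Psi>) (auto elim!: eventually_mono intro!: L2_quotient)
  also have "(LINT x|lborel. v x t * \<Psi> (x \<bullet> x)) = V t"
    using assms t' by (intro V_cut[OF \<Psi>]) auto
  finally have lim: "((\<lambda>s. LINT x|lborel. (u x s - u x t) / (s - t) * \<Psi> (x \<bullet> x)) \<longlongrightarrow> V t)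
    (at t within {1..<T})" .
  show ?thesis
    unfolding has_field_derivative_iff
  proof (rule Lim_transform_eventually[OF lim])
    show "\<forall>\<^sub>F s in at t within {1..<T}.
        (LINT x|lborel. (u x s - u x t) / (s - t) * \<Psi> (x \<bullet> x)) = (U s - U t) / (s - t)"
      using ev
    proof eventually_elim
      case (elim s)
      have i: "integrable lborel (\<lambda>x. u x s * \<Psi> (x \<bullet> x))" "integrable lborel (\<lambda>x. u x t * \<Psi> (x \<bullet> x))"
        using elim assms by (auto intro!: L2_mult_integrable L2_u L2\<Psi>)
      have "(LINT x|lborel. (u x s - u x t) / (s - t) * \<Psi> (x \<bullet> x)) =
          (LINT x|lborel. (u x s * \<Psi> (x \<bullet> x) - u x t * \<Psi> (x \<bullet> x)) / (s - t))"
        by (simp add: left_diff_distrib)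
      also have "\<dots> = (U s - U t) / (s - t)"
        using i U_cut[OF \<Psi>, of s] U_cut[OF \<Psi>, of t] elim assms t' by simp
      finally show ?case .
    qed
  qed
qed

lemma cont_V: "continuous_on {1..<T} V"
  unfolding continuous_on_def
proof
  fix t assume "t \<in> {1..<T}"
  hence t: "1 \<le> t" "t < T" by auto
  obtain t' where t': "t < t'" "t' < T" using dense[OF t(2)] by blast
  obtain \<Psi> where \<Psi>: "eig_cut t' \<Psi>" using eig_cut_exists[of t'] t' t by auto
  have L2\<Psi>: "L2 (\<lambda>x :: real^'n. \<Psi> (x \<bullet> x))"
    using \<Psi> by (intro test_fn_L2) (simp add: eig_cut_def)
  have ev: "\<forall>\<^sub>F s in at t within {1..<T}. s \<in> {1..<T} \<and> s < t'"
  proof -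
    have "\<forall>\<^sub>F s in at t within {1..<T}. s \<in> {..<t'}"
      by (rule topological_tendstoD[OF tendsto_ident_at]) (use t' in auto)
    moreover have "\<forall>\<^sub>F s in at t within {1..<T}. s \<in> {1..<T}"
      by (simp add: eventually_at_filter)
    ultimately show ?thesis by eventually_elim auto
  qed
  have "((\<lambda>s. LINT x|lborel. v x s * \<Psi> (x \<bullet> x)) \<longlongrightarrow> (LINT x|lborel. v x t * \<Psi> (x \<bullet> x))) (at t within {1..<T})"
    using ev t
    by (intro L2_tendsto_integral cont_v L2_v L2\<Psi>) (auto elim!: eventually_mono intro!: L2_v)
  also have "(LINT x|lborel. v x t * \<Psi> (x \<bullet> x)) = V t"
    using t t' by (intro V_cut[OF \<Psi>]) auto
  finally have lim: "((\<lambda>s. LINT x|lborel. v x s * \<Psi> (x \<bullet> x)) \<longlongrightarrow> V t) (at t within {1..<T})" .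
  show "(V \<longlongrightarrow> V t) (at t within {1..<T})"
    by (rule Lim_transform_eventually[OF lim])
      (use ev in \<open>auto elim!: eventually_mono intro!: V_cut[OF \<Psi>]\<close>)
qed

lemma cont_U: "continuous_on {1..<T} U"
  by (rule continuous_on_vector_derivative[where f' = V])
    (use DERIV_U in \<open>auto simp: has_real_derivative_iff_has_vector_derivative[symmetric]\<close>)

lemma U_1: "U 1 = \<epsilon> * (LINT x|lborel. u0 x * eig x)"
proof -
  have "U 1 = (LINT x|lborel. \<epsilon> * (u0 x * eig x))"
    unfolding U_def
  proof (rule integral_cong_AE)
    show "AE x in lborel. u x 1 * eig x = \<epsilon> * (u0 x * eig x)"
      using init by eventually_elim simp
  qed (use L2_u[of 1] u0 T in \<open>auto simp: L2_def\<close>)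
  thus ?thesis by simp
qed

text \<open>The time factor \<eta> is left general because the initial value and the increments of
  \<open>V\<close> need different ones.\<close>

lemma weak_identity:
  assumes \<Psi>: "eig_cut t \<Psi>" and t: "1 \<le> \<tau>" "\<tau> \<le> t" "t < T"
    and \<eta>: "smooth_fun \<eta>" "T' < T" "\<And>s. T' \<le> s \<Longrightarrow> \<eta> s = 0"
  shows "V \<tau> * \<eta> \<tau> - \<epsilon> * (LINT x|lborel. u1 x * eig x) * \<eta> 1 =
    (LINT s:{1..\<tau>}|lborel. V s * deriv \<eta> s + ((s powr (2 * m) - \<nu>\<^sup>2 / s\<^sup>2) * U s - \<mu> / s * V s) * \<eta> s) +
    (LINT s:{1..\<tau>}|lborel. (LINT x|lborel. \<bar>v x s\<bar> powr p * \<Psi> (x \<bullet> x)) * \<eta> s)"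
proof -
  define \<Phi> where "\<Phi> = (\<lambda>(x :: real^'n) s. \<Psi> (x \<bullet> x) * \<eta> s)"
  have s\<Psi>: "smooth_fun \<Psi>" and tf: "test_fn (\<lambda>x :: real^'n. \<Psi> (x \<bullet> x))"
    using \<Psi> by (auto simp: eig_cut_def)
  obtain r where r: "\<And>x :: real^'n. r \<le> norm x \<Longrightarrow> \<Psi> (x \<bullet> x) = 0"
    using tf by (auto simp: test_fn_def)
  have \<Phi>: "test_fn_T T \<Phi>" "\<And>x s. dt_T \<Phi> x s = \<Psi> (x \<bullet> x) * deriv \<eta> s"
    "\<And>i x s. dx_T \<Phi> i x s = pdx (\<lambda>x. \<Psi> (x \<bullet> x)) i x * \<eta> s"
    unfolding \<Phi>_def by (rule test_fn_T_radial[OF s\<Psi> \<eta> r]; assumption)+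
  have sT: "1 \<le> s" "s \<le> t" "s < T" if "s \<in> {1..\<tau>}" for s using that t by auto
  have e1: "(LINT x|lborel. v x \<tau> * \<Phi> x \<tau>) = V \<tau> * \<eta> \<tau>"
    using V_cut[OF \<Psi> t(1,2)] t by (simp add: \<Phi>_def mult.assoc[symmetric])
  have e2: "(LINT x|lborel. u1 x * \<Phi> x 1) = (LINT x|lborel. u1 x * eig x) * \<eta> 1"
    using u1_cut[OF \<Psi>] t by (simp add: \<Phi>_def mult.assoc[symmetric])
  have e3: "(LINT s:{1..\<tau>}|lborel. (LINT x|lborel. v x s * dt_T \<Phi> x s)) =
      (LINT s:{1..\<tau>}|lborel. V s * deriv \<eta> s)"
    by (rule set_lebesgue_integral_cong)
      (auto simp: \<Phi>(2) mult.assoc[symmetric] V_cut[OF \<Psi> sT])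
  have e4: "(LINT s:{1..\<tau>}|lborel. (LINT x|lborel. s powr (2 * m) * (\<Sum>i\<in>UNIV. G x s $ i * dx_T \<Phi> i x s))) =
      (LINT s:{1..\<tau>}|lborel. - (s powr (2 * m) * U s * \<eta> s))"
  proof (rule set_lebesgue_integral_cong)
    show "\<forall>s. s \<in> {1..\<tau>} \<longrightarrow> (LINT x|lborel. s powr (2 * m) * (\<Sum>i\<in>UNIV. G x s $ i * dx_T \<Phi> i x s)) =
        - (s powr (2 * m) * U s * \<eta> s)"
    proof (intro allI impI)
      fix s assume s: "s \<in> {1..\<tau>}"
      have "(\<Sum>i\<in>UNIV. G x s $ i * dx_T \<Phi> i x s) =
          (\<Sum>i\<in>UNIV. G x s $ i * pdx (\<lambda>x. \<Psi> (x \<bullet> x)) i x) * \<eta> s" for x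
        by (simp add: \<Phi>(3) sum_distrib_right mult.assoc)
      thus "(LINT x|lborel. s powr (2 * m) * (\<Sum>i\<in>UNIV. G x s $ i * dx_T \<Phi> i x s)) =
        - (s powr (2 * m) * U s * \<eta> s)"
        using grad_cut[OF \<Psi> sT[OF s]] by simp
    qed
  qed auto
  have e5: "(LINT s:{1..\<tau>}|lborel. (LINT x|lborel. \<mu> / s * v x s * \<Phi> x s)) =
      (LINT s:{1..\<tau>}|lborel. \<mu> / s * V s * \<eta> s)"
  proof (rule set_lebesgue_integral_cong)
    show "\<forall>s. s \<in> {1..\<tau>} \<longrightarrow> (LINT x|lborel. \<mu> / s * v x s * \<Phi> x s) = \<mu> / s * V s * \<eta> s"
    proof (intro allI impI)
      fix s assume s: "s \<in> {1..\<tau>}"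
      have "(\<lambda>x. \<mu> / s * v x s * \<Phi> x s) = (\<lambda>x. (\<mu> / s * \<eta> s) * (v x s * \<Psi> (x \<bullet> x)))"
        by (simp add: \<Phi>_def mult_ac)
      thus "(LINT x|lborel. \<mu> / s * v x s * \<Phi> x s) = \<mu> / s * V s * \<eta> s"
        by (simp only: integral_mult_right_zero V_cut[OF \<Psi> sT[OF s]]) (simp only: mult_ac)
    qed
  qed auto
  have e6: "(LINT s:{1..\<tau>}|lborel. (LINT x|lborel. \<nu>^2 / s^2 * u x s * \<Phi> x s)) =
      (LINT s:{1..\<tau>}|lborel. \<nu>\<^sup>2 / s\<^sup>2 * U s * \<eta> s)"
  proof (rule set_lebesgue_integral_cong)
    show "\<forall>s. s \<in> {1..\<tau>} \<longrightarrow> (LINT x|lborel. \<nu>^2 / s^2 * u x s * \<Phi> x s) = \<nu>\<^sup>2 / s\<^sup>2 * U s * \<eta> s"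
    proof (intro allI impI)
      fix s assume s: "s \<in> {1..\<tau>}"
      have "(\<lambda>x. \<nu>^2 / s^2 * u x s * \<Phi> x s) = (\<lambda>x. (\<nu>\<^sup>2 / s\<^sup>2 * \<eta> s) * (u x s * \<Psi> (x \<bullet> x)))"
        by (simp add: \<Phi>_def mult_ac)
      thus "(LINT x|lborel. \<nu>^2 / s^2 * u x s * \<Phi> x s) = \<nu>\<^sup>2 / s\<^sup>2 * U s * \<eta> s"
        by (simp only: integral_mult_right_zero U_cut[OF \<Psi> sT[OF s]]) (simp only: mult_ac)
    qed
  qed auto
  have e7: "(LINT s:{1..\<tau>}|lborel. (LINT x|lborel. \<bar>v x s\<bar> powr p * \<Phi> x s)) =
      (LINT s:{1..\<tau>}|lborel. (LINT x|lborel. \<bar>v x s\<bar> powr p * \<Psi> (x \<bullet> x)) * \<eta> s)"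
    by (simp add: \<Phi>_def mult.assoc[symmetric])
  have cUV: "continuous_on {1..\<tau>} U" "continuous_on {1..\<tau>} V"
    using cont_U cont_V t by (auto elim!: continuous_on_subset)
  have c\<eta>: "continuous_on {1..\<tau>} \<eta>" "continuous_on {1..\<tau>} (deriv \<eta>)"
    using \<eta>(1) by (auto intro: smooth_fun_continuous_on smooth_fun_deriv)
  have nz: "s \<noteq> 0" if "s \<in> {1..\<tau>}" for s :: real using that by auto
  have si1: "set_integrable lborel {1..\<tau>} (\<lambda>s. V s * deriv \<eta> s)"
    by (intro borel_integrable_atLeastAtMost' continuous_on_mult cUV c\<eta>)
  have si2: "set_integrable lborel {1..\<tau>} (\<lambda>s. s powr (2 * m) * U s * \<eta> s)"
    by (intro borel_integrable_atLeastAtMost' continuous_on_mult cUV c\<eta> continuous_on_powr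
        continuous_on_id continuous_on_const) (use nz in blast)
  have si3: "set_integrable lborel {1..\<tau>} (\<lambda>s. \<mu> / s * V s * \<eta> s)"
    by (intro borel_integrable_atLeastAtMost' continuous_on_mult cUV c\<eta> continuous_on_divide
        continuous_on_id continuous_on_const) (use nz in blast)
  have si4: "set_integrable lborel {1..\<tau>} (\<lambda>s. \<nu>\<^sup>2 / s\<^sup>2 * U s * \<eta> s)"
    by (intro borel_integrable_atLeastAtMost' continuous_on_mult cUV c\<eta> continuous_on_divide
        continuous_on_power continuous_on_id continuous_on_const) (use nz in auto)
  note si = si1 si2 si3 si4
  have "(LINT s:{1..\<tau>}|lborel. V s * deriv \<eta> s + ((s powr (2 * m) - \<nu>\<^sup>2 / s\<^sup>2) * U s - \<mu> / s * V s) * \<eta> s) =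
     (LINT s:{1..\<tau>}|lborel. ((V s * deriv \<eta> s + s powr (2 * m) * U s * \<eta> s) - \<nu>\<^sup>2 / s\<^sup>2 * U s * \<eta> s)
        - \<mu> / s * V s * \<eta> s)"
    by (simp add: algebra_simps)
  also have "\<dots> = (LINT s:{1..\<tau>}|lborel. V s * deriv \<eta> s) + (LINT s:{1..\<tau>}|lborel. s powr (2 * m) * U s * \<eta> s)
     - (LINT s:{1..\<tau>}|lborel. \<nu>\<^sup>2 / s\<^sup>2 * U s * \<eta> s) - (LINT s:{1..\<tau>}|lborel. \<mu> / s * V s * \<eta> s)"
    using si by (simp add: set_integral_add set_integral_diff)
  finally have lin: "(LINT s:{1..\<tau>}|lborel. V s * deriv \<eta> s + ((s powr (2 * m) - \<nu>\<^sup>2 / s\<^sup>2) * U s - \<mu> / s * V s) * \<eta> s) =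
     (LINT s:{1..\<tau>}|lborel. V s * deriv \<eta> s) + (LINT s:{1..\<tau>}|lborel. s powr (2 * m) * U s * \<eta> s)
     - (LINT s:{1..\<tau>}|lborel. \<nu>\<^sup>2 / s\<^sup>2 * U s * \<eta> s) - (LINT s:{1..\<tau>}|lborel. \<mu> / s * V s * \<eta> s)" .
  have neg: "(LINT s:{1..\<tau>}|lborel. - (s powr (2 * m) * U s * \<eta> s)) = - (LINT s:{1..\<tau>}|lborel. s powr (2 * m) * U s * \<eta> s)"
    by (simp add: set_lebesgue_integral_def)
  show ?thesis
    using weak[OF \<Phi>(1) t(1) le_less_trans[OF t(2,3)]]
    unfolding e1 e2 e3 e4 e5 e6 e7 lin neg by (simp add: mult.assoc)
qed

text \<open>The initial value of u_t is encoded only in the weak formulation. At \<tau> = 1 all time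
  integrals extend over one point and vanish, which isolates it.\<close>

lemma V_1: "V 1 = \<epsilon> * (LINT x|lborel. u1 x * eig x)"
proof -
  obtain T' where T': "1 < T'" "T' < T" using dense[OF T] by blast
  obtain \<eta> :: "real \<Rightarrow> real" where \<eta>: "smooth_fun \<eta>" "\<And>x. x \<le> 1 \<Longrightarrow> \<eta> x = 1" "\<And>x. T' \<le> x \<Longrightarrow> \<eta> x = 0"
    using smooth_cutoff_exists[OF T'(1)] by metis
  obtain \<Psi> where \<Psi>: "eig_cut 1 \<Psi>" using eig_cut_exists[of 1] by auto
  have "AE s in lborel. s \<noteq> (1 :: real)" by (rule AE_lborel_singleton)
  hence z: "(LINT s:{1..1}|lborel. f s) = 0" for f :: "real \<Rightarrow> real"
    unfolding set_lebesgue_integral_def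
    by (intro integral_eq_zero_AE) (erule eventually_mono, simp add: indicator_def)
  show ?thesis
    using weak_identity[OF \<Psi> order_refl order_refl T \<eta>(1) T'(2) \<eta>(3)] \<eta>(2)[of 1] unfolding z by simp
qed

end

lemma set_integrable_mult_continuous:
  fixes f w :: "'a::euclidean_space \<Rightarrow> real"
  assumes "compact K" "continuous_on K w" "set_integrable lborel K f"
  shows "set_integrable lborel K (\<lambda>x. f x * w x)"
proof -
  have "bounded (w ` K)"
    using assms by (intro compact_imp_bounded compact_continuous_image)
  then obtain B where B: "\<And>x. x \<in> K \<Longrightarrow> \<bar>w x\<bar> \<le> B"
    by (auto simp: bounded_iff)
  have K: "K \<in> sets borel" using assms(1) by (simp add: borel_compact)
  have wm: "(\<lambda>x. indicator K x *\<^sub>R w x) \<in> borel_measurable borel"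
    by (rule borel_measurable_continuous_on_indicator[OF K assms(2)])
  have fi: "integrable lborel (\<lambda>x. indicator K x *\<^sub>R f x)"
    using assms(3) by (simp add: set_integrable_def)
  have "integrable lborel (\<lambda>x. (indicator K x *\<^sub>R f x) * (indicator K x *\<^sub>R w x))"
  proof (rule Bochner_Integration.integrable_bound[OF integrable_mult_right[OF fi, of B]])
    show "(\<lambda>x. (indicator K x *\<^sub>R f x) * (indicator K x *\<^sub>R w x)) \<in> borel_measurable lborel"
      using borel_measurable_times[OF borel_measurable_integrable[OF fi]] wm by simp
    have "\<bar>f x * w x\<bar> \<le> \<bar>B * f x\<bar>" if "x \<in> K" for x
      using mult_left_mono[OF order_trans[OF B[OF that] abs_ge_self[of B]], of "\<bar>f x\<bar>"]
      by (simp add: abs_mult mult.commute)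
    thus "AE x in lborel. norm ((indicator K x *\<^sub>R f x) * (indicator K x *\<^sub>R w x)) \<le> norm (B * (indicator K x *\<^sub>R f x))"
      by (intro always_eventually) (auto simp: indicator_def)
  qed
  moreover have "(\<lambda>x. (indicator K x *\<^sub>R f x) * (indicator K x *\<^sub>R w x)) = (\<lambda>x. indicator K x *\<^sub>R (f x * w x))"
    by (auto simp: indicator_def)
  ultimately show ?thesis by (simp add: set_integrable_def)
qed

section \<open>Lower bound of the nonlinear term and the inequality for V\<close>

context tricomi_weak_solution
begin

lemma continuous_on_power_weight:
  assumes "continuous_on S V" "S \<subseteq> {1..}"
  shows "continuous_on S (\<lambda>s. c * \<bar>V s\<bar> powr p * (exp (phi_m m s) * s powr d) powr (1 - p))"
proof -
  have "continuous_on S (\<lambda>s. \<bar>V s\<bar> powr p)"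
    using assms p by (intro continuous_on_powr' continuous_on_rabs continuous_on_const) auto
  moreover have "continuous_on S (\<lambda>s. (exp (phi_m m s) * s powr d) powr (1 - p))"
    unfolding phi_m_def using assms(2) m by (intro continuous_intros) auto
  ultimately show ?thesis by (intro continuous_on_mult continuous_on_const)
qed

text \<open>Fubini on a cylinder over [a, t] with a > 1, where the local integrability applies; it
  yields integrable space slices for almost every s only.\<close>

lemma nonlinearity_integrable:
  assumes \<Psi>: "eig_cut t \<Psi>" and t: "1 < a" "t < T"
  shows "set_integrable lborel {a..t} (\<lambda>s. LINT x|lborel. \<bar>v x s\<bar> powr p * \<Psi> (x \<bullet> x))"
    and "AE s in lborel. s \<in> {a..t} \<longrightarrow> integrable lborel (\<lambda>x. \<bar>v x s\<bar> powr p * \<Psi> (x \<bullet> x))"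
proof -
  obtain r where r: "\<And>x :: real^'n. r \<le> norm x \<Longrightarrow> \<Psi> (x \<bullet> x) = 0"
    using \<Psi> by (auto simp: eig_cut_def test_fn_def)
  define K where "K = cball (0 :: real^'n) r \<times> {a..t}"
  have K: "compact K" unfolding K_def by (intro compact_Times compact_cball compact_Icc)
  have "smooth_fun \<Psi>" using \<Psi> by (simp add: eig_cut_def)
  hence "continuous_on K (\<lambda>z. \<Psi> (fst z \<bullet> fst z))"
    by (intro continuous_on_compose2[OF smooth_fun_continuous_on[of \<Psi> UNIV]] continuous_intros) auto
  moreover have "set_integrable lborel K (\<lambda>z. \<bar>v (fst z) (snd z)\<bar> powr p)"
    using t by (intro Lp_v K) (auto simp: K_def)
  ultimately have "set_integrable lborel K (\<lambda>z. \<bar>v (fst z) (snd z)\<bar> powr p * \<Psi> (fst z \<bullet> fst z))"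
    by (intro set_integrable_mult_continuous K)
  moreover have "(\<lambda>z. indicator K z *\<^sub>R (\<bar>v (fst z) (snd z)\<bar> powr p * \<Psi> (fst z \<bullet> fst z))) =
      (\<lambda>(x, s). indicator {a..t} s * (\<bar>v x s\<bar> powr p * \<Psi> (x \<bullet> x)))"
    using r by (auto simp: fun_eq_iff K_def indicator_def not_le intro: less_imp_le)
  ultimately have i: "integrable (lborel \<Otimes>\<^sub>M lborel)
      (\<lambda>(x, s). indicator {a..t} s * (\<bar>v x s\<bar> powr p * \<Psi> (x \<bullet> x)))"
    by (simp add: set_integrable_def lborel_prod)
  show "set_integrable lborel {a..t} (\<lambda>s. LINT x|lborel. \<bar>v x s\<bar> powr p * \<Psi> (x \<bullet> x))"
    using lborel_pair.integrable_snd[OF i] by (simp add: set_integrable_def)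
  show "AE s in lborel. s \<in> {a..t} \<longrightarrow> integrable lborel (\<lambda>x. \<bar>v x s\<bar> powr p * \<Psi> (x \<bullet> x))"
    using lborel_pair.AE_integrable_snd[OF i] by eventually_elim auto
qed

text \<open>The power mean inequality with weight \<open>eig\<close> on the ball of radius \<rho> s.
  The truncation belongs to the later time t, but the support of \<open>v\<close> allows the smaller
  ball, so that the mass at time s appears.\<close>

lemma nonlinearity_ge:
  assumes \<Psi>: "eig_cut t \<Psi>" and s: "1 \<le> s" "s \<le> t" "s < T"
    and int: "integrable lborel (\<lambda>x. \<bar>v x s\<bar> powr p * \<Psi> (x \<bullet> x))"
  shows "\<bar>V s\<bar> powr p * eig_mass TYPE('n) (\<rho> s) powr (1 - p) \<le> (LINT x|lborel. \<bar>v x s\<bar> powr p * \<Psi> (x \<bullet> x))"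
proof -
  define w where "w = (\<lambda>x :: real^'n. indicator (cball 0 (\<rho> s)) x * eig x)"
  have tf: "test_fn (\<lambda>x :: real^'n. \<Psi> (x \<bullet> x))" using \<Psi> by (simp add: eig_cut_def)
  have [measurable]: "(\<lambda>x :: real^'n. \<Psi> (x \<bullet> x)) \<in> borel_measurable borel"
    by (rule measurable_test_fn[OF tf])
  have [measurable]: "(\<lambda>x. v x s) \<in> borel_measurable borel"
    using L2_v[OF s(1,3)] by (simp add: L2_def)
  have [measurable]: "w \<in> borel_measurable borel"
    unfolding w_def
    by (intro borel_measurable_times borel_measurable_indicator borel_measurable_eig) simp
  have ae: "AE x in lborel. h (v x s) * \<Psi> (x \<bullet> x) = h (v x s) * w x" if "h 0 = 0" for h :: "real \<Rightarrow> real"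
    using supp_v[OF s(1,3)]
  proof eventually_elim
    case (elim x)
    show ?case
    proof (cases "norm x \<le> \<rho> s")
      case True
      hence "norm x \<le> \<rho> t" using \<rho>_mono[OF s(1,2)] by simp
      thus ?thesis using \<Psi> True by (simp add: eig_cut_def w_def)
    qed (use elim that in auto)
  qed
  have ae1: "AE x in lborel. \<bar>v x s\<bar> powr p * \<Psi> (x \<bullet> x) = \<bar>v x s\<bar> powr p * w x"
    using ae[of "\<lambda>y. \<bar>y\<bar> powr p"] by simp
  have ae2: "AE x in lborel. v x s * \<Psi> (x \<bullet> x) = v x s * w x"
    using ae[of "\<lambda>y. y"] by simp
  have i1: "integrable lborel (\<lambda>x. \<bar>v x s\<bar> powr p * w x)"
    using int by (subst (asm) integrable_cong_AE[OF _ _ ae1]) auto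
  have "integrable lborel (\<lambda>x. v x s * \<Psi> (x \<bullet> x))"
    using s by (intro L2_mult_integrable L2_v test_fn_L2 tf)
  hence i2: "integrable lborel (\<lambda>x. v x s * w x)"
    by (subst (asm) integrable_cong_AE[OF _ _ ae2]) auto
  have mass: "(LINT x|lborel. w x) = eig_mass TYPE('n) (\<rho> s)"
    by (simp add: w_def eig_mass_def set_lebesgue_integral_def)
  have "\<bar>LINT x|lborel. v x s * w x\<bar> powr p * (LINT x|lborel. w x) powr (1 - p)
      \<le> (LINT x|lborel. \<bar>v x s\<bar> powr p * w x)"
  proof (rule weighted_power_mean[OF p i1 i2])
    show "integrable lborel w"
      using set_integrable_eig[of "\<rho> s"] by (simp add: set_integrable_def w_def)
    show "0 < (LINT x|lborel. w x)"
      unfolding mass by (intro eig_mass_pos \<rho>_pos s)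
  qed (simp add: w_def)
  also have "(LINT x|lborel. v x s * w x) = (LINT x|lborel. v x s * \<Psi> (x \<bullet> x))"
    by (intro integral_cong_AE) (use ae2 in auto)
  also have "\<dots> = V s" by (rule V_cut[OF \<Psi> s])
  also have "(LINT x|lborel. \<bar>v x s\<bar> powr p * w x) = (LINT x|lborel. \<bar>v x s\<bar> powr p * \<Psi> (x \<bullet> x))"
    by (intro integral_cong_AE) (use ae1 in auto)
  finally show ?thesis unfolding mass .
qed

text \<open>The time cutoff vanishes near \<open>t = 1\<close>, where no local integrability of \<open>|v|\<close> to the power
  \<open>p\<close> is available.\<close>

lemma V_increment:
  assumes t: "1 < t1" "t1 < t2" "t2 < T"
    and C: "C > 0" "\<And>s. 1 \<le> s \<Longrightarrow> eig_mass TYPE('n) (\<rho> s) \<le> C * (exp (phi_m m s) * s powr d)"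
  shows "(LINT s:{t1<..t2}|lborel. ((s powr (2 * m) - \<nu>\<^sup>2 / s\<^sup>2) * U s - \<mu> / s * V s)
      + C powr (1 - p) * \<bar>V s\<bar> powr p * (exp (phi_m m s) * s powr d) powr (1 - p)) \<le> V t2 - V t1"
proof -
  define a where "a = (1 + t1) / 2"
  have a: "1 < a" "a < t1" using t by (auto simp: a_def)
  \<comment> \<open>\<eta> will be 1 up to \<open>T''\<close> and 0 from \<open>T'\<close> on: t2 <
    T'' keeps it constant near t2, and T' < T makes it admissible.\<close>
  obtain T' where T': "t2 < T'" "T' < T" using dense[OF t(3)] by blast
  obtain T'' where T'': "t2 < T''" "T'' < T'" using dense[OF T'(1)] by blast
  obtain \<Psi> where \<Psi>: "eig_cut t2 \<Psi>" using eig_cut_exists[of t2] t by auto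
  obtain \<zeta>1 :: "real \<Rightarrow> real" where \<zeta>1: "smooth_fun \<zeta>1" "\<And>x. x \<le> - t1 \<Longrightarrow> \<zeta>1 x = 1" "\<And>x. - a \<le> x \<Longrightarrow> \<zeta>1 x = 0"
    by (rule smooth_cutoff_exists[of "- t1" "- a"]) (use a in auto)
  obtain \<zeta>2 :: "real \<Rightarrow> real" where \<zeta>2: "smooth_fun \<zeta>2" "\<And>x. x \<le> T'' \<Longrightarrow> \<zeta>2 x = 1" "\<And>x. T' \<le> x \<Longrightarrow> \<zeta>2 x = 0"
    by (rule smooth_cutoff_exists[OF T''(2)]) blast
  define \<eta> where "\<eta> = (\<lambda>s. \<zeta>1 (- s) * \<zeta>2 s)"
  have s\<eta>: "smooth_fun \<eta>"
    unfolding \<eta>_def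
    by (intro smooth_fun_mult smooth_fun_compose[OF \<zeta>1(1) smooth_fun_bounded_linear] \<zeta>2(1)
        bounded_linear_minus bounded_linear_ident)
  have \<eta>_out: "\<eta> s = 0" if "T' \<le> s" for s using \<zeta>2(3)[OF that] by (simp add: \<eta>_def)
  have \<eta>_left: "\<eta> s = 0" if "s \<le> a" for s using \<zeta>1(3)[of "- s"] that by (simp add: \<eta>_def)
  have \<eta>_one: "\<eta> s = 1" if "t1 \<le> s" "s \<le> T''" for s using \<zeta>1(2)[of "- s"] \<zeta>2(2)[of s] that by (simp add: \<eta>_def)
  have \<eta>_deriv: "deriv \<eta> s = 0" if "s \<in> {t1<..t2}" for s
  proof (rule DERIV_imp_deriv)
    show "(\<eta> has_real_derivative 0) (at s)"
      by (rule has_field_derivative_transform_within_open[of "\<lambda>_. 1" 0 s "{t1<..<T''}"])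
        (use that T'' \<eta>_one in auto)
  qed
  define k where "k = (\<lambda>s. V s * deriv \<eta> s + ((s powr (2 * m) - \<nu>\<^sup>2 / s\<^sup>2) * U s - \<mu> / s * V s) * \<eta> s)"
  define N where "N = (\<lambda>s. LINT x|lborel. \<bar>v x s\<bar> powr p * \<Psi> (x \<bullet> x))"
  define L where "L = (\<lambda>s. (s powr (2 * m) - \<nu>\<^sup>2 / s\<^sup>2) * U s - \<mu> / s * V s)"
  define H where "H = (\<lambda>s. C powr (1 - p) * \<bar>V s\<bar> powr p * (exp (phi_m m s) * s powr d) powr (1 - p))"
  have cUV: "continuous_on {1..t2} U" "continuous_on {1..t2} V"
    using cont_U cont_V t by (auto elim!: continuous_on_subset)
  have cL: "continuous_on {1..t2} L"
    unfolding L_def by (intro continuous_intros cUV) auto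
  have k: "set_integrable lborel {1..t2} k"
    unfolding k_def
    by (intro borel_integrable_atLeastAtMost' continuous_on_add continuous_on_mult cUV cL[unfolded L_def]
        smooth_fun_continuous_on smooth_fun_deriv s\<eta>)
  have Na: "set_integrable lborel {a..t2} N"
    unfolding N_def by (rule nonlinearity_integrable(1)[OF \<Psi> a(1) t(3)])
  have N\<eta>: "set_integrable lborel {1..t2} (\<lambda>s. N s * \<eta> s)"
  proof -
    have "set_integrable lborel {a..t2} (\<lambda>s. N s * \<eta> s)"
      by (intro set_integrable_mult_continuous compact_Icc smooth_fun_continuous_on s\<eta> Na)
    moreover have "(\<lambda>s. indicator {a..t2} s *\<^sub>R (N s * \<eta> s)) = (\<lambda>s. indicator {1..t2} s *\<^sub>R (N s * \<eta> s))"
      using \<eta>_left a by (auto simp: fun_eq_iff indicator_def)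
    ultimately show ?thesis by (simp add: set_integrable_def)
  qed
  have w2: "V t2 * \<eta> t2 - \<epsilon> * (LINT x|lborel. u1 x * eig x) * \<eta> 1 =
      (LINT s:{1..t2}|lborel. k s) + (LINT s:{1..t2}|lborel. N s * \<eta> s)"
    unfolding k_def N_def
    by (rule weak_identity[OF \<Psi> _ _ t(3) s\<eta> T'(2) \<eta>_out]) (use t in auto)
  have w1: "V t1 * \<eta> t1 - \<epsilon> * (LINT x|lborel. u1 x * eig x) * \<eta> 1 =
      (LINT s:{1..t1}|lborel. k s) + (LINT s:{1..t1}|lborel. N s * \<eta> s)"
    unfolding k_def N_def
    by (rule weak_identity[OF \<Psi> _ _ t(3) s\<eta> T'(2) \<eta>_out]) (use t in auto)
  \<comment> \<open>Subtracting the identities at the two times removes the data term and leaves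
    integrals over (t1, t2], where \<eta> = 1 and its derivative is 0.\<close>
  have "V t2 - V t1 = ((LINT s:{1..t2}|lborel. k s) - (LINT s:{1..t1}|lborel. k s))
      + ((LINT s:{1..t2}|lborel. N s * \<eta> s) - (LINT s:{1..t1}|lborel. N s * \<eta> s))"
    using w1 w2 \<eta>_one[of t1] \<eta>_one[of t2] t T'' by simp
  also have "\<dots> = (LINT s:{t1<..t2}|lborel. k s) + (LINT s:{t1<..t2}|lborel. N s * \<eta> s)"
    using t by (subst (1 2) set_integral_Icc_diff) (auto intro: k N\<eta>)
  also have "(LINT s:{t1<..t2}|lborel. k s) = (LINT s:{t1<..t2}|lborel. L s)"
    by (rule set_lebesgue_integral_cong) (use T'' \<eta>_deriv \<eta>_one in \<open>auto simp: k_def L_def\<close>)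
  also have "(LINT s:{t1<..t2}|lborel. N s * \<eta> s) = (LINT s:{t1<..t2}|lborel. N s)"
    by (rule set_lebesgue_integral_cong) (use T'' \<eta>_one in auto)
  finally have eq: "V t2 - V t1 = (LINT s:{t1<..t2}|lborel. L s) + (LINT s:{t1<..t2}|lborel. N s)" .
  have Li: "set_integrable lborel {t1<..t2} L"
    by (rule set_integrable_subset[OF borel_integrable_atLeastAtMost'[OF cL]]) (use t in auto)
  have "continuous_on {1..t2} H"
    unfolding H_def by (intro continuous_on_power_weight cUV) auto
  hence Hi: "set_integrable lborel {t1<..t2} H"
    by (rule set_integrable_subset[OF borel_integrable_atLeastAtMost']) (use t in auto)
  have Ni: "set_integrable lborel {t1<..t2} N"
    by (rule set_integrable_subset[OF Na]) (use a in auto)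
  have "(LINT s:{t1<..t2}|lborel. H s) \<le> (LINT s:{t1<..t2}|lborel. N s)"
  proof (rule set_integral_mono_AE[OF Hi Ni])
    show "AE s \<in> {t1<..t2} in lborel. H s \<le> N s"
      using nonlinearity_integrable(2)[OF \<Psi> a(1) t(3)]
    proof eventually_elim
      case (elim s)
      show ?case
      proof
        assume s: "s \<in> {t1<..t2}"
        hence s1: "1 \<le> s" "s \<le> t2" "s < T" using t by auto
        have M: "eig_mass TYPE('n) (\<rho> s) > 0" by (intro eig_mass_pos \<rho>_pos s1)
        have "H s = \<bar>V s\<bar> powr p * (C * (exp (phi_m m s) * s powr d)) powr (1 - p)"
          by (simp add: H_def powr_mult)
        also have "\<dots> \<le> \<bar>V s\<bar> powr p * eig_mass TYPE('n) (\<rho> s) powr (1 - p)"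
          using C(2)[OF s1(1)] M p by (intro mult_left_mono powr_mono2') auto
        also have "\<dots> \<le> N s"
          unfolding N_def using elim s a by (intro nonlinearity_ge[OF \<Psi> s1]) auto
        finally show "H s \<le> N s" .
      qed
    qed
  qed
  hence "(LINT s:{t1<..t2}|lborel. L s + H s) \<le> V t2 - V t1"
    unfolding eq using set_integral_add(2)[OF Li Hi] by simp
  thus ?thesis by (simp only: L_def H_def)
qed

lemma rdini_V:
  assumes t: "1 \<le> t" "t < T"
    and C: "C > 0" "\<And>s. 1 \<le> s \<Longrightarrow> eig_mass TYPE('n) (\<rho> s) \<le> C * (exp (phi_m m s) * s powr d)"
  shows "rdini_ge V t ((t powr (2 * m) - \<nu>\<^sup>2 / t\<^sup>2) * U t - \<mu> / t * V t
      + C powr (1 - p) * \<bar>V t\<bar> powr p * (exp (phi_m m t) * t powr d) powr (1 - p))"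
proof (rule increments_imp_rdini_ge[OF cont_V _ _ t])
  show "continuous_on {1..<T} (\<lambda>t. (t powr (2 * m) - \<nu>\<^sup>2 / t\<^sup>2) * U t - \<mu> / t * V t
      + C powr (1 - p) * \<bar>V t\<bar> powr p * (exp (phi_m m t) * t powr d) powr (1 - p))"
    by (intro continuous_on_add[OF _ continuous_on_power_weight] continuous_intros cont_U cont_V) auto
qed (use V_increment[OF _ _ _ C] in blast)

end

section \<open>Lifespan estimates\<close>

text \<open>c may be negative, so positivity is seen only for the combined integrand, which is
  positive almost everywhere on a ball of positive measure.\<close>

lemma initial_mass_pos:
  fixes u0 u1 :: "real^'n \<Rightarrow> real"
  assumes R: "R > 0" and u: "L2 u0" "L2 u1"
    and supp: "AE x in lborel. R < norm x \<longrightarrow> u0 x = 0" "AE x in lborel. R < norm x \<longrightarrow> u1 x = 0"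
    and pos: "AE x in lborel. norm x < R \<longrightarrow> c * u0 x + u1 x > 0"
  shows "(LINT x|lborel. u1 x * eig x) + c * (LINT x|lborel. u0 x * eig x) > 0"
proof -
  define w where "w = (\<lambda>x :: real^'n. indicator (cball 0 R) x * eig x)"
  have L2w: "L2 w"
  proof -
    have "integrable lborel (\<lambda>x :: real^'n. indicator (cball 0 R) x *\<^sub>R (eig x)\<^sup>2)"
      by (intro borel_integrable_compact compact_cball continuous_intros continuous_on_eig)
    moreover have "(\<lambda>x :: real^'n. indicator (cball 0 R) x *\<^sub>R (eig x)\<^sup>2) = (\<lambda>x. (w x)\<^sup>2)"
      by (auto simp: w_def indicator_def)
    moreover have "w \<in> borel_measurable borel"
      unfolding w_def
      by (intro borel_measurable_times borel_measurable_indicator borel_measurable_eig) simp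
    ultimately show ?thesis by (simp add: L2_def)
  qed
  have cut: "(LINT x|lborel. f x * eig x) = (LINT x|lborel. f x * w x)"
    if "L2 f" "AE x in lborel. R < norm x \<longrightarrow> f x = 0" for f
  proof (rule integral_cong_AE)
    show "AE x in lborel. f x * eig x = f x * w x"
      using that(2) by eventually_elim (auto simp: w_def indicator_def)
  qed (use that L2w in \<open>auto simp: L2_def\<close>)
  have i: "integrable lborel (\<lambda>x. u0 x * w x)" "integrable lborel (\<lambda>x. u1 x * w x)"
    using u L2w by (auto intro: L2_mult_integrable)
  define g where "g = (\<lambda>x. u1 x * w x + c * (u0 x * w x))"
  have gi: "integrable lborel g" unfolding g_def using i by simp
  have eq: "(LINT x|lborel. u1 x * eig x) + c * (LINT x|lborel. u0 x * eig x) = (LINT x|lborel. g x)"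
    unfolding g_def cut[OF u(1) supp(1)] cut[OF u(2) supp(2)] using i by simp
  \<comment> \<open>Support and sign conditions leave out |x| = R, which is a null set.\<close>
  have "AE x in lborel. (x :: real^'n) \<notin> sphere 0 R"
    by (intro AE_not_in negligible_iff_null_sets[THEN iffD1, THEN null_sets_completion_iff[THEN iffD1, rotated]]
        negligible_sphere) simp
  hence g: "AE x in lborel. 0 \<le> g x \<and> (norm x < R \<longrightarrow> 0 < g x)"
    using supp pos
  proof eventually_elim
    case (elim x)
    have "g x = w x * (c * u0 x + u1 x)" by (simp add: g_def algebra_simps)
    moreover have "w x > 0" if "norm x < R" using that eig_pos[of x] by (simp add: w_def)
    ultimately show ?case using elim by (cases "norm x < R") (auto simp: w_def)
  qed
  have "(LINT x|lborel. g x) \<noteq> 0"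
  proof
    assume "(LINT x|lborel. g x) = 0"
    hence "AE x in lborel. g x = 0"
      using integral_nonneg_eq_0_iff_AE[OF gi] g by (auto elim!: eventually_mono)
    hence "AE x in lborel. (x :: real^'n) \<notin> ball 0 R"
      using g by eventually_elim auto
    hence "emeasure lborel (ball (0 :: real^'n) R) = 0"
      by (subst AE_iff_measurable[symmetric, of _ _ "\<lambda>x. x \<notin> ball 0 R"]) (auto simp del: mem_ball)
    moreover have "unit_ball_vol (real CARD('n)) * R ^ CARD('n) > 0" using R by simp
    ultimately show False using R by (simp add: emeasure_ball ennreal_eq_0_iff)
  qed
  moreover have "(LINT x|lborel. g x) \<ge> 0"
    using g by (intro integral_nonneg_AE) (auto elim!: eventually_mono)
  ultimately show ?thesis unfolding eq by simp
qed

section \<open>From the integral bound to explicit lifespans\<close>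

lemma le_powr_inverse:
  fixes x y \<beta> :: real
  assumes "x powr \<beta> \<le> y" "x \<ge> 0" "\<beta> > 0"
  shows "x \<le> y powr (1 / \<beta>)"
proof -
  have "(x powr \<beta>) powr (1 / \<beta>) \<le> y powr (1 / \<beta>)"
    using assms by (intro powr_mono2) auto
  thus ?thesis using assms by (simp add: powr_powr)
qed

text \<open>\<Theta> = t^\<beta> / \<beta> with \<beta> = 1 - \<kappa> (p - 1) / 2 > 0. For
  \<epsilon> <= 1 the power \<epsilon>^(1 - p) is at least 1 and absorbs t1^\<beta>; times before t1
  are covered by C >= t1.\<close>

lemma lifespan_subcritical:
  fixes t1 K p \<kappa> :: real
  assumes t1: "t1 \<ge> 1" and K: "K > 0" and p: "p > 1" and \<kappa>: "\<kappa> * (p - 1) < 2"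
  obtains C where "C > 0"
    "\<And>\<epsilon> T. 0 < \<epsilon> \<Longrightarrow> \<epsilon> \<le> 1 \<Longrightarrow>
      (\<And>\<Theta> t. t1 \<le> t \<Longrightarrow> t < T \<Longrightarrow>
        (\<And>t. 1 \<le> t \<Longrightarrow> (\<Theta> has_real_derivative t powr ((1 - p) * (\<kappa> / 2))) (at t)) \<Longrightarrow>
        \<Theta> t - \<Theta> t1 \<le> K * \<epsilon> powr (1 - p)) \<Longrightarrow>
      T \<le> C * \<epsilon> powr (- (2 * (p - 1) / (2 - \<kappa> * (p - 1))))"
proof -
  define \<beta> where "\<beta> = 1 + (1 - p) * (\<kappa> / 2)"
  have \<beta>2: "2 * \<beta> = 2 - \<kappa> * (p - 1)" by (simp add: \<beta>_def field_simps)
  have \<beta>: "\<beta> > 0" using \<beta>2 \<kappa> by simp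
  define A where "A = t1 powr \<beta> + \<beta> * K"
  have A: "A > 0" using K \<beta> t1 by (simp add: A_def add_pos_pos)
  define C where "C = max t1 (A powr (1 / \<beta>))"
  have C: "C > 0" "t1 \<le> C" "A powr (1 / \<beta>) \<le> C" using t1 by (auto simp: C_def)
  show ?thesis
  proof (rule that[OF C(1)])
    fix \<epsilon> T :: real
    assume \<epsilon>: "0 < \<epsilon>" "\<epsilon> \<le> 1"
      and bound: "\<And>\<Theta> t. t1 \<le> t \<Longrightarrow> t < T \<Longrightarrow>
        (\<And>t. 1 \<le> t \<Longrightarrow> (\<Theta> has_real_derivative t powr ((1 - p) * (\<kappa> / 2))) (at t)) \<Longrightarrow>
        \<Theta> t - \<Theta> t1 \<le> K * \<epsilon> powr (1 - p)"
    have ex: "- (2 * (p - 1) / (2 - \<kappa> * (p - 1))) = (1 - p) / \<beta>"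
      unfolding \<beta>2[symmetric] using \<beta> by (simp add: field_simps)
    have e1: "\<epsilon> powr (1 - p) \<ge> 1" "\<epsilon> powr ((1 - p) / \<beta>) \<ge> 1"
      using \<epsilon> p \<beta> powr_mono2'[of "1 - p" \<epsilon> 1] powr_mono2'[of "(1 - p) / \<beta>" \<epsilon> 1]
      by (auto simp: divide_le_0_iff)
    show "T \<le> C * \<epsilon> powr (- (2 * (p - 1) / (2 - \<kappa> * (p - 1))))"
      unfolding ex
    \<comment> \<open>The integral bound is available at times t < T only.\<close>
    proof (rule dense_le)
      fix t assume "t < T"
      show "t \<le> C * \<epsilon> powr ((1 - p) / \<beta>)"
      proof (cases "t1 \<le> t")
        case False
        hence "t \<le> C * 1" using C(2) by simp
        also have "\<dots> \<le> C * \<epsilon> powr ((1 - p) / \<beta>)" using C e1 by (intro mult_left_mono) auto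
        finally show ?thesis .
      next
        case True
        have "((\<lambda>t. t powr \<beta> / \<beta>) has_real_derivative t powr ((1 - p) * (\<kappa> / 2))) (at t)" if "1 \<le> t" for t
        proof -
          have "((\<lambda>t. t powr \<beta> / \<beta>) has_real_derivative (\<beta> * t powr (\<beta> - 1)) / \<beta>) (at t)"
            using that by (intro DERIV_cdivide has_real_derivative_powr) auto
          thus ?thesis using \<beta> by (simp add: \<beta>_def)
        qed
        from bound[OF True \<open>t < T\<close> this] have "t powr \<beta> / \<beta> - t1 powr \<beta> / \<beta> \<le> K * \<epsilon> powr (1 - p)" .
        hence "t powr \<beta> \<le> t1 powr \<beta> * 1 + \<beta> * K * \<epsilon> powr (1 - p)"
          using \<beta> by (simp add: field_simps)
        also have "\<dots> \<le> t1 powr \<beta> * \<epsilon> powr (1 - p) + \<beta> * K * \<epsilon> powr (1 - p)"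
          using e1 by (intro add_right_mono mult_left_mono) auto
        also have "\<dots> = A * \<epsilon> powr (1 - p)" by (simp add: A_def algebra_simps)
        finally have "t powr \<beta> \<le> A * \<epsilon> powr (1 - p)" .
        hence "t \<le> (A * \<epsilon> powr (1 - p)) powr (1 / \<beta>)"
          using True t1 \<beta> by (intro le_powr_inverse) auto
        also have "\<dots> = A powr (1 / \<beta>) * \<epsilon> powr ((1 - p) / \<beta>)"
          by (simp add: powr_mult powr_powr)
        also have "\<dots> \<le> C * \<epsilon> powr ((1 - p) / \<beta>)"
          using C by (intro mult_right_mono) auto
        finally show ?thesis .
      qed
    qed
  qed
qed

text \<open>The exponent of t is -1 here, so \<Theta> is the logarithm, and its bound
  exponentiates.\<close>

lemma lifespan_critical:
  fixes t1 K p \<kappa> :: real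
  assumes t1: "t1 \<ge> 1" and K: "K > 0" and p: "p > 1" and \<kappa>: "\<kappa> * (p - 1) = 2"
  obtains C where "C > 0"
    "\<And>\<epsilon> T. 0 < \<epsilon> \<Longrightarrow> \<epsilon> \<le> 1 \<Longrightarrow>
      (\<And>\<Theta> t. t1 \<le> t \<Longrightarrow> t < T \<Longrightarrow>
        (\<And>t. 1 \<le> t \<Longrightarrow> (\<Theta> has_real_derivative t powr ((1 - p) * (\<kappa> / 2))) (at t)) \<Longrightarrow>
        \<Theta> t - \<Theta> t1 \<le> K * \<epsilon> powr (1 - p)) \<Longrightarrow>
      T \<le> exp (C * \<epsilon> powr (- (p - 1)))"
proof -
  define C where "C = ln t1 + K"
  have lt: "ln t1 \<ge> 0" using t1 by simp
  have C: "C > 0" using K lt by (simp add: C_def)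
  have ex: "(1 - p) * (\<kappa> / 2) = - 1"
  proof -
    have "(1 - p) * (\<kappa> / 2) = - (\<kappa> * (p - 1)) / 2" by (simp add: field_simps)
    thus ?thesis unfolding \<kappa> by simp
  qed
  show ?thesis
  proof (rule that[OF C])
    fix \<epsilon> T :: real
    assume \<epsilon>: "0 < \<epsilon>" "\<epsilon> \<le> 1"
      and bound: "\<And>\<Theta> t. t1 \<le> t \<Longrightarrow> t < T \<Longrightarrow>
        (\<And>t. 1 \<le> t \<Longrightarrow> (\<Theta> has_real_derivative t powr ((1 - p) * (\<kappa> / 2))) (at t)) \<Longrightarrow>
        \<Theta> t - \<Theta> t1 \<le> K * \<epsilon> powr (1 - p)"
    have e1: "\<epsilon> powr (1 - p) \<ge> 1"
      using \<epsilon> p powr_mono2'[of "1 - p" \<epsilon> 1] by auto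
    have le: "ln t1 + K * \<epsilon> powr (1 - p) \<le> C * \<epsilon> powr (1 - p)"
      using mult_left_mono[OF e1 lt] by (simp add: C_def algebra_simps)
    show "T \<le> exp (C * \<epsilon> powr (- (p - 1)))"
    proof (rule dense_le)
      fix t assume "t < T"
      have ln: "ln t \<le> C * \<epsilon> powr (1 - p)" if "t > 0"
      proof (cases "t1 \<le> t")
        case False
        hence "ln t \<le> ln t1" using that by simp
        moreover have "0 \<le> K * \<epsilon> powr (1 - p)" using K by simp
        ultimately show ?thesis using le by linarith
      next
        case True
        have "(ln has_real_derivative t powr ((1 - p) * (\<kappa> / 2))) (at t)" if "1 \<le> t" for t :: real
          unfolding ex using that by (auto intro!: derivative_eq_intros simp: powr_minus divide_inverse)
        from bound[OF True \<open>t < T\<close> this] le show ?thesis by linarith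
      qed
      show "t \<le> exp (C * \<epsilon> powr (- (p - 1)))"
      proof (cases "t > 0")
        case True
        hence "t = exp (ln t)" by simp
        also have "\<dots> \<le> exp (C * \<epsilon> powr (- (p - 1)))" using ln[OF True] by simp
        finally show ?thesis .
      qed (use exp_gt_zero[of "C * \<epsilon> powr (- (p - 1))"] in linarith)
    qed
  qed
qed

text \<open>The scalar problem is fed with c0 = C^(1 - p), C being the constant of the mass bound,
  and its exponent (\<mu> - m) / 2 + d is \<kappa> / 2.\<close>

lemma weak_sol_lifespan:
  fixes u0 u1 :: "real^'n \<Rightarrow> real" and p m \<mu> \<nu> R :: real
  assumes p: "p > 1" and m: "m \<ge> 0"
    and \<delta>: "(\<mu> - 1)^2 - 4 * \<nu>^2 \<ge> 0" and R: "R > 0"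
    and u: "L2 u0" "L2 u1" and nonneg: "AE x in lborel. u0 x \<ge> 0"
    and supp: "AE x in lborel. R < norm x \<longrightarrow> u0 x = 0" "AE x in lborel. R < norm x \<longrightarrow> u1 x = 0"
    and pos: "AE x in lborel. norm x < R \<longrightarrow>
           (\<mu> - 1 - sqrt ((\<mu> - 1)^2 - 4 * \<nu>^2)) / 2 * u0 x + u1 x > 0"
  defines "\<kappa> \<equiv> (1 + m) * (real CARD('n) - 1) - m + \<mu>"
  obtains t1 K where "t1 \<ge> 1" "K > 0"
    "\<And>\<epsilon> T u \<Theta> t. 0 < \<epsilon> \<Longrightarrow> weak_sol m \<mu> \<nu> p \<epsilon> u0 u1 T u \<Longrightarrow>
      (\<forall>t\<in>{1..<T}. AE x in lborel. R + phi_m m t - phi_m m 1 < norm x \<longrightarrow> u x t = 0) \<Longrightarrow>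
      t1 \<le> t \<Longrightarrow> t < T \<Longrightarrow>
      (\<And>t. 1 \<le> t \<Longrightarrow> (\<Theta> has_real_derivative t powr ((1 - p) * (\<kappa> / 2))) (at t)) \<Longrightarrow>
      \<Theta> t - \<Theta> t1 \<le> K * \<epsilon> powr (1 - p)"
proof -
  define c where "c = (\<mu> - 1 - sqrt ((\<mu> - 1)^2 - 4 * \<nu>^2)) / 2"
  define d where "d = (1 + m) * (real CARD('n) - 1) / 2"
  define I0 I1 where "I0 = (LINT x|lborel. u0 x * eig x)" and "I1 = (LINT x|lborel. u1 x * eig x)"
  have I: "I1 + c * I0 > 0"
    unfolding I0_def I1_def by (rule initial_mass_pos[OF R u supp pos[folded c_def]])
  have I0: "I0 \<ge> 0"
    unfolding I0_def by (intro integral_nonneg_AE) (use nonneg in eventually_elim, simp)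
  obtain C where C: "C > 0"
    "\<And>t. t \<ge> 1 \<Longrightarrow> eig_mass TYPE('n) (R + phi_m m t) \<le> C * (exp (phi_m m t) * t powr d)"
    using eig_mass_le[OF m R, where 'n = 'n] unfolding d_def by blast
  have c0: "C powr (1 - p) > 0" using C by simp
  obtain t1 K where tK: "t1 \<ge> 1" "K > 0" and
    ode: "\<And>\<epsilon> T U V \<Theta> t. \<epsilon> > 0 \<Longrightarrow> t1 \<le> t \<Longrightarrow> t < T \<Longrightarrow>
      (\<And>t. 1 \<le> t \<Longrightarrow> t < T \<Longrightarrow> (U has_real_derivative V t) (at t within {1..<T})) \<Longrightarrow>
      continuous_on {1..<T} V \<Longrightarrow>
      (\<And>t. 1 \<le> t \<Longrightarrow> t < T \<Longrightarrow> rdini_ge V t ((t powr (2 * m) - \<nu>\<^sup>2 / t\<^sup>2) * U t - \<mu> / t * V t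
        + C powr (1 - p) * \<bar>V t\<bar> powr p * (exp (phi_m m t) * t powr d) powr (1 - p))) \<Longrightarrow>
      U 1 \<ge> 0 \<Longrightarrow> V 1 + c * U 1 = \<epsilon> * (I1 + c * I0) \<Longrightarrow>
      (\<And>t. 1 \<le> t \<Longrightarrow> (\<Theta> has_real_derivative t powr ((1 - p) * ((\<mu> - m) / 2 + d))) (at t)) \<Longrightarrow>
      \<Theta> t - \<Theta> t1 \<le> K * \<epsilon> powr (1 - p)"
    using tricomi_ode_lifespan[OF m \<delta> p c0 I, of d, folded c_def] by blast
  show ?thesis
  proof (rule that[OF tK])
    fix \<epsilon> T u \<Theta> t
    assume \<epsilon>: "0 < (\<epsilon>::real)" and sol: "weak_sol m \<mu> \<nu> p \<epsilon> u0 u1 T u"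
      and supp_u: "\<forall>t\<in>{1..<T}. AE x in lborel. R + phi_m m t - phi_m m 1 < norm x \<longrightarrow> u x t = 0"
      and t: "t1 \<le> t" "t < T"
      and \<Theta>: "\<And>t. 1 \<le> t \<Longrightarrow> (\<Theta> has_real_derivative t powr ((1 - p) * (\<kappa> / 2))) (at t)"
    obtain G v where "tricomi_weak_solution m \<mu> \<nu> p \<epsilon> R T u0 u1 u v G"
    proof -
      have mem: "s \<in> {1..<T}" if "1 \<le> s" "s < T" for s using that by simp
      from sol show thesis
        unfolding weak_sol_def
      proof (elim conjE exE, goal_cases)
        case (1 G v)
        have "tricomi_weak_solution m \<mu> \<nu> p \<epsilon> R T u0 u1 u v G"
          by unfold_locales (use 1 supp_u m p R u supp mem in \<open>blast+\<close>)
        thus ?case by (rule that)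
      qed
    qed
    then interpret tricomi_weak_solution m \<mu> \<nu> p \<epsilon> R T u0 u1 u v G .
    have \<kappa>: "\<kappa> / 2 = (\<mu> - m) / 2 + d" by (simp add: \<kappa>_def d_def field_simps)
    show "\<Theta> t - \<Theta> t1 \<le> K * \<epsilon> powr (1 - p)"
    proof (rule ode[OF \<epsilon> t, of U V])
      show "U 1 \<ge> 0" using \<epsilon> I0 by (simp add: U_1 I0_def)
      show "V 1 + c * U 1 = \<epsilon> * (I1 + c * I0)"
        by (simp add: U_1 V_1 I0_def I1_def algebra_simps)
      show "rdini_ge V s ((s powr (2 * m) - \<nu>\<^sup>2 / s\<^sup>2) * U s - \<mu> / s * V s
        + C powr (1 - p) * \<bar>V s\<bar> powr p * (exp (phi_m m s) * s powr d) powr (1 - p))"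
        if "1 \<le> s" "s < T" for s
        using that C by (intro rdini_V) (auto simp: \<rho>_def)
    qed (use DERIV_U cont_V \<Theta> in \<open>auto simp: \<kappa>\<close>)
  qed
qed

text \<open>Every T for which a solution exists on [1, T) obeys the bound; this bounds the maximal
  existence time and yields blow-up. The value \<epsilon>0 = 1 works, since small \<epsilon> serves
  only to absorb constants into \<epsilon>^(1 - p).\<close>

theorem theorem2p1:
  fixes u0 u1 :: "real^'n \<Rightarrow> real" and p m \<mu> \<nu> R :: real
  assumes "p > 1" and "m \<ge> 0" and "\<mu> \<ge> 0" and "\<nu> \<ge> 0"
    and "(\<mu> - 1)^2 - 4 * \<nu>^2 \<ge> 0" and "R > 0"
    and "H1 u0" and "L2 u1"
    and "AE x in lborel. u0 x \<ge> 0" and "AE x in lborel. u1 x \<ge> 0"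
    and "AE x in lborel. R < norm x \<longrightarrow> u0 x = 0"
    and "AE x in lborel. R < norm x \<longrightarrow> u1 x = 0"
    and "\<not> ((AE x in lborel. u0 x = 0) \<and> (AE x in lborel. u1 x = 0))"
    and "AE x in lborel. norm x < R \<longrightarrow>
           (\<mu> - 1 - sqrt ((\<mu> - 1)^2 - 4 * \<nu>^2)) / 2 * u0 x + u1 x > 0"
  shows "\<exists>\<epsilon>0>0. \<exists>C>0. \<forall>\<epsilon> T u. 0 < \<epsilon> \<and> \<epsilon> \<le> \<epsilon>0
           \<and> weak_sol m \<mu> \<nu> p \<epsilon> u0 u1 T u
           \<and> (\<forall>t\<in>{1..<T}. AE x in lborel. R + phi_m m t - phi_m m 1 < norm x \<longrightarrow> u x t = 0)
         \<longrightarrow>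
           (CARD('n) \<ge> 2 \<longrightarrow>
              (p < 1 + 2 / ((1 + m) * (real CARD('n) - 1) - m + \<mu>) \<longrightarrow>
                 T \<le> C * \<epsilon> powr (- (2 * (p - 1) / (2 - ((1 + m) * (real CARD('n) - 1) - m + \<mu>) * (p - 1)))))
            \<and> (p = 1 + 2 / ((1 + m) * (real CARD('n) - 1) - m + \<mu>) \<longrightarrow>
                 T \<le> exp (C * \<epsilon> powr (- (p - 1)))))
         \<and> (CARD('n) = 1 \<longrightarrow>
              ((\<mu> \<le> m \<or> (\<mu> > m \<and> p < 1 + 2 / (\<mu> - m))) \<longrightarrow>
                 T \<le> C * \<epsilon> powr (- (2 * (p - 1) / (2 - (\<mu> - m) * (p - 1)))))
            \<and> ((\<mu> > m \<and> p = 1 + 2 / (\<mu> - m)) \<longrightarrow>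
                 T \<le> exp (C * \<epsilon> powr (- (p - 1)))))"
proof -
  define \<kappa> where "\<kappa> = (1 + m) * (real CARD('n) - 1) - m + \<mu>"
  have "L2 u0" using assms(7) by (simp add: H1_def)
  then obtain t1 K where t1: "t1 \<ge> 1" and K: "K > 0" and bound:
    "\<And>\<epsilon> T u \<Theta> t. 0 < \<epsilon> \<Longrightarrow> weak_sol m \<mu> \<nu> p \<epsilon> u0 u1 T u \<Longrightarrow>
      (\<forall>t\<in>{1..<T}. AE x in lborel. R + phi_m m t - phi_m m 1 < norm x \<longrightarrow> u x t = 0) \<Longrightarrow>
      t1 \<le> t \<Longrightarrow> t < T \<Longrightarrow>
      (\<And>t. 1 \<le> t \<Longrightarrow> (\<Theta> has_real_derivative t powr ((1 - p) * (\<kappa> / 2))) (at t)) \<Longrightarrow>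
      \<Theta> t - \<Theta> t1 \<le> K * \<epsilon> powr (1 - p)"
    using weak_sol_lifespan[OF assms(1,2,5,6) _ assms(8,9,11,12,14), folded \<kappa>_def] by blast
  \<comment> \<open>One C must serve all cases. Each case constant exists unconditionally, as
    outside its range of exponents the implication is vacuous.\<close>
  have "\<exists>C1>0. \<forall>\<epsilon> T u. 0 < \<epsilon> \<and> \<epsilon> \<le> 1 \<and> weak_sol m \<mu> \<nu> p \<epsilon> u0 u1 T u \<and>
      (\<forall>t\<in>{1..<T}. AE x in lborel. R + phi_m m t - phi_m m 1 < norm x \<longrightarrow> u x t = 0) \<longrightarrow>
      \<kappa> * (p - 1) < 2 \<longrightarrow> T \<le> C1 * \<epsilon> powr (- (2 * (p - 1) / (2 - \<kappa> * (p - 1))))"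
  proof (cases "\<kappa> * (p - 1) < 2")
    case True
    show ?thesis
      by (rule lifespan_subcritical[OF t1 K assms(1) True]) (use bound in blast)
  qed (auto intro: exI[of _ 1])
  then obtain C1 where C1: "C1 > 0" "\<And>\<epsilon> T u. 0 < \<epsilon> \<Longrightarrow> \<epsilon> \<le> 1 \<Longrightarrow> weak_sol m \<mu> \<nu> p \<epsilon> u0 u1 T u \<Longrightarrow>
      (\<forall>t\<in>{1..<T}. AE x in lborel. R + phi_m m t - phi_m m 1 < norm x \<longrightarrow> u x t = 0) \<Longrightarrow>
      \<kappa> * (p - 1) < 2 \<Longrightarrow> T \<le> C1 * \<epsilon> powr (- (2 * (p - 1) / (2 - \<kappa> * (p - 1))))"
    by blast
  have "\<exists>C2>0. \<forall>\<epsilon> T u. 0 < \<epsilon> \<and> \<epsilon> \<le> 1 \<and> weak_sol m \<mu> \<nu> p \<epsilon> u0 u1 T u \<and>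
      (\<forall>t\<in>{1..<T}. AE x in lborel. R + phi_m m t - phi_m m 1 < norm x \<longrightarrow> u x t = 0) \<longrightarrow>
      \<kappa> * (p - 1) = 2 \<longrightarrow> T \<le> exp (C2 * \<epsilon> powr (- (p - 1)))"
  proof (cases "\<kappa> * (p - 1) = 2")
    case True
    show ?thesis
      by (rule lifespan_critical[OF t1 K assms(1) True]) (use bound in blast)
  qed (auto intro: exI[of _ 1])
  then obtain C2 where C2: "C2 > 0" "\<And>\<epsilon> T u. 0 < \<epsilon> \<Longrightarrow> \<epsilon> \<le> 1 \<Longrightarrow> weak_sol m \<mu> \<nu> p \<epsilon> u0 u1 T u \<Longrightarrow>
      (\<forall>t\<in>{1..<T}. AE x in lborel. R + phi_m m t - phi_m m 1 < norm x \<longrightarrow> u x t = 0) \<Longrightarrow>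
      \<kappa> * (p - 1) = 2 \<Longrightarrow> T \<le> exp (C2 * \<epsilon> powr (- (p - 1)))"
    by blast
  define C where "C = max C1 C2"
  have C: "C > 0" "C1 \<le> C" "C2 \<le> C" using C1(1) by (auto simp: C_def)
  have sub: "T \<le> C * \<epsilon> powr (- (2 * (p - 1) / (2 - \<kappa> * (p - 1))))"
    if "0 < \<epsilon>" "\<epsilon> \<le> 1" "weak_sol m \<mu> \<nu> p \<epsilon> u0 u1 T u"
      "\<forall>t\<in>{1..<T}. AE x in lborel. R + phi_m m t - phi_m m 1 < norm x \<longrightarrow> u x t = 0"
      "\<kappa> * (p - 1) < 2" for \<epsilon> T u
    by (rule order_trans[OF C1(2)[OF that] mult_right_mono[OF C(2)]]) simp
  have crit: "T \<le> exp (C * \<epsilon> powr (- (p - 1)))"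
    if "0 < \<epsilon>" "\<epsilon> \<le> 1" "weak_sol m \<mu> \<nu> p \<epsilon> u0 u1 T u"
      "\<forall>t\<in>{1..<T}. AE x in lborel. R + phi_m m t - phi_m m 1 < norm x \<longrightarrow> u x t = 0"
      "\<kappa> * (p - 1) = 2" for \<epsilon> T u
    by (rule order_trans[OF C2(2)[OF that]]) (use C(3) in \<open>simp add: mult_right_mono\<close>)
  \<comment> \<open>Passing from p < 1 + 2 / \<kappa> to \<kappa> (p - 1) < 2 requires \<kappa> > 0.
    This holds for N >= 2; for N = 1 with \<mu> <= m the product is nonpositive instead.\<close>
  have sub_iff: "\<kappa> * (p - 1) < 2" if "\<kappa> > 0" "p < 1 + 2 / \<kappa>"
    using that by (simp add: field_simps)
  have crit_iff: "\<kappa> * (p - 1) = 2" if "\<kappa> > 0" "p = 1 + 2 / \<kappa>"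
    using that by simp
  have \<kappa>_ge2: "\<kappa> > 0" if "CARD('n) \<ge> 2"
  proof -
    have "(1 + m) * 1 \<le> (1 + m) * (real CARD('n) - 1)"
      using that assms(2) by (intro mult_left_mono) auto
    thus ?thesis using assms(3) by (simp add: \<kappa>_def)
  qed
  have \<kappa>_1: "\<kappa> = \<mu> - m" if "CARD('n) = 1"
    using that by (simp add: \<kappa>_def)
  have sub_1: "\<kappa> * (p - 1) < 2" if "\<mu> \<le> m" "CARD('n) = 1"
  proof -
    have "\<kappa> * (p - 1) \<le> 0"
      using that assms(1) by (intro mult_nonpos_nonneg) (auto simp: \<kappa>_1)
    thus ?thesis by simp
  qed
  show ?thesis
  proof (rule exI[of _ 1], rule conjI[OF zero_less_one], rule exI[of _ C], rule conjI[OF C(1)],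
      intro conjI allI impI; (elim conjE)?)
    fix \<epsilon> T u
    assume a: "0 < \<epsilon>" "\<epsilon> \<le> 1" "weak_sol m \<mu> \<nu> p \<epsilon> u0 u1 T u"
      "\<forall>t\<in>{1..<T}. AE x in lborel. R + phi_m m t - phi_m m 1 < norm x \<longrightarrow> u x t = 0" and N: "2 \<le> CARD('n)"
    show "T \<le> C * \<epsilon> powr (- (2 * (p - 1) / (2 - ((1 + m) * (real CARD('n) - 1) - m + \<mu>) * (p - 1))))"
      if "p < 1 + 2 / ((1 + m) * (real CARD('n) - 1) - m + \<mu>)"
      using sub[OF a sub_iff[OF \<kappa>_ge2[OF N]]] that unfolding \<kappa>_def by blast
    show "T \<le> exp (C * \<epsilon> powr (- (p - 1)))"
      if "p = 1 + 2 / ((1 + m) * (real CARD('n) - 1) - m + \<mu>)"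
      using crit[OF a crit_iff[OF \<kappa>_ge2[OF N]]] that unfolding \<kappa>_def by blast
  next
    fix \<epsilon> T u
    assume a: "0 < \<epsilon>" "\<epsilon> \<le> 1" "weak_sol m \<mu> \<nu> p \<epsilon> u0 u1 T u"
      "\<forall>t\<in>{1..<T}. AE x in lborel. R + phi_m m t - phi_m m 1 < norm x \<longrightarrow> u x t = 0" and N: "CARD('n) = 1"
    show "T \<le> C * \<epsilon> powr (- (2 * (p - 1) / (2 - (\<mu> - m) * (p - 1))))"
      if "\<mu> \<le> m \<or> m < \<mu> \<and> p < 1 + 2 / (\<mu> - m)"
    proof -
      have "\<kappa> * (p - 1) < 2"
        using that sub_1[OF _ N] sub_iff unfolding \<kappa>_1[OF N] by auto
      from sub[OF a this] show ?thesis unfolding \<kappa>_1[OF N] .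
    qed
    show "T \<le> exp (C * \<epsilon> powr (- (p - 1)))" if "m < \<mu>" "p = 1 + 2 / (\<mu> - m)"
      using crit[OF a] crit_iff that unfolding \<kappa>_1[OF N] by auto
  qed
qed

end
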